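(* Let $\mathcal{U}$ be a Hilbert space, let $f$ be a holomorphic $L(\mathcal{U})$-valued function on $\Omega_N$, and let $\iota=\iota_{\mathcal{U}}$ be an anti-unitary involution (AUI) on $\mathcal{U}$. The following conditions are equivalent: (i) $f\in\iota\mathbb{R}\mathcal{B}_N(\mathcal{U})$; (ii) there exist a Hilbert space $\mathcal{H}$, a representation $f(z)=a(z)-b(z)d(z)^{-1}c(z)$, $z\in\Omega_N$, with $$A(z)=z_1A_1+\cdots+z_NA_N=\begin{bmatrix} a(z)&b(z)\\ c(z)&d(z)\end{bmatrix}\in L(\mathcal{U}\oplus\mathcal{H}),\quad z\in\Omega_N,$$ where the bounded operators $A_k=A_k^*$, $k=1,\ldots,N$, are positive semidefinite, and an AUI $\iota_{\mathcal{H}}$ on $\mathcal{H}$ such that the function $A(z)$ is $(\iota_{\mathcal{U}}\oplus\iota_{\mathcal{H}})$-real; (iii) there exist holomorphic PSD kernels $\Phi_k(z,\zeta)$, $k=1,\ldots,N$, on $\Pi^N\times\Pi^N$ which are $\iota_{\mathcal{U}}$-real and satisfy $f(z)=\sum_{k=1}^N z_k\Phi_k(z,\zeta)$, $(z,\zeta)\in\Pi^N\times\Pi^N$; (iv) the double Cayley transform $\mathcal{F}=\mathcal{C}(f)$ is well defined on $\mathbb{D}^N$, and there exist an Agler unitary colligation $\alpha=(N;U;\mathcal{X}=\bigoplus_{k=1}^N\mathcal{X}_k,\mathcal{U},\mathcal{U})$ with $U=U^*=\begin{bmatrix}A&B\\ C&D\end{bmatrix}$, the corresponding representation $$\mathcal{F}(w)=D+CP(w)(I_{\mathcal{X}}-AP(w))^{-1}B,\quad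 w\in\mathbb{D}^N,$$ and an AUI $\iota_{\mathcal{X}}$ on $\mathcal{X}$ which commutes with the orthogonal projectors $P_k=P_{\mathcal{X}_k}$, $k=1,\ldots,N$, such that the operator $U$ is $(\iota_{\mathcal{X}}\oplus\iota_{\mathcal{U}})$-real.
   Context: All Hilbert spaces are complex; $L(\mathcal{U})$ denotes the bounded linear operators on $\mathcal{U}$. $\Pi=\{z\in\mathbb{C}:\mathrm{Re}\,z>0\}$, $\mathbb{T}$ is the unit circle, $\mathbb{D}^N=\{w\in\mathbb{C}^N:|w_k|<1\}$, $\Omega_N=\bigcup_{\lambda\in\mathbb{T}}(\lambda\Pi)^N\subset\mathbb{C}^N$, $\bar z=(\overline{z_1},\ldots,\overline{z_N})$. Anti-unitary involution (AUI) on a Hilbert space $\mathcal{U}$: a map $\iota:\mathcal{U}\to\mathcal{U}$ with $\iota^2=I_{\mathcal{U}}$ and $\langle\iota u_1,\iota u_2\rangle=\langle u_2,u_1\rangle$ for all $u_1,u_2\in\mathcal{U}$ (it is automatically anti-linear). An operator $A\in L(\mathcal{U})$ is $\iota$-real if $\iota A=A\iota$. An $L(\mathcal{U})$-valued function $f$ on a conjugation-invariant domain is $\iota$-real if $f^\sharp=f$, where $f^\sharp(z)=\iota f(\bar z)\iota$; for a kernel on $\Pi^N\times\Pi^N$ this means $\iota\Phi(\bar z,\bar\zeta)\iota=\Phi(z,\zeta)$. The class $\mathcal{B}_N(\mathcal{U})$ consists of the $L(\mathcal{U})$-valued functions $f$ holomorphic on $\Omega_N$ and representable as $f(z)=a(z)-b(z)d(z)^{-1}c(z)$,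 $z\in\Omega_N$, where, for some Hilbert space $\mathcal{H}$, $A(z)=z_1A_1+\cdots+z_NA_N=\begin{bmatrix} a(z)&b(z)\\ c(z)&d(z)\end{bmatrix}\in L(\mathcal{U}\oplus\mathcal{H})$ with bounded positive semidefinite operators $A_k=A_k^*$ on $\mathcal{U}\oplus\mathcal{H}$ (and $d(z)$ boundedly invertible for $z\in\Omega_N$; the same is understood in (ii)). $\iota\mathbb{R}\mathcal{B}_N(\mathcal{U})$ is the subclass of $\iota$-real functions in $\mathcal{B}_N(\mathcal{U})$. Holomorphic PSD kernel on $\Omega\times\Omega$ ($\Omega\subset\mathbb{C}^N$ a domain): an $L(\mathcal{U})$-valued function $\Phi(z,\zeta)$ on $\Omega\times\Omega$, holomorphic in $z$ and anti-holomorphic in $\zeta$, with $\Phi(z,\zeta)=\Phi(\zeta,z)^*$ and $\sum_{\mu,\nu=1}^m\langle\Phi(z^{(\mu)},z^{(\nu)})u^{(\mu)},u^{(\nu)}\rangle\ge 0$ for all $m\in\mathbb{N}$, $z^{(\mu)}\in\Omega$, $u^{(\mu)}\in\mathcal{U}$. The double Cayley transform of $f$ is $\mathcal{C}(f)(w)=(F(w)-I_{\mathcal{U}})(F(w)+I_{\mathcal{U}})^{-1}$, $w\in\mathbb{D}^N$, where $F(w)=f\big(\tfrac{1+w_1}{1-w_1},\ldots,\tfrac{1+w_N}{1-w_N}\big)$; it is well defined when $F(w)+I_{\mathcal{U}}$ is boundedly invertible for every $w\in\mathbb{D}^N$. An Agler unitary colligation $\alpha=(N;U;\mathcal{X}=\bigoplus_{k=1}^N\mathcal{X}_k,\mathcal{U},\mathcal{U})$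 consists of Hilbert spaces $\mathcal{X}_1,\ldots,\mathcal{X}_N$, their orthogonal sum $\mathcal{X}$, and a unitary operator $U=\begin{bmatrix}A&B\\ C&D\end{bmatrix}\in L(\mathcal{X}\oplus\mathcal{U})$; $P_{\mathcal{X}_k}$ is the orthogonal projector of $\mathcal{X}$ onto $\mathcal{X}_k$ and $P(w)=\sum_{k=1}^N w_kP_{\mathcal{X}_k}$. *)

theory Defs
  imports "HOL-Analysis.Analysis"
begin

class scaleC =
  fixes scaleC :: "complex \<Rightarrow> 'a \<Rightarrow> 'a" (infixr \<open>*\<^sub>C\<close> 75)

class complex_vector = real_vector + scaleC +
  assumes scaleC_add_right: "c *\<^sub>C (x + y) = c *\<^sub>C x + c *\<^sub>C y"
    and scaleC_add_left: "(c + d) *\<^sub>C x = c *\<^sub>C x + d *\<^sub>C x"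
    and scaleC_scaleC: "c *\<^sub>C (d *\<^sub>C x) = (c * d) *\<^sub>C x"
    and scaleR_scaleC: "r *\<^sub>R x = complex_of_real r *\<^sub>C x"

text \<open>The inner product is linear in its \<^emph>\<open>first\<close> argument.  Positive definiteness is
  contained in \<open>norm_eq_sqrt_cinner\<close>, because \<^const>\<open>norm\<close> is a norm.\<close>

class complex_inner = complex_vector + real_normed_vector +
  fixes cinner :: "'a \<Rightarrow> 'a \<Rightarrow> complex"
  assumes cinner_commute: "cinner x y = cnj (cinner y x)"
    and cinner_add_left: "cinner (x + y) z = cinner x z + cinner y z"
    and cinner_scaleC_left: "cinner (c *\<^sub>C x) y = c * cinner x y"
    and norm_eq_sqrt_cinner: "norm x = sqrt (Re (cinner x x))"

class chilbert_space = complex_inner + banach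

lemma scaleC_one: "1 *\<^sub>C x = (x :: 'a::complex_vector)"
  by (metis of_real_1 scaleR_one scaleR_scaleC)

lemma cinner_scaleC_right: "cinner x (c *\<^sub>C y) = cnj c * cinner x (y :: 'a::complex_inner)"
  by (metis cinner_commute cinner_scaleC_left complex_cnj_mult)

lemma norm_scaleC: "norm (c *\<^sub>C x) = cmod c * norm (x :: 'a::complex_inner)"
proof -
  have "Im (cinner x x) = 0"
    by (metis Reals_cnj_iff cinner_commute complex_is_Real_iff)
  then have "cinner (c *\<^sub>C x) (c *\<^sub>C x) = complex_of_real ((cmod c)\<^sup>2 * Re (cinner x x))"
    by (simp add: cinner_scaleC_left cinner_scaleC_right complex_eq_iff cmod_power2)
       (simp add: algebra_simps power2_eq_square)
  then show ?thesis
    by (simp add: norm_eq_sqrt_cinner real_sqrt_mult)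
qed

lemma bounded_linear_scaleC: "bounded_linear (\<lambda>x :: 'a::complex_inner. c *\<^sub>C x)"
  by (rule bounded_linear_intro[where K = "cmod c"])
     (simp_all add: scaleC_add_right scaleR_scaleC scaleC_scaleC norm_scaleC mult.commute)

instantiation complex :: chilbert_space
begin
definition "scaleC_complex (c :: complex) x = c * x"
definition "cinner_complex (x :: complex) y = x * cnj y"
instance
  by standard
     (simp_all add: scaleC_complex_def cinner_complex_def algebra_simps scaleR_conv_of_real
       cmod_def power2_eq_square)
end

instantiation prod :: (complex_vector, complex_vector) complex_vector
begin
definition "scaleC_prod c x = (c *\<^sub>C fst x, c *\<^sub>C snd x)"
instance
  by standard
     (simp_all add: scaleC_prod_def prod_eq_iff scaleC_add_right scaleC_add_left scaleC_scaleC
       scaleR_scaleC)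
end

instantiation prod :: (complex_inner, complex_inner) complex_inner
begin
definition "cinner_prod x y = cinner (fst x) (fst y) + cinner (snd x) (snd y)"
instance
proof
  fix x y z :: "'a \<times> 'b" and c :: complex
  show "cinner x y = cnj (cinner y x)"
    by (simp add: cinner_prod_def cinner_commute[of "fst x"] cinner_commute[of "snd x"])
  show "cinner (x + y) z = cinner x z + cinner y z"
    by (simp add: cinner_prod_def cinner_add_left)
  show "cinner (c *\<^sub>C x) y = c * cinner x y"
    by (simp add: cinner_prod_def scaleC_prod_def cinner_scaleC_left algebra_simps)
  have *: "(norm u)\<^sup>2 = Re (cinner u u)" for u :: "'c::complex_inner"
    by (metis norm_eq_sqrt_cinner norm_ge_zero real_sqrt_ge_0_iff real_sqrt_pow2)
  show "norm x = sqrt (Re (cinner x x))"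
    by (simp add: norm_prod_def * cinner_prod_def)
qed
end

instance prod :: (chilbert_space, chilbert_space) chilbert_space ..

instantiation vec :: (complex_vector, finite) complex_vector
begin
definition "scaleC_vec c x = (\<chi> i. c *\<^sub>C x $ i)"
instance
  by standard
     (simp_all add: scaleC_vec_def vec_eq_iff scaleC_add_right scaleC_add_left scaleC_scaleC
       scaleR_scaleC)
end

instantiation vec :: (complex_inner, finite) complex_inner
begin
definition "cinner_vec x y = (\<Sum>i\<in>UNIV. cinner (x $ i) (y $ i))"
instance
proof
  fix x y z :: "'a ^ 'b" and c :: complex
  show "cinner x y = cnj (cinner y x)"
    unfolding cinner_vec_def cnj_sum by (rule sum.cong) (auto intro: cinner_commute)
  show "cinner (x + y) z = cinner x z + cinner y z"
    by (simp add: cinner_vec_def cinner_add_left sum.distrib)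
  show "cinner (c *\<^sub>C x) y = c * cinner x y"
    by (simp add: cinner_vec_def scaleC_vec_def cinner_scaleC_left sum_distrib_left)
  have *: "(norm u)\<^sup>2 = Re (cinner u u)" for u :: "'c::complex_inner"
    by (metis norm_eq_sqrt_cinner norm_ge_zero real_sqrt_ge_0_iff real_sqrt_pow2)
  show "norm x = sqrt (Re (cinner x x))"
    by (simp add: norm_vec_def L2_set_def * cinner_vec_def)
qed
end

instance vec :: (chilbert_space, finite) chilbert_space ..

text \<open>The library type of (real-)linear bounded operators becomes a complex vector space through
  its codomain; \<open>L(\<U>)\<close> consists of its complex linear elements (\<open>clinear\<close> below).\<close>

instantiation blinfun :: (real_normed_vector, complex_inner) complex_vector
begin
lift_definition scaleC_blinfun :: "complex \<Rightarrow> ('a \<Rightarrow>\<^sub>L 'b) \<Rightarrow> ('a \<Rightarrow>\<^sub>L 'b)" is "\<lambda>c f x. c *\<^sub>C f x"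
  by (rule bounded_linear_compose[OF bounded_linear_scaleC])
instance
  by standard
     (transfer, simp add: fun_eq_iff scaleC_add_right scaleC_add_left scaleC_scaleC scaleR_scaleC)+
end

typedef 'i ell2 = "{x :: 'i \<Rightarrow> complex. (\<lambda>i. (cmod (x i))\<^sup>2) summable_on UNIV}"
  morphisms ell2_nth Abs_ell2
  by (rule exI[of _ "\<lambda>_. 0"]) simp

setup_lifting type_definition_ell2

lemma ell2_boundI:
  assumes "\<And>F. finite F \<Longrightarrow> L2_set (\<lambda>i. cmod (x i)) F \<le> B"
  shows "(\<lambda>i. (cmod (x i))\<^sup>2) summable_on UNIV" "sqrt (\<Sum>\<^sub>\<infinity>i. (cmod (x i))\<^sup>2) \<le> B"
proof -
  have B: "0 \<le> B" using assms[of "{}"] by simp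
  have le: "(\<Sum>i\<in>F. (cmod (x i))\<^sup>2) \<le> B\<^sup>2" if "finite F" for F
    using assms[OF that] unfolding L2_set_def
    by (metis real_sqrt_le_iff real_sqrt_abs abs_of_nonneg B)
  show s: "(\<lambda>i. (cmod (x i))\<^sup>2) summable_on UNIV"
    by (rule nonneg_bdd_above_summable_on) (auto intro!: bdd_aboveI2 le)
  have "(\<Sum>\<^sub>\<infinity>i. (cmod (x i))\<^sup>2) \<le> B\<^sup>2"
    by (rule infsum_le_finite_sums[OF s]) (use le in auto)
  then show "sqrt (\<Sum>\<^sub>\<infinity>i. (cmod (x i))\<^sup>2) \<le> B"
    using B real_le_lsqrt by blast
qed

lemma L2_set_le_ell2:
  assumes "(\<lambda>i. (cmod (x i))\<^sup>2) summable_on UNIV" "finite F"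
  shows "L2_set (\<lambda>i. cmod (x i)) F \<le> sqrt (\<Sum>\<^sub>\<infinity>i. (cmod (x i))\<^sup>2)"
  unfolding L2_set_def using finite_sum_le_infsum[OF assms] by simp

lemma ell2_add:
  assumes "(\<lambda>i. (cmod (x i))\<^sup>2) summable_on UNIV" "(\<lambda>i. (cmod (y i))\<^sup>2) summable_on UNIV"
  shows "(\<lambda>i. (cmod (x i + y i))\<^sup>2) summable_on UNIV"
    "sqrt (\<Sum>\<^sub>\<infinity>i. (cmod (x i + y i))\<^sup>2)
       \<le> sqrt (\<Sum>\<^sub>\<infinity>i. (cmod (x i))\<^sup>2) + sqrt (\<Sum>\<^sub>\<infinity>i. (cmod (y i))\<^sup>2)"
proof -
  have "L2_set (\<lambda>i. cmod (x i + y i)) F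
      \<le> sqrt (\<Sum>\<^sub>\<infinity>i. (cmod (x i))\<^sup>2) + sqrt (\<Sum>\<^sub>\<infinity>i. (cmod (y i))\<^sup>2)" if F: "finite F" for F
  proof -
    have "L2_set (\<lambda>i. cmod (x i + y i)) F \<le> L2_set (\<lambda>i. cmod (x i) + cmod (y i)) F"
      by (rule L2_set_mono) (auto intro: norm_triangle_ineq)
    also have "\<dots> \<le> L2_set (\<lambda>i. cmod (x i)) F + L2_set (\<lambda>i. cmod (y i)) F"
      by (rule L2_set_triangle_ineq)
    finally show ?thesis
      using L2_set_le_ell2[OF assms(1) F] L2_set_le_ell2[OF assms(2) F] by linarith
  qed
  from ell2_boundI[OF this]
  show "(\<lambda>i. (cmod (x i + y i))\<^sup>2) summable_on UNIV"
    "sqrt (\<Sum>\<^sub>\<infinity>i. (cmod (x i + y i))\<^sup>2)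
       \<le> sqrt (\<Sum>\<^sub>\<infinity>i. (cmod (x i))\<^sup>2) + sqrt (\<Sum>\<^sub>\<infinity>i. (cmod (y i))\<^sup>2)"
    by auto
qed

lemma ell2_scale:
  assumes "(\<lambda>i. (cmod (x i))\<^sup>2) summable_on UNIV"
  shows "(\<lambda>i. (cmod (c * x i))\<^sup>2) summable_on UNIV"
  using summable_on_cmult_right[OF assms, of "(cmod c)\<^sup>2"] by (simp add: norm_mult power_mult_distrib)

lemma ell2_prod_summable:
  assumes "(\<lambda>i. (cmod (x i))\<^sup>2) summable_on UNIV" "(\<lambda>i. (cmod (y i))\<^sup>2) summable_on UNIV"
  shows "(\<lambda>i. x i * cnj (y i)) summable_on UNIV"
proof -
  have "(\<lambda>i. norm (x i * cnj (y i))) summable_on UNIV"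
    using abs_summable_product[of x UNIV "\<lambda>i. cnj (y i)"] assms
    by (simp add: norm_mult power2_eq_square)
  then show ?thesis
    by (rule abs_summable_summable)
qed

instantiation ell2 :: (type) real_vector
begin
lift_definition zero_ell2 :: "'a ell2" is "\<lambda>_. 0" by simp
lift_definition plus_ell2 :: "'a ell2 \<Rightarrow> 'a ell2 \<Rightarrow> 'a ell2" is "\<lambda>x y i. x i + y i"
  by (rule ell2_add)
lift_definition uminus_ell2 :: "'a ell2 \<Rightarrow> 'a ell2" is "\<lambda>x i. - x i" by simp
lift_definition minus_ell2 :: "'a ell2 \<Rightarrow> 'a ell2 \<Rightarrow> 'a ell2" is "\<lambda>x y i. x i - y i"
proof -
  fix x y :: "'a \<Rightarrow> complex"
  assume "(\<lambda>i. (cmod (x i))\<^sup>2) summable_on UNIV" "(\<lambda>i. (cmod (y i))\<^sup>2) summable_on UNIV"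
  then show "(\<lambda>i. (cmod (x i - y i))\<^sup>2) summable_on UNIV"
    using ell2_add(1)[of x "\<lambda>i. - y i"] by simp
qed
lift_definition scaleR_ell2 :: "real \<Rightarrow> 'a ell2 \<Rightarrow> 'a ell2" is "\<lambda>r x i. complex_of_real r * x i"
  by (rule ell2_scale)
instance
  by standard (transfer, simp add: fun_eq_iff algebra_simps)+
end

instantiation ell2 :: (type) complex_vector
begin
lift_definition scaleC_ell2 :: "complex \<Rightarrow> 'a ell2 \<Rightarrow> 'a ell2" is "\<lambda>c x i. c * x i"
  by (rule ell2_scale)
instance
  by standard (transfer, simp add: fun_eq_iff algebra_simps)+
end

instantiation ell2 :: (type) real_normed_vector
begin
lift_definition norm_ell2 :: "'a ell2 \<Rightarrow> real" is "\<lambda>x. sqrt (\<Sum>\<^sub>\<infinity>i. (cmod (x i))\<^sup>2)" .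
definition "dist_ell2 (x :: 'a ell2) y = norm (x - y)"
definition "sgn_ell2 (x :: 'a ell2) = inverse (norm x) *\<^sub>R x"
definition "(uniformity :: ('a ell2 \<times> 'a ell2) filter)
  = (INF e\<in>{0 <..}. principal {(x, y). dist x y < e})"
definition "open_ell2 (S :: 'a ell2 set)
  = (\<forall>x\<in>S. \<forall>\<^sub>F (x', y) in uniformity. x' = x \<longrightarrow> y \<in> S)"
instance
proof
  fix x y :: "'a ell2" and r :: real
  show "norm x = 0 \<longleftrightarrow> x = 0"
  proof (transfer, safe)
    fix x :: "'a \<Rightarrow> complex"
    assume s: "(\<lambda>i. (cmod (x i))\<^sup>2) summable_on UNIV" and "sqrt (\<Sum>\<^sub>\<infinity>i. (cmod (x i))\<^sup>2) = 0"
    then have "(\<Sum>\<^sub>\<infinity>i. (cmod (x i))\<^sup>2) \<le> 0" by simp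
    then show "x = (\<lambda>_. 0)"
      using nonneg_infsum_le_0D[OF _ s] by (auto simp: fun_eq_iff)
  qed simp
  show "norm (x + y) \<le> norm x + norm y"
    by transfer (rule ell2_add)
  show "norm (r *\<^sub>R x) = \<bar>r\<bar> * norm x"
    by transfer
       (simp add: norm_mult power_mult_distrib infsum_cmult_right' real_sqrt_mult)
qed (simp_all add: dist_ell2_def sgn_ell2_def uniformity_ell2_def open_ell2_def)
end

instantiation ell2 :: (type) complex_inner
begin
lift_definition cinner_ell2 :: "'a ell2 \<Rightarrow> 'a ell2 \<Rightarrow> complex" is "\<lambda>x y. \<Sum>\<^sub>\<infinity>i. x i * cnj (y i)" .
instance
proof
  fix x y z :: "'a ell2" and c :: complex
  show "cinner x y = cnj (cinner y x)"
    by transfer (simp flip: infsum_cnj add: mult.commute)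
  show "cinner (x + y) z = cinner x z + cinner y z"
    by transfer (simp add: distrib_right infsum_add ell2_prod_summable)
  show "cinner (c *\<^sub>C x) y = c * cinner x y"
    by transfer (simp add: mult.assoc infsum_cmult_right')
  show "norm x = sqrt (Re (cinner x x))"
  proof transfer
    fix x :: "'a \<Rightarrow> complex"
    assume "(\<lambda>i. (cmod (x i))\<^sup>2) summable_on UNIV"
    then have s: "(\<lambda>i. x i * cnj (x i)) summable_on UNIV"
      using ell2_prod_summable by blast
    have *: "(cmod (x i))\<^sup>2 = Re (x i * cnj (x i))" for i
      by (metis Re_complex_of_real complex_norm_square)
    show "sqrt (\<Sum>\<^sub>\<infinity>i. (cmod (x i))\<^sup>2) = sqrt (Re (\<Sum>\<^sub>\<infinity>i. x i * cnj (x i)))"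
      by (simp only: * infsum_Re[OF s])
  qed
qed
end

lemma norm_ell2_nth: "norm x = sqrt (\<Sum>\<^sub>\<infinity>i. (cmod (ell2_nth x i))\<^sup>2)"
  by transfer (rule refl)

lemma L2_set_ell2_nth_le: "finite F \<Longrightarrow> L2_set (\<lambda>i. cmod (ell2_nth x i)) F \<le> norm x"
  unfolding norm_ell2_nth using ell2_nth[of x] by (intro L2_set_le_ell2) auto

lemma cmod_ell2_nth_le: "cmod (ell2_nth x i) \<le> norm x"
  using L2_set_ell2_nth_le[of "{i}" x] by simp

instance ell2 :: (type) chilbert_space
proof
  fix X :: "nat \<Rightarrow> 'a ell2"
  assume X: "Cauchy X"
  have dif: "ell2_nth (x - y) i = ell2_nth x i - ell2_nth y i" for x y :: "'a ell2" and i
    by transfer simp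
  have "Cauchy (\<lambda>n. ell2_nth (X n) i)" for i
  proof (rule metric_CauchyI)
    fix e :: real assume "e > 0"
    then obtain M where M: "\<And>m n. m \<ge> M \<Longrightarrow> n \<ge> M \<Longrightarrow> dist (X m) (X n) < e"
      using metric_CauchyD[OF X] by blast
    show "\<exists>M. \<forall>m\<ge>M. \<forall>n\<ge>M. dist (ell2_nth (X m) i) (ell2_nth (X n) i) < e"
      using M cmod_ell2_nth_le[of "X _ - X _" i] unfolding dist_norm dif
      by (meson le_less_trans)
  qed
  then have "\<exists>l. (\<lambda>n. ell2_nth (X n) i) \<longlonglongrightarrow> l" for i
    using Cauchy_convergent convergent_def by blast
  then obtain l where l: "\<And>i. (\<lambda>n. ell2_nth (X n) i) \<longlonglongrightarrow> l i"
    by metis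
  have bound: "L2_set (\<lambda>i. cmod (ell2_nth (X n) i - l i)) F \<le> e"
    if M: "\<And>m n. m \<ge> M \<Longrightarrow> n \<ge> M \<Longrightarrow> dist (X m) (X n) < e" and "n \<ge> M" and F: "finite F"
    for M n e and F :: "'a set"
  proof (rule LIMSEQ_le_const2)
    show "(\<lambda>m. L2_set (\<lambda>i. cmod (ell2_nth (X n) i - ell2_nth (X m) i)) F)
        \<longlonglongrightarrow> L2_set (\<lambda>i. cmod (ell2_nth (X n) i - l i)) F"
      unfolding L2_set_def by (intro tendsto_intros l)
    have "L2_set (\<lambda>i. cmod (ell2_nth (X n) i - ell2_nth (X m) i)) F \<le> e" if "m \<ge> M" for m
    proof -
      have "L2_set (\<lambda>i. cmod (ell2_nth (X n - X m) i)) F \<le> norm (X n - X m)"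
        by (rule L2_set_ell2_nth_le[OF F])
      then show ?thesis
        using M[OF \<open>n \<ge> M\<close> that] by (simp add: dif dist_norm)
    qed
    then show "\<exists>N. \<forall>m\<ge>N. L2_set (\<lambda>i. cmod (ell2_nth (X n) i - ell2_nth (X m) i)) F \<le> e"
      by blast
  qed
  have sq: "(\<lambda>i. (cmod (ell2_nth x i))\<^sup>2) summable_on UNIV" for x :: "'a ell2"
    using ell2_nth[of x] by simp
  obtain M where M: "\<And>m n. m \<ge> M \<Longrightarrow> n \<ge> M \<Longrightarrow> dist (X m) (X n) < 1"
    using metric_CauchyD[OF X zero_less_one] by blast
  have "(\<lambda>i. (cmod (ell2_nth (X M) i - l i))\<^sup>2) summable_on UNIV"
    by (rule ell2_boundI(1)[OF bound[OF M]]) auto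
  then have "(\<lambda>i. (cmod (- (ell2_nth (X M) i - l i)))\<^sup>2) summable_on UNIV"
    by (simp add: norm_minus_commute)
  from ell2_add(1)[OF sq[of "X M"] this]
  have lsq: "(\<lambda>i. (cmod (l i))\<^sup>2) summable_on UNIV" by simp
  define L where "L = Abs_ell2 l"
  have L: "ell2_nth L = l"
    unfolding L_def using lsq by (simp add: Abs_ell2_inverse)
  have "X \<longlonglongrightarrow> L"
  proof (rule metric_LIMSEQ_I)
    fix e :: real assume "e > 0"
    then have "e / 2 > 0" by simp
    then obtain M where M: "\<And>m n. m \<ge> M \<Longrightarrow> n \<ge> M \<Longrightarrow> dist (X m) (X n) < e / 2"
      using metric_CauchyD[OF X] by blast
    have "dist (X n) L < e" if "n \<ge> M" for n
    proof -
      have "norm (X n - L) = sqrt (\<Sum>\<^sub>\<infinity>i. (cmod (ell2_nth (X n) i - l i))\<^sup>2)"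
        by (simp add: norm_ell2_nth dif L)
      also have "\<dots> \<le> e / 2"
        by (rule ell2_boundI(2)[OF bound[OF M that]])
      finally show ?thesis
        using \<open>e > 0\<close> by (simp add: dist_norm)
    qed
    then show "\<exists>N. \<forall>n\<ge>N. dist (X n) L < e" by blast
  qed
  then show "convergent X" by (rule convergentI)
qed

text \<open>``There exists a Hilbert space'' is rendered as ``there exists a closed subspace of the type
  below''.  Here \<open>'g\<close> is an arbitrary Hilbert space type, so that every Hilbert space, of whatever
  dimension, is admitted; the second summand guarantees that, for every choice of \<open>'g\<close>, there is
  room for the spaces that have to be constructed from an operator function on \<open>\<complex>\<^sup>N\<close>.\<close>

type_synonym ('g, 'n, 'u) ambient = "'g \<times> ('n \<times> (complex ^ 'n) \<times> 'u) ell2"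

definition closed_csubspace :: "'a::complex_inner set \<Rightarrow> bool" where
  "closed_csubspace S \<longleftrightarrow> 0 \<in> S \<and> (\<forall>x\<in>S. \<forall>y\<in>S. x + y \<in> S) \<and> (\<forall>c. \<forall>x\<in>S. c *\<^sub>C x \<in> S) \<and> closed S"

definition clinear_on :: "'a::complex_vector set \<Rightarrow> ('a \<Rightarrow> 'b::complex_vector) \<Rightarrow> bool" where
  "clinear_on S T \<longleftrightarrow> (\<forall>x\<in>S. \<forall>y\<in>S. T (x + y) = T x + T y) \<and> (\<forall>c. \<forall>x\<in>S. T (c *\<^sub>C x) = c *\<^sub>C T x)"

abbreviation clinear :: "('a::complex_vector \<Rightarrow> 'b::complex_vector) \<Rightarrow> bool" where
  "clinear \<equiv> clinear_on UNIV"

definition antilinear :: "('a::complex_vector \<Rightarrow> 'b::complex_vector) \<Rightarrow> bool" where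
  "antilinear T \<longleftrightarrow> (\<forall>x y. T (x + y) = T x + T y) \<and> (\<forall>c x. T (c *\<^sub>C x) = cnj c *\<^sub>C T x)"

text \<open>An operator on a closed subspace \<open>S\<close> is a function on the ambient type; its values outside
  \<open>S\<close> are irrelevant.\<close>

definition bounded_ops :: "'a::complex_inner set \<Rightarrow> ('a \<Rightarrow> 'a) set" where
  "bounded_ops S = {T. T ` S \<subseteq> S \<and> clinear_on S T \<and> (\<exists>K. \<forall>x\<in>S. norm (T x) \<le> K * norm x)}"

definition boundedly_invertible_on :: "'a::complex_inner set \<Rightarrow> ('a \<Rightarrow> 'a) \<Rightarrow> bool" where
  "boundedly_invertible_on S T \<longleftrightarrow> (\<exists>R\<in>bounded_ops S. \<forall>x\<in>S. R (T x) = x \<and> T (R x) = x)"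

definition selfadjoint_on :: "'a::complex_inner set \<Rightarrow> ('a \<Rightarrow> 'a) \<Rightarrow> bool" where
  "selfadjoint_on S T \<longleftrightarrow> (\<forall>x\<in>S. \<forall>y\<in>S. cinner (T x) y = cinner x (T y))"

definition psd_on :: "'a::complex_inner set \<Rightarrow> ('a \<Rightarrow> 'a) \<Rightarrow> bool" where
  "psd_on S T \<longleftrightarrow> (\<forall>x\<in>S. cinner (T x) x \<in> \<real>\<^sub>\<ge>\<^sub>0)"

definition unitary_on :: "'a::complex_inner set \<Rightarrow> ('a \<Rightarrow> 'a) \<Rightarrow> bool" where
  "unitary_on S T \<longleftrightarrow> T \<in> bounded_ops S \<and> T ` S = S \<and>
     (\<forall>x\<in>S. \<forall>y\<in>S. cinner (T x) (T y) = cinner x y)"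

definition AUI_on :: "'a::complex_inner set \<Rightarrow> ('a \<Rightarrow> 'a) \<Rightarrow> bool" where
  "AUI_on S \<iota> \<longleftrightarrow> \<iota> ` S \<subseteq> S \<and> (\<forall>x\<in>S. \<iota> (\<iota> x) = x) \<and>
     (\<forall>x\<in>S. \<forall>y\<in>S. cinner (\<iota> x) (\<iota> y) = cinner y x)"

definition iota_real_op_on :: "'a set \<Rightarrow> ('a \<Rightarrow> 'a) \<Rightarrow> ('a \<Rightarrow> 'a) \<Rightarrow> bool" where
  "iota_real_op_on S \<iota> T \<longleftrightarrow> (\<forall>x\<in>S. \<iota> (T x) = T (\<iota> x))"

definition poly_halfplane :: "(complex ^ 'n) set" where
  "poly_halfplane = {z. \<forall>k. 0 < Re (z $ k)}"

definition rotated_halfplanes :: "(complex ^ 'n) set" where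
  "rotated_halfplanes = (\<Union>l\<in>sphere 0 1. {z. \<forall>k. z $ k \<in> (\<lambda>p. l * p) ` {p. 0 < Re p}})"

definition polydisc :: "(complex ^ 'n) set" where
  "polydisc = {w. \<forall>k. cmod (w $ k) < 1}"

definition vcnj :: "complex ^ 'n \<Rightarrow> complex ^ 'n" where
  "vcnj z = (\<chi> k. cnj (z $ k))"

text \<open>Holomorphy of \<open>L(\<U>)\<close>-valued functions on open sets is complex Frechet differentiability in
  the operator norm.\<close>

definition holomorphic_op_on :: "(complex ^ 'n \<Rightarrow> 'u::complex_inner \<Rightarrow>\<^sub>L 'u) \<Rightarrow> (complex ^ 'n) set \<Rightarrow> bool"
  where "holomorphic_op_on f \<Omega> \<longleftrightarrow>
     (\<forall>z\<in>\<Omega>. clinear (blinfun_apply (f z)) \<and> (\<exists>D. clinear D \<and> (f has_derivative D) (at z)))"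

definition antiholomorphic_op_on ::
  "(complex ^ 'n \<Rightarrow> 'u::complex_inner \<Rightarrow>\<^sub>L 'u) \<Rightarrow> (complex ^ 'n) set \<Rightarrow> bool"
  where "antiholomorphic_op_on f \<Omega> \<longleftrightarrow>
     (\<forall>z\<in>\<Omega>. clinear (blinfun_apply (f z)) \<and> (\<exists>D. antilinear D \<and> (f has_derivative D) (at z)))"

definition sharp :: "('a \<Rightarrow> 'a) \<Rightarrow> (complex ^ 'n \<Rightarrow> 'a \<Rightarrow> 'a) \<Rightarrow> complex ^ 'n \<Rightarrow> 'a \<Rightarrow> 'a" where
  "sharp \<iota> f z = (\<lambda>x. \<iota> (f (vcnj z) (\<iota> x)))"

definition iota_real_fun_on ::
  "(complex ^ 'n) set \<Rightarrow> 'a set \<Rightarrow> ('a \<Rightarrow> 'a) \<Rightarrow> (complex ^ 'n \<Rightarrow> 'a \<Rightarrow> 'a) \<Rightarrow> bool" where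
  "iota_real_fun_on \<Omega> S \<iota> f \<longleftrightarrow> (\<forall>z\<in>\<Omega>. \<forall>x\<in>S. sharp \<iota> f z x = f z x)"

definition holomorphic_psd_kernel ::
  "(complex ^ 'n) set \<Rightarrow> (complex ^ 'n \<Rightarrow> complex ^ 'n \<Rightarrow> 'u::complex_inner \<Rightarrow>\<^sub>L 'u) \<Rightarrow> bool" where
  "holomorphic_psd_kernel \<Omega> \<Phi> \<longleftrightarrow>
     (\<forall>\<zeta>\<in>\<Omega>. holomorphic_op_on (\<lambda>z. \<Phi> z \<zeta>) \<Omega>) \<and>
     (\<forall>z\<in>\<Omega>. antiholomorphic_op_on (\<lambda>\<zeta>. \<Phi> z \<zeta>) \<Omega>) \<and>
     (\<forall>z\<in>\<Omega>. \<forall>\<zeta>\<in>\<Omega>. \<forall>u v. cinner (\<Phi> z \<zeta> u) v = cinner u (\<Phi> \<zeta> z v)) \<and>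
     (\<forall>(m::nat) z u. (\<forall>\<mu><m. z \<mu> \<in> \<Omega>) \<longrightarrow>
        (\<Sum>\<mu><m. \<Sum>\<nu><m. cinner (\<Phi> (z \<mu>) (z \<nu>) (u \<mu>)) (u \<nu>)) \<in> \<real>\<^sub>\<ge>\<^sub>0)"

definition iota_real_kernel_on ::
  "(complex ^ 'n) set \<Rightarrow> ('u \<Rightarrow> 'u) \<Rightarrow> (complex ^ 'n \<Rightarrow> complex ^ 'n \<Rightarrow> 'u::complex_inner \<Rightarrow>\<^sub>L 'u) \<Rightarrow> bool"
  where "iota_real_kernel_on \<Omega> \<iota> \<Phi> \<longleftrightarrow>
     (\<forall>z\<in>\<Omega>. \<forall>\<zeta>\<in>\<Omega>. \<forall>u. \<iota> (\<Phi> (vcnj z) (vcnj \<zeta>) (\<iota> u)) = \<Phi> z \<zeta> u)"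

definition pencil :: "('n::finite \<Rightarrow> 'a \<Rightarrow> 'a::complex_vector) \<Rightarrow> complex ^ 'n \<Rightarrow> 'a \<Rightarrow> 'a" where
  "pencil A z x = (\<Sum>k\<in>UNIV. z $ k *\<^sub>C A k x)"

text \<open>The entries of the block matrix of an operator on \<open>\<V> \<oplus> \<W>\<close>, where the summands are closed
  subspaces of the two factors of a product type.\<close>

definition block11 :: "('v::zero \<times> 'w::zero \<Rightarrow> 'v \<times> 'w) \<Rightarrow> 'v \<Rightarrow> 'v" where
  "block11 T v = fst (T (v, 0))"

definition block12 :: "('v::zero \<times> 'w::zero \<Rightarrow> 'v \<times> 'w) \<Rightarrow> 'w \<Rightarrow> 'v" where
  "block12 T w = fst (T (0, w))"

definition block21 :: "('v::zero \<times> 'w::zero \<Rightarrow> 'v \<times> 'w) \<Rightarrow> 'v \<Rightarrow> 'w" where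
  "block21 T v = snd (T (v, 0))"

definition block22 :: "('v::zero \<times> 'w::zero \<Rightarrow> 'v \<times> 'w) \<Rightarrow> 'w \<Rightarrow> 'w" where
  "block22 T w = snd (T (0, w))"

definition bessmertnyi_representation ::
  "(complex ^ 'n \<Rightarrow> 'u::chilbert_space \<Rightarrow>\<^sub>L 'u) \<Rightarrow> 'h::chilbert_space set \<Rightarrow>
   ('n \<Rightarrow> 'u \<times> 'h \<Rightarrow> 'u \<times> 'h) \<Rightarrow> bool" where
  "bessmertnyi_representation f H A \<longleftrightarrow>
     (\<forall>k. A k \<in> bounded_ops (UNIV \<times> H) \<and> selfadjoint_on (UNIV \<times> H) (A k) \<and> psd_on (UNIV \<times> H) (A k)) \<and>
     (\<forall>z\<in>rotated_halfplanes.
        boundedly_invertible_on H (block22 (pencil A z)) \<and>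
        (\<forall>u. f z u = block11 (pencil A z) u
               - block12 (pencil A z) (inv_into H (block22 (pencil A z)) (block21 (pencil A z) u))))"

definition bessmertnyi_class ::
  "'h::chilbert_space itself \<Rightarrow> (complex ^ 'n \<Rightarrow> 'u::chilbert_space \<Rightarrow>\<^sub>L 'u) set" where
  "bessmertnyi_class _ = {f. holomorphic_op_on f rotated_halfplanes \<and>
     (\<exists>(H :: 'h set) A. closed_csubspace H \<and> bessmertnyi_representation f H A)}"

definition real_bessmertnyi_class ::
  "'h::chilbert_space itself \<Rightarrow> ('u \<Rightarrow> 'u) \<Rightarrow> (complex ^ 'n \<Rightarrow> 'u::chilbert_space \<Rightarrow>\<^sub>L 'u) set" where
  "real_bessmertnyi_class h \<iota> =
     {f \<in> bessmertnyi_class h. iota_real_fun_on rotated_halfplanes UNIV \<iota> (\<lambda>z. blinfun_apply (f z))}"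

definition cayley_arg :: "(complex ^ 'n \<Rightarrow> 'u::complex_inner \<Rightarrow>\<^sub>L 'u) \<Rightarrow> complex ^ 'n \<Rightarrow> 'u \<Rightarrow>\<^sub>L 'u" where
  "cayley_arg f w = f (\<chi> k. (1 + w $ k) / (1 - w $ k))"

definition double_cayley_defined :: "(complex ^ 'n \<Rightarrow> 'u::complex_inner \<Rightarrow>\<^sub>L 'u) \<Rightarrow> bool" where
  "double_cayley_defined f \<longleftrightarrow>
     (\<forall>w\<in>polydisc. boundedly_invertible_on UNIV (\<lambda>u. cayley_arg f w u + u))"

definition double_cayley :: "(complex ^ 'n \<Rightarrow> 'u::complex_inner \<Rightarrow>\<^sub>L 'u) \<Rightarrow> complex ^ 'n \<Rightarrow> 'u \<Rightarrow> 'u" where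
  "double_cayley f w = (\<lambda>u. cayley_arg f w u - u) \<circ> inv (\<lambda>u. cayley_arg f w u + u)"

text \<open>The orthogonal sum \<open>\<X> = \<X>\<^sub>1 \<oplus> \<dots> \<oplus> \<X>\<^sub>N\<close> is a subspace of the Hilbert space type
  \<open>'h ^ 'n\<close>.\<close>

definition orth_sum :: "('n \<Rightarrow> 'h set) \<Rightarrow> ('h ^ 'n) set" where
  "orth_sum X = {x. \<forall>k. x $ k \<in> X k}"

definition coord_proj :: "'n \<Rightarrow> 'h ^ 'n \<Rightarrow> ('h::zero) ^ 'n" where
  "coord_proj k x = (\<chi> j. if j = k then x $ j else 0)"

definition agler_unitary_colligation ::
  "('n \<Rightarrow> 'h::chilbert_space set) \<Rightarrow> (('h ^ 'n) \<times> 'u::chilbert_space \<Rightarrow> ('h ^ 'n) \<times> 'u) \<Rightarrow> bool" where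
  "agler_unitary_colligation X U \<longleftrightarrow>
     (\<forall>k. closed_csubspace (X k)) \<and> unitary_on (orth_sum X \<times> UNIV) U"

text \<open>\<open>D + C P(w) (I - A P(w))\<^sup>-\<^sup>1 B\<close>; the inverse exists on the polydisc because \<open>A\<close> is a
  contraction.\<close>

definition transfer_function ::
  "('n \<Rightarrow> 'h::chilbert_space set) \<Rightarrow> (('h ^ 'n) \<times> 'u::chilbert_space \<Rightarrow> ('h ^ 'n) \<times> 'u) \<Rightarrow>
   complex ^ 'n \<Rightarrow> 'u \<Rightarrow> 'u" where
  "transfer_function X U w u =
     (let P = pencil coord_proj w in
      block22 U u +
      block21 U (P (inv_into (orth_sum X) (\<lambda>x. x - block11 U (P x)) (block12 U u))))"

end

theory Submission
  imports Defs "HOL-Complex_Analysis.Conformal_Mappings"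
begin

text \<open>The four conditions are compared through a purely scalar one, \<open>gram_solution\<close>: there are positive
  semidefinite kernels \<open>G\<^sub>k\<close> on the set of pairs \<open>(z, u)\<close>, \<open>z \<in> \<Pi>\<^sup>N\<close>, with
  \<open>\<Sum> z\<^sub>k G\<^sub>k((z, u), (\<zeta>, v)) = \<langle>f(z) u, v\<rangle>\<close>, which are conjugated under \<open>(z, u) \<mapsto> (cnj z, \<iota> u)\<close>.

  From operators to kernels.  A representation as a Schur complement gives vectors \<open>\<psi>(z) u = (u, y)\<close> with
  \<open>A(z) \<psi>(z) u = (f(z) u, 0)\<close>; pairing with \<open>\<psi>(\<zeta>) v\<close> shows that \<open>\<langle>A\<^sub>k \<psi>(z) u, \<psi>(\<zeta>) v\<rangle>\<close> solves the kernel problem.  If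
  only \<open>f\<close> is real, these kernels are averaged with their conjugates (\<open>bessmertnyi_imp_gram_solution\<close>); if the
  pencil is real, they are real by themselves and are the holomorphic kernels of condition (iii)
  (\<open>real_pencil_imp_real_kernels\<close>).  For a self-adjoint unitary colligation the kernel identity is the
  orthogonality of the eigenspaces of \<open>U\<close> for \<open>1\<close> and \<open>-1\<close> (\<open>colligation_imp_gram_solution\<close>).

  From kernels to operators.  The kernels are Gram matrices of vectors \<open>\<eta>\<^sub>k(z) u\<close> in one Hilbert space,
  orthogonal for different \<open>k\<close> (\<open>gram_representation\<close>), and the symmetry of the kernels becomes an anti-unitary
  involution of their closed span (\<open>AUI_extension\<close>).  Let \<open>h(z) u = \<Sum> \<eta>\<^sub>k(z) u\<close>.  In the identity
  \<open>\<langle>\<Sum> z\<^sub>k \<eta>\<^sub>k(z) u, h(\<zeta>) v\<rangle> = \<langle>f(z) u, v\<rangle>\<close> the right-hand side does not depend on \<open>\<zeta>\<close>.  Two constructions exploit this.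
  The span \<open>\<H>\<close> of all differences \<open>h(\<zeta>) v - h(1) v\<close> is orthogonal to \<open>\<Sum> z\<^sub>k \<eta>\<^sub>k(z) u\<close>, and pulling the
  projections onto the spans of the \<open>\<eta>\<^sub>k\<close> back along \<open>(u, x) \<mapsto> h(1) u + x\<close> gives the pencil (\<open>pencil_model\<close>).  The span \<open>L\<close> of the
  vectors \<open>(- \<eta>(\<zeta>) v, v)\<close> is orthogonal to all \<open>(z \<eta>(z) u, f(z) u)\<close>, and the reflection \<open>I - 2 P\<^sub>L\<close> is the
  colligation (\<open>colligation_model\<close>).  Both are compatible with the involution because projections onto
  invariant subspaces are.

  The pencil represents \<open>f\<close> at first only on \<open>\<Pi>\<^sup>N\<close>; the one-variable identity theorem along line segments
  extends this to \<open>\<Omega>\<^sub>N\<close> (\<open>rotated_identity_theorem\<close>).  The inverses \<open>d(z)\<^sup>-\<^sup>1\<close> and \<open>(I - A P(w))\<^sup>-\<^sup>1\<close> exist by coercivity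
  (\<open>boundedly_invertible_on_coercive\<close>).\<close>

section \<open>Complex inner product spaces\<close>

lemma scaleC_zero_left [simp]: "0 *\<^sub>C x = (0 :: 'a::complex_vector)"
  using scaleR_scaleC[of 0 x] by simp

lemma scaleC_zero_right [simp]: "c *\<^sub>C 0 = (0 :: 'a::complex_vector)"
  using scaleC_add_right[of c 0 0] by simp

lemma scaleC_one_left [simp]: "1 *\<^sub>C x = (x :: 'a::complex_vector)"
  by (rule scaleC_one)

lemma scaleC_minus1: "(-1) *\<^sub>C x = - (x :: 'a::complex_vector)"
  using scaleR_scaleC[of "-1" x] by simp

lemma scaleC_minus_right: "c *\<^sub>C (- x) = - (c *\<^sub>C (x :: 'a::complex_vector))"
  by (metis scaleC_minus1 scaleC_scaleC mult.commute)

lemma scaleC_minus_left: "(- c) *\<^sub>C x = - (c *\<^sub>C (x :: 'a::complex_vector))"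
  by (metis scaleC_minus1 scaleC_scaleC mult_minus1)

lemma scaleC_diff_right: "c *\<^sub>C (x - y) = c *\<^sub>C x - c *\<^sub>C (y :: 'a::complex_vector)"
  using scaleC_add_right[of c x "- y"] by (simp add: scaleC_minus_right)

lemma scaleC_diff_left: "(c - d) *\<^sub>C x = c *\<^sub>C x - d *\<^sub>C (x :: 'a::complex_vector)"
  using scaleC_add_left[of c "- d" x] by (simp add: scaleC_minus_left)

lemma scaleC_two: "2 *\<^sub>C x = x + (x :: 'a::complex_vector)"
  using scaleC_add_left[of 1 1 x] by simp

lemma scaleC_sum_right: "c *\<^sub>C (\<Sum>i\<in>F. x i) = (\<Sum>i\<in>F. c *\<^sub>C (x i :: 'a::complex_vector))"
  by (induction F rule: infinite_finite_induct) (auto simp: scaleC_add_right)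

lemma fst_scaleC [simp]: "fst (c *\<^sub>C p) = c *\<^sub>C fst p"
  by (simp add: scaleC_prod_def)

lemma snd_scaleC [simp]: "snd (c *\<^sub>C p) = c *\<^sub>C snd p"
  by (simp add: scaleC_prod_def)

lemma scaleC_eq_0_iff: "c *\<^sub>C x = 0 \<longleftrightarrow> c = 0 \<or> x = (0 :: 'a::complex_vector)"
proof
  assume *: "c *\<^sub>C x = 0"
  show "c = 0 \<or> x = 0"
  proof (rule disjCI)
    assume "x \<noteq> 0"
    show "c = 0"
    proof (rule ccontr)
      assume "c \<noteq> 0"
      then have "x = inverse c *\<^sub>C (c *\<^sub>C x)" by (simp add: scaleC_scaleC)
      with * \<open>x \<noteq> 0\<close> show False by simp
    qed
  qed
qed auto

lemma cinner_add_right: "cinner x (y + z) = cinner x y + cinner (x :: 'a::complex_inner) z"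
  by (metis cinner_add_left cinner_commute complex_cnj_add)

lemma cinner_zero_left [simp]: "cinner 0 (x :: 'a::complex_inner) = 0"
  using cinner_add_left[of 0 0 x] by simp

lemma cinner_zero_right [simp]: "cinner (x :: 'a::complex_inner) 0 = 0"
  using cinner_add_right[of x 0 0] by simp

lemma cinner_minus_left: "cinner (- x) y = - cinner (x :: 'a::complex_inner) y"
  using cinner_add_left[of x "- x" y] by (simp add: eq_neg_iff_add_eq_0 add.commute)

lemma cinner_minus_right: "cinner x (- y) = - cinner (x :: 'a::complex_inner) y"
  using cinner_add_right[of x y "- y"] by (simp add: eq_neg_iff_add_eq_0 add.commute)

lemma cinner_diff_left: "cinner (x - y) z = cinner x z - cinner (y :: 'a::complex_inner) z"
  using cinner_add_left[of x "- y" z] by (simp add: cinner_minus_left)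

lemma cinner_diff_right: "cinner z (x - y) = cinner z x - cinner z (y :: 'a::complex_inner)"
  using cinner_add_right[of z x "- y"] by (simp add: cinner_minus_right)

lemma cinner_sum_left: "cinner (\<Sum>i\<in>F. x i) y = (\<Sum>i\<in>F. cinner (x i :: 'a::complex_inner) y)"
  by (induction F rule: infinite_finite_induct) (auto simp: cinner_add_left)

lemma cinner_sum_right: "cinner y (\<Sum>i\<in>F. x i) = (\<Sum>i\<in>F. cinner y (x i :: 'a::complex_inner))"
  by (induction F rule: infinite_finite_induct) (auto simp: cinner_add_right)

lemma cinner_linear_combinations:
  "cinner (\<Sum>i\<in>F. c i *\<^sub>C x i) (\<Sum>j\<in>G. d j *\<^sub>C y j)
    = (\<Sum>i\<in>F. \<Sum>j\<in>G. c i * cnj (d j) * cinner (x i :: 'a::complex_inner) (y j))"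
  unfolding cinner_sum_left
  by (rule sum.cong[OF refl])
     (simp add: cinner_sum_right cinner_scaleC_left cinner_scaleC_right sum_distrib_left mult_ac)

lemmas cinner_simps = cinner_add_left cinner_add_right cinner_minus_left cinner_minus_right
  cinner_diff_left cinner_diff_right cinner_scaleC_left cinner_scaleC_right

lemma cinner_scaleR_left: "cinner (r *\<^sub>R x) y = of_real r * cinner (x :: 'a::complex_inner) y"
  by (simp add: scaleR_scaleC cinner_scaleC_left)

lemma cinner_scaleR_right: "cinner x (r *\<^sub>R y) = of_real r * cinner (x :: 'a::complex_inner) y"
  by (simp add: scaleR_scaleC cinner_scaleC_right)

lemma Im_cinner_self [simp]: "Im (cinner x (x :: 'a::complex_inner)) = 0"
  by (metis Reals_cnj_iff cinner_commute complex_is_Real_iff)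

lemma norm_sq_cinner: "(norm (x :: 'a::complex_inner))\<^sup>2 = Re (cinner x x)"
  by (metis norm_eq_sqrt_cinner norm_ge_zero real_sqrt_ge_0_iff real_sqrt_pow2)

lemma cinner_self: "cinner x (x :: 'a::complex_inner) = complex_of_real ((norm x)\<^sup>2)"
  by (simp add: complex_eq_iff norm_sq_cinner)

lemma cinner_self_eq_0_iff [simp]: "cinner x (x :: 'a::complex_inner) = 0 \<longleftrightarrow> x = 0"
  by (simp add: cinner_self)

lemma Re_cinner_commute: "Re (cinner x y) = Re (cinner (y :: 'a::complex_inner) x)"
  using arg_cong[OF cinner_commute[of x y], of Re] by simp

lemma norm_add_sq: "(norm (x + y))\<^sup>2 = (norm x)\<^sup>2 + 2 * Re (cinner x y) + (norm (y :: 'a::complex_inner))\<^sup>2"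
  by (simp add: norm_sq_cinner cinner_simps Re_cinner_commute[of y x])

lemma norm_diff_sq: "(norm (x - y))\<^sup>2 = (norm x)\<^sup>2 - 2 * Re (cinner x y) + (norm (y :: 'a::complex_inner))\<^sup>2"
  by (simp add: norm_sq_cinner cinner_simps Re_cinner_commute[of y x])

text \<open>The triangle inequality is part of the normed space structure, so the Cauchy-Schwarz
  inequality can be read off from it by expanding the square.\<close>

lemma Re_cinner_le: "Re (cinner x y) \<le> norm x * norm (y :: 'a::complex_inner)"
proof -
  have "(norm (x + y))\<^sup>2 \<le> (norm x + norm y)\<^sup>2"
    by (intro power_mono norm_triangle_ineq norm_ge_zero)
  then show ?thesis by (simp add: norm_add_sq power2_sum)
qed

lemma cinner_cauchy_schwarz: "cmod (cinner x y) \<le> norm x * norm (y :: 'a::complex_inner)"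
proof (cases "cinner x y = 0")
  case False
  define c where "c = cnj (cinner x y) / complex_of_real (cmod (cinner x y))"
  have c: "cmod c = 1" using False by (simp add: c_def norm_divide)
  have "c * cinner x y = complex_of_real (cmod (cinner x y))"
    using False by (simp add: c_def complex_norm_square[symmetric] mult.commute power2_eq_square field_simps)
  then have "cmod (cinner x y) = Re (cinner (c *\<^sub>C x) y)"
    by (simp add: cinner_scaleC_left)
  also have "\<dots> \<le> norm x * norm y"
    using Re_cinner_le[of "c *\<^sub>C x" y] by (simp add: norm_scaleC c)
  finally show ?thesis .
qed simp

lemma bounded_bilinear_cinner: "bounded_bilinear (cinner :: 'a::complex_inner \<Rightarrow> 'a \<Rightarrow> complex)"
proof
  show "\<exists>K. \<forall>a b :: 'a. norm (cinner a b) \<le> norm a * norm b * K"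
    by (rule exI[of _ 1]) (auto simp: cinner_cauchy_schwarz)
qed (auto simp: cinner_simps scaleR_scaleC scaleR_conv_of_real scaleC_complex_def)

lemma bounded_bilinear_scaleC: "bounded_bilinear (\<lambda>c. (*\<^sub>C) c :: 'a::complex_inner \<Rightarrow> 'a)"
proof
  show "\<exists>K. \<forall>(a::complex) (b::'a). norm (a *\<^sub>C b) \<le> norm a * norm b * K"
    by (rule exI[of _ 1]) (auto simp: norm_scaleC)
qed (auto simp: scaleC_add_left scaleC_add_right scaleR_scaleC scaleC_scaleC scaleC_complex_def
    scaleR_conv_of_real mult.commute)

lemmas tendsto_cinner [tendsto_intros] = bounded_bilinear.tendsto[OF bounded_bilinear_cinner]
lemmas tendsto_scaleC [tendsto_intros] = bounded_bilinear.tendsto[OF bounded_bilinear_scaleC]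
lemmas continuous_on_cinner [continuous_intros] =
  bounded_bilinear.continuous_on[OF bounded_bilinear_cinner]
lemmas continuous_on_scaleC [continuous_intros] =
  bounded_bilinear.continuous_on[OF bounded_bilinear_scaleC]

lemma cinner_eqI:
  assumes "\<And>v. cinner x v = cinner y v"
  shows "x = (y :: 'a::complex_inner)"
  using assms[of "x - y"] by (metis cinner_diff_left cinner_self_eq_0_iff diff_self eq_iff_diff_eq_0)

section \<open>Closed subspaces and the moment problem\<close>

lemma closed_csubspaceD:
  assumes "closed_csubspace S"
  shows "0 \<in> S" "\<And>x y. x \<in> S \<Longrightarrow> y \<in> S \<Longrightarrow> x + y \<in> S" "\<And>c x. x \<in> S \<Longrightarrow> c *\<^sub>C x \<in> S" "closed S"
    "\<And>x. x \<in> S \<Longrightarrow> - x \<in> S" "\<And>x y. x \<in> S \<Longrightarrow> y \<in> S \<Longrightarrow> x - y \<in> S"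
proof -
  show *: "0 \<in> S" "\<And>x y. x \<in> S \<Longrightarrow> y \<in> S \<Longrightarrow> x + y \<in> S" "\<And>c x. x \<in> S \<Longrightarrow> c *\<^sub>C x \<in> S" "closed S"
    using assms by (auto simp: closed_csubspace_def)
  show m: "\<And>x. x \<in> S \<Longrightarrow> - x \<in> S" using *(3)[of _ "-1"] by (simp add: scaleC_minus1)
  show "\<And>x y. x \<in> S \<Longrightarrow> y \<in> S \<Longrightarrow> x - y \<in> S"
    using *(2) m by (metis diff_conv_add_uminus)
qed

lemma closed_csubspace_sum:
  "closed_csubspace S \<Longrightarrow> (\<And>i. i \<in> F \<Longrightarrow> x i \<in> S) \<Longrightarrow> (\<Sum>i\<in>F. x i) \<in> S"
  by (induction F rule: infinite_finite_induct) (auto intro: closed_csubspaceD)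

lemma closed_csubspace_UNIV: "closed_csubspace UNIV"
  by (simp add: closed_csubspace_def)

lemma closed_csubspace_Times:
  "closed_csubspace S \<Longrightarrow> closed_csubspace T \<Longrightarrow> closed_csubspace (S \<times> T)"
  by (auto simp: closed_csubspace_def scaleC_prod_def zero_prod_def intro: closed_Times)

text \<open>The closed span is taken as an intersection, so that properties of its elements are proved by
  exhibiting a closed subspace that contains the generators.\<close>

definition ccspan :: "'a::complex_inner set \<Rightarrow> 'a set" where
  "ccspan B = \<Inter>{S. closed_csubspace S \<and> B \<subseteq> S}"

lemma closed_csubspace_ccspan: "closed_csubspace (ccspan B)"
  unfolding ccspan_def closed_csubspace_def by (auto intro!: closed_Inter)

lemma ccspan_superset: "b \<in> B \<Longrightarrow> b \<in> ccspan B"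
  by (auto simp: ccspan_def)

lemma ccspan_minimal: "closed_csubspace S \<Longrightarrow> B \<subseteq> S \<Longrightarrow> ccspan B \<subseteq> S"
  by (auto simp: ccspan_def)

lemma ccspan_mono: "B \<subseteq> B' \<Longrightarrow> ccspan B \<subseteq> ccspan B'"
  by (auto simp: ccspan_def)

lemma ccspan_induct [consumes 1, case_names base zero add scale closed]:
  assumes "x \<in> ccspan B" and "\<And>b. b \<in> B \<Longrightarrow> P b" and "P 0"
    and "\<And>x y. P x \<Longrightarrow> P y \<Longrightarrow> P (x + y)" and "\<And>c x. P x \<Longrightarrow> P (c *\<^sub>C x)" and "closed {x. P x}"
  shows "P x"
  using ccspan_minimal[of "{x. P x}" B] assms by (auto simp: closed_csubspace_def)

lemma orthogonal_ccspan:
  assumes "x \<in> ccspan B" and "\<And>b. b \<in> B \<Longrightarrow> cinner b y = 0"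
  shows "cinner x y = 0"
  using assms(1)
proof (induction rule: ccspan_induct)
  case closed
  show ?case by (intro closed_Collect_eq continuous_intros)
qed (auto simp: assms(2) cinner_simps)

lemma orthogonal_ccspan_imp_zero:
  assumes "y \<in> ccspan B" and "\<And>b. b \<in> B \<Longrightarrow> cinner b y = 0"
  shows "y = 0"
  using orthogonal_ccspan[OF assms(1,2)] by simp

lemma convergent_minimizing:
  fixes y :: "nat \<Rightarrow> 'a::chilbert_space"
  assumes "\<And>m n. (norm (y m - y n))\<^sup>2 \<le> e m + e n" and "e \<longlonglongrightarrow> 0"
  shows "convergent y"
proof (rule Cauchy_convergent, rule metric_CauchyI)
  fix r :: real assume r: "r > 0"
  have "\<forall>\<^sub>F n in sequentially. e n < r\<^sup>2 / 2"
    by (rule order_tendstoD(2)[OF assms(2)]) (use r in simp)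
  then obtain N where N: "\<And>n. n \<ge> N \<Longrightarrow> e n < r\<^sup>2 / 2" by (auto simp: eventually_sequentially)
  have "dist (y m) (y n) < r" if "m \<ge> N" "n \<ge> N" for m n
  proof -
    have "(norm (y m - y n))\<^sup>2 < r\<^sup>2"
      using assms(1)[of m n] N[OF that(1)] N[OF that(2)] by simp
    then show ?thesis using r by (simp add: dist_norm power_less_imp_less_base)
  qed
  then show "\<exists>M. \<forall>m\<ge>M. \<forall>n\<ge>M. dist (y m) (y n) < r" by blast
qed

text \<open>Riesz representation, orthogonal projections, extensions of anti-unitary maps and Gram
  representations of kernels all reduce to this one existence statement.  If the conditions \<open>\<langle>y, x\<rangle> = b\<close> for \<open>(y, b) \<in> S\<close> are imposed along a linear relation \<open>S\<close>, the
  functional \<open>\<parallel>y\<parallel>\<^sup>2 - 2 Re b\<close> is bounded below, minimizing sequences are Cauchy by the parallelogram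
  law, and the first-order condition at the limit is the required equation.\<close>

lemma linear_relation_moment:
  fixes S :: "('a::chilbert_space \<times> complex) set"
  assumes zero: "0 \<in> S" and add: "\<And>p q. p \<in> S \<Longrightarrow> q \<in> S \<Longrightarrow> p + q \<in> S"
    and scale: "\<And>c p. p \<in> S \<Longrightarrow> c *\<^sub>C p \<in> S"
    and bound: "\<And>y b. (y, b) \<in> S \<Longrightarrow> 2 * Re b \<le> (norm y)\<^sup>2 + M"
  shows "\<exists>x\<in>closure (fst ` S). (\<forall>y b. (y, b) \<in> S \<longrightarrow> cinner y x = b) \<and> (norm x)\<^sup>2 \<le> M"
proof -
  define Q where "Q p = (norm (fst p))\<^sup>2 - 2 * Re (snd p)" for p :: "'a \<times> complex"
  define m where "m = Inf (Q ` S)"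
  have Qlb: "- M \<le> Q p" if "p \<in> S" for p
    using bound[of "fst p" "snd p"] that by (simp add: Q_def)
  have bdd: "bdd_below (Q ` S)" using Qlb by (auto intro!: bdd_belowI2)
  have mle: "m \<le> Q p" if "p \<in> S" for p
    unfolding m_def using bdd that by (rule cINF_lower)
  have mM: "- M \<le> m" unfolding m_def
    by (rule cINF_greatest) (use zero Qlb in auto)
  have "\<exists>p\<in>S. Q p < m + 1 / (real n + 1)" for n
  proof -
    have "Inf (Q ` S) < m + 1 / (real n + 1)" by (simp add: m_def)
    then show ?thesis using cInf_lessD[of "Q ` S"] zero by blast
  qed
  then obtain p where pS: "\<And>n. p n \<in> S" and pm: "\<And>n. Q (p n) < m + 1 / (real n + 1)"
    by metis
  define y where "y n = fst (p n)" for n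
  define b where "b n = snd (p n)" for n
  have inv: "(\<lambda>n. 1 / (real n + 1)) \<longlonglongrightarrow> 0"
    using LIMSEQ_inverse_real_of_nat by (simp add: inverse_eq_divide add.commute)
  have Qlim: "(\<lambda>n. Q (p n)) \<longlonglongrightarrow> m"
  proof (rule tendsto_sandwich[where f = "\<lambda>_. m" and h = "\<lambda>n. m + 1 / (real n + 1)"])
    show "(\<lambda>n. m + 1 / (real n + 1)) \<longlonglongrightarrow> m" using tendsto_add[OF tendsto_const inv, of m] by simp
    show "(\<lambda>n. m) \<longlonglongrightarrow> m" by simp
    show "\<forall>\<^sub>F n in sequentially. m \<le> Q (p n)" using mle[OF pS] by simp
    show "\<forall>\<^sub>F n in sequentially. Q (p n) \<le> m + 1 / (real n + 1)" using less_imp_le[OF pm] by simp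
  qed
  \<comment> \<open>The midpoint of two nearly minimal elements cannot fall below the infimum.\<close>
  have par: "(norm (y k - y n))\<^sup>2 \<le> 2 * (Q (p k) - m) + 2 * (Q (p n) - m)" for k n
  proof -
    define h where "h = (1/2 :: complex) *\<^sub>C (p k + p n)"
    have h: "h \<in> S" unfolding h_def by (intro scale add pS)
    have "4 * Q h = 2 * Q (p k) + 2 * Q (p n) - (norm (y k - y n))\<^sup>2"
      unfolding Q_def h_def scaleC_prod_def fst_conv snd_conv norm_scaleC power_mult_distrib
        fst_add norm_add_sq norm_diff_sq y_def
      by (simp add: scaleC_complex_def power_divide algebra_simps)
    with mle[OF h] show ?thesis by simp
  qed
  have "convergent y"
  proof (rule convergent_minimizing)
    show "(norm (y k - y n))\<^sup>2 \<le> 2 * (Q (p k) - m) + 2 * (Q (p n) - m)" for k n by (rule par)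
    show "(\<lambda>n. 2 * (Q (p n) - m)) \<longlonglongrightarrow> 0"
      using tendsto_mult[OF tendsto_const tendsto_diff[OF Qlim tendsto_const], of 2 m] by simp
  qed
  then obtain x where x: "y \<longlonglongrightarrow> x" by (auto simp: convergent_def)
  have xin: "x \<in> closure (fst ` S)"
    unfolding closure_sequential using x pS by (intro exI[of _ y]) (auto simp: y_def)
  have eq: "cinner v x = c" if vc: "(v, c) \<in> S" for v c
  proof -
    \<comment> \<open>Perturbing the minimizing sequence by \<open>r (w, d)\<close> and passing to the limit.\<close>
    have ge: "0 \<le> r\<^sup>2 * (norm w)\<^sup>2 + 2 * r * Re (cinner w x - d)" if wd: "(w, d) \<in> S" for w d and r :: real
    proof -
      have ineq: "m \<le> Q (p n) + (r\<^sup>2 * (norm w)\<^sup>2 + 2 * r * Re (cinner w (y n) - d))" for n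
        using mle[OF add[OF pS[of n] scale[OF wd, of "complex_of_real r"]]]
        by (simp add: Q_def norm_add_sq scaleC_prod_def norm_scaleC power_mult_distrib y_def
            cinner_simps Re_cinner_commute[of "fst (p n)" w] scaleC_complex_def algebra_simps)
      have "(\<lambda>n. Q (p n) + (r\<^sup>2 * (norm w)\<^sup>2 + 2 * r * Re (cinner w (y n) - d)))
          \<longlonglongrightarrow> m + (r\<^sup>2 * (norm w)\<^sup>2 + 2 * r * Re (cinner w x - d))"
        by (intro tendsto_intros Qlim x)
      then have "m \<le> m + (r\<^sup>2 * (norm w)\<^sup>2 + 2 * r * Re (cinner w x - d))"
        using ineq by (intro LIMSEQ_le_const) auto
      then show ?thesis by simp
    qed
    have Re0: "Re (cinner w x - d) = 0" if wd: "(w, d) \<in> S" for w d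
    proof (rule ccontr)
      define s where "s = Re (cinner w x - d)"
      define a where "a = (norm w)\<^sup>2 + 1"
      assume "Re (cinner w x - d) \<noteq> 0"
      then have s: "s \<noteq> 0" by (simp add: s_def)
      have a: "a > 0" by (auto simp: a_def intro!: add_nonneg_pos)
      have "0 \<le> (- s / a)\<^sup>2 * (norm w)\<^sup>2 + 2 * (- s / a) * s"
        using ge[OF wd, of "- s / a"] by (simp only: s_def)
      also have "\<dots> \<le> (- s / a)\<^sup>2 * a + 2 * (- s / a) * s"
        by (intro add_right_mono mult_left_mono) (auto simp: a_def)
      also have "\<dots> = - (s\<^sup>2 / a)" using a by (simp add: field_simps power2_eq_square)
      finally show False using s a by (simp add: divide_le_0_iff)
    qed
    have "Im (cinner v x - c) = 0"
      using Re0[of "(- \<i>) *\<^sub>C v" "(- \<i>) * c"] scale[OF vc, of "- \<i>"]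
      by (simp add: scaleC_prod_def scaleC_complex_def cinner_simps scaleC_minus_left)
    with Re0[OF vc] show ?thesis by (simp add: complex_eq_iff)
  qed
  \<comment> \<open>The minimum is \<open>- \<parallel>x\<parallel>\<^sup>2\<close>, which turns the lower bound \<open>- M\<close> into the norm estimate.\<close>
  have "(\<lambda>n. Q (p n)) \<longlonglongrightarrow> (norm x)\<^sup>2 - 2 * Re (cinner x x)"
  proof -
    have "Q (p n) = (norm (y n))\<^sup>2 - 2 * Re (cinner (y n) x)" for n
      using eq[of "fst (p n)" "snd (p n)"] pS[of n] by (simp add: Q_def y_def)
    then show ?thesis by (simp only:) (intro tendsto_intros x)
  qed
  then have "m = (norm x)\<^sup>2 - 2 * Re (cinner x x)" using Qlim LIMSEQ_unique by blast
  then have "(norm x)\<^sup>2 \<le> M" using mM by (simp add: norm_sq_cinner)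
  with xin eq show ?thesis by blast
qed

text \<open>The linear relation to be solved here consists of the finite linear combinations of the pairs
  \<open>(\<eta> i, b i)\<close>.  It need not be the graph of a function beforehand; that it is one follows from the bound.\<close>

lemma moment_problem:
  fixes \<eta> :: "'j \<Rightarrow> 'a::chilbert_space"
  assumes bound: "\<And>F c. finite F \<Longrightarrow> F \<subseteq> J \<Longrightarrow>
      2 * Re (\<Sum>i\<in>F. c i * b i) \<le> (norm (\<Sum>i\<in>F. c i *\<^sub>C \<eta> i))\<^sup>2 + M"
  shows "\<exists>x\<in>ccspan (\<eta> ` J). (\<forall>i\<in>J. cinner (\<eta> i) x = b i) \<and> (norm x)\<^sup>2 \<le> M"
proof -
  define comb where "comb F c = ((\<Sum>i\<in>F. c i *\<^sub>C \<eta> i), (\<Sum>i\<in>F. c i * b i))" for F c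
  define S where "S = {comb F c | F c. finite F \<and> F \<subseteq> J}"
  have ext: "comb F c = comb (F \<union> G) (\<lambda>i. if i \<in> F then c i else 0)"
    if "finite F" "finite G" for F G c
    unfolding comb_def using that
    by (intro arg_cong2[where f = Pair] sum.mono_neutral_cong_left) auto
  have "\<exists>x\<in>closure (fst ` S). (\<forall>y b. (y, b) \<in> S \<longrightarrow> cinner y x = b) \<and> (norm x)\<^sup>2 \<le> M"
  proof (rule linear_relation_moment)
    show "0 \<in> S" unfolding S_def comb_def zero_prod_def by (force intro!: exI[of _ "{}"])
    show "p + q \<in> S" if p: "p \<in> S" and q: "q \<in> S" for p q
    proof -
      obtain F c where F: "finite F" "F \<subseteq> J" "p = comb F c" using p by (auto simp: S_def)
      obtain G d where G: "finite G" "G \<subseteq> J" "q = comb G d" using q by (auto simp: S_def)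
      let ?c = "\<lambda>i. if i \<in> F then c i else 0" and ?d = "\<lambda>i. if i \<in> G then d i else 0"
      have "p = comb (F \<union> G) ?c" unfolding F(3) by (rule ext[OF F(1) G(1)])
      moreover have "q = comb (F \<union> G) ?d"
        unfolding G(3) using ext[OF G(1) F(1), of d] by (simp only: Un_commute)
      ultimately have "p + q = comb (F \<union> G) (\<lambda>i. ?c i + ?d i)"
        by (simp add: comb_def sum.distrib[symmetric] scaleC_add_left distrib_right)
      then show ?thesis unfolding S_def using F G by blast
    qed
    show "a *\<^sub>C p \<in> S" if p: "p \<in> S" for a p
    proof -
      obtain F c where F: "finite F" "F \<subseteq> J" "p = comb F c" using p by (auto simp: S_def)
      then have "a *\<^sub>C p = comb F (\<lambda>i. a * c i)"
        by (simp add: comb_def scaleC_prod_def scaleC_sum_right scaleC_scaleC sum_distrib_left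
            scaleC_complex_def mult.assoc)
      then show ?thesis unfolding S_def using F by blast
    qed
    show "2 * Re d \<le> (norm y)\<^sup>2 + M" if "(y, d) \<in> S" for y d
      using that bound by (auto simp: S_def comb_def)
  qed
  then obtain x where x: "x \<in> closure (fst ` S)" "\<And>y d. (y, d) \<in> S \<Longrightarrow> cinner y x = d" "(norm x)\<^sup>2 \<le> M"
    by blast
  have "(\<Sum>i\<in>F. c i *\<^sub>C \<eta> i) \<in> ccspan (\<eta> ` J)" if "F \<subseteq> J" for F c
    by (rule closed_csubspace_sum[OF closed_csubspace_ccspan],
        rule closed_csubspaceD(3)[OF closed_csubspace_ccspan], rule ccspan_superset)
       (use that in auto)
  then have "fst ` S \<subseteq> ccspan (\<eta> ` J)" by (auto simp: S_def comb_def)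
  then have "x \<in> ccspan (\<eta> ` J)"
    using x(1) closure_minimal closed_csubspaceD(4)[OF closed_csubspace_ccspan] by blast
  moreover have "cinner (\<eta> i) x = b i" if "i \<in> J" for i
  proof (rule x(2))
    have "comb {i} (\<lambda>_. 1) \<in> S" unfolding S_def using that by blast
    then show "(\<eta> i, b i) \<in> S" by (simp add: comb_def)
  qed
  ultimately show ?thesis using x(3) by blast
qed

section \<open>Orthogonal projections, adjoints and inverses\<close>

lemma riesz_closed_subspace:
  fixes L :: "'a::chilbert_space \<Rightarrow> complex"
  assumes S: "closed_csubspace S"
    and add: "\<And>x y. x \<in> S \<Longrightarrow> y \<in> S \<Longrightarrow> L (x + y) = L x + L y"
    and scale: "\<And>c x. x \<in> S \<Longrightarrow> L (c *\<^sub>C x) = c * L x"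
    and bound: "\<And>x. x \<in> S \<Longrightarrow> cmod (L x) \<le> K * norm x"
  shows "\<exists>x\<in>S. \<forall>y\<in>S. cinner y x = L y"
proof -
  have L0: "L 0 = 0" using scale[of 0 0] closed_csubspaceD(1)[OF S] by simp
  have sum: "L (\<Sum>i\<in>F. c i *\<^sub>C i) = (\<Sum>i\<in>F. c i * L i)" if "finite F" "F \<subseteq> S" for F c
    using that
  proof (induction F rule: finite_induct)
    case (insert i F)
    then show ?case
      by (simp add: add scale closed_csubspaceD(3)[OF S] closed_csubspace_sum[OF S] subset_iff)
  qed (simp add: L0)
  have "\<exists>x\<in>ccspan (id ` S). (\<forall>i\<in>S. cinner (id i) x = L i) \<and> (norm x)\<^sup>2 \<le> K\<^sup>2"
  proof (rule moment_problem)
    fix F and c :: "'a \<Rightarrow> complex" assume F: "finite F" "F \<subseteq> S"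
    define y where "y = (\<Sum>i\<in>F. c i *\<^sub>C i)"
    have y: "y \<in> S" unfolding y_def
      using F by (auto intro!: closed_csubspace_sum[OF S] closed_csubspaceD(3)[OF S])
    have "2 * Re (L y) \<le> 2 * (K * norm y)"
      using complex_Re_le_cmod[of "L y"] bound[OF y] by simp
    also have "\<dots> \<le> (norm y)\<^sup>2 + K\<^sup>2"
      using sum_squares_bound[of "norm y" K] by (simp add: mult_ac)
    finally show "2 * Re (\<Sum>i\<in>F. c i * L i) \<le> (norm (\<Sum>i\<in>F. c i *\<^sub>C id i))\<^sup>2 + K\<^sup>2"
      using sum[OF F, of c] by (simp add: y_def)
  qed
  moreover have "ccspan (id ` S) \<subseteq> S" by (rule ccspan_minimal[OF S]) simp
  ultimately show ?thesis by auto
qed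

definition proj :: "'a::chilbert_space set \<Rightarrow> 'a \<Rightarrow> 'a" where
  "proj S x = (SOME p. p \<in> S \<and> (\<forall>y\<in>S. cinner y p = cinner y x))"

lemma proj_exists:
  fixes x :: "'a::chilbert_space"
  assumes "closed_csubspace S"
  shows "\<exists>p\<in>S. \<forall>y\<in>S. cinner y p = cinner y x"
  by (rule riesz_closed_subspace[OF assms, where L = "\<lambda>y. cinner y x" and K = "norm x"])
     (use cinner_cauchy_schwarz[of _ x] in \<open>auto simp: cinner_simps mult.commute\<close>)

lemma
  assumes "closed_csubspace S"
  shows proj_in: "proj S x \<in> S"
    and cinner_proj_right: "y \<in> S \<Longrightarrow> cinner y (proj S x) = cinner y x"
proof -
  have "proj S x \<in> S \<and> (\<forall>y\<in>S. cinner y (proj S x) = cinner y x)"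
    unfolding proj_def by (rule someI_ex) (use proj_exists[OF assms, of x] in blast)
  then show "proj S x \<in> S" "y \<in> S \<Longrightarrow> cinner y (proj S x) = cinner y x" by auto
qed

lemma cinner_proj_left:
  assumes "closed_csubspace S" "y \<in> S" shows "cinner (proj S x) y = cinner x y"
  using cinner_proj_right[OF assms, of x] cinner_commute by metis

lemma proj_unique:
  assumes S: "closed_csubspace S" and p: "p \<in> S" and "\<And>y. y \<in> S \<Longrightarrow> cinner y p = cinner y x"
  shows "proj S x = p"
proof -
  have "proj S x - p \<in> S" by (intro closed_csubspaceD[OF S] proj_in[OF S] p)
  then have "cinner (proj S x - p) (proj S x - p) = 0"
    using cinner_proj_right[OF S] assms(3) by (simp add: cinner_diff_right)
  then show ?thesis by simp
qed

lemma proj_fixed: "closed_csubspace S \<Longrightarrow> x \<in> S \<Longrightarrow> proj S x = x"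
  by (rule proj_unique) auto

lemma proj_add:
  assumes S: "closed_csubspace S" shows "proj S (x + y) = proj S x + proj S y"
  by (rule proj_unique[OF S])
     (auto intro!: closed_csubspaceD[OF S] proj_in[OF S] simp: cinner_simps cinner_proj_right[OF S])

lemma proj_scaleC:
  assumes S: "closed_csubspace S" shows "proj S (c *\<^sub>C x) = c *\<^sub>C proj S x"
  by (rule proj_unique[OF S])
     (auto intro!: closed_csubspaceD[OF S] proj_in[OF S] simp: cinner_simps cinner_proj_right[OF S])

lemma cinner_proj_proj:
  assumes S: "closed_csubspace S" shows "cinner (proj S x) (proj S y) = cinner (proj S x) y"
  by (rule cinner_proj_right[OF S proj_in[OF S]])

lemma cinner_proj_swap:
  assumes S: "closed_csubspace S" shows "cinner (proj S x) y = cinner x (proj S y)"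
  using cinner_proj_proj[OF S, of x y] cinner_proj_left[OF S proj_in[OF S], of x y] by simp

lemma norm_proj_le:
  assumes S: "closed_csubspace S" shows "norm (proj S x) \<le> norm x"
proof -
  have "(norm (proj S x))\<^sup>2 = Re (cinner (proj S x) x)"
    by (simp add: norm_sq_cinner cinner_proj_proj[OF S])
  also have "\<dots> \<le> norm (proj S x) * norm x" by (rule Re_cinner_le)
  finally have "norm (proj S x) * norm (proj S x) \<le> norm (proj S x) * norm x"
    by (simp add: power2_eq_square)
  then show ?thesis by (cases "norm (proj S x) = 0") (auto simp: mult_le_cancel_left)
qed

lemma bounded_linear_proj: "closed_csubspace S \<Longrightarrow> bounded_linear (proj S)"
  by (rule bounded_linear_intro[where K = 1])
     (auto simp: proj_add proj_scaleC scaleR_scaleC norm_proj_le)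

lemma clinear_simps:
  assumes "clinear T"
  shows "T (x + y) = T x + T y" "T (c *\<^sub>C x) = c *\<^sub>C T x" "T 0 = 0" "T (- x) = - T x"
    "T (x - y) = T x - T y"
proof -
  show *: "T (x + y) = T x + T y" "T (c *\<^sub>C x) = c *\<^sub>C T x" for x y c
    using assms by (auto simp: clinear_on_def)
  show "T 0 = 0" using *(2)[of 0 0] by simp
  show m: "T (- x) = - T x" for x using *(2)[of "-1" x] by (simp add: scaleC_minus1)
  show "T (x - y) = T x - T y" using *(1)[of x "- y"] m by simp
qed

lemma clinearI:
  "(\<And>x y. T (x + y) = T x + T y) \<Longrightarrow> (\<And>c x. T (c *\<^sub>C x) = c *\<^sub>C T x) \<Longrightarrow> clinear T"
  by (auto simp: clinear_on_def)

lemma clinear_sum: "clinear T \<Longrightarrow> T (\<Sum>i\<in>F. x i) = (\<Sum>i\<in>F. T (x i))"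
  by (induction F rule: infinite_finite_induct) (auto simp: clinear_simps)

text \<open>The adjoint is taken with respect to the real inner product \<open>Re \<langle>_, _\<rangle>\<close>.  It then exists for
  every real-linear operator, so that taking adjoints is a bounded linear map on the whole operator
  space and can be differentiated through; on complex-linear operators it is the usual adjoint.\<close>

definition cadj :: "('a::chilbert_space \<Rightarrow>\<^sub>L 'b::complex_inner) \<Rightarrow> 'b \<Rightarrow>\<^sub>L 'a" where
  "cadj T = Blinfun (\<lambda>y. SOME x. \<forall>a. Re (cinner a x) = Re (cinner (T a) y))"

text \<open>A real functional \<open>g\<close> is the real part of the complex functional \<open>a \<mapsto> g a - \<i> g (\<i> a)\<close>.\<close>

lemma real_riesz:
  fixes g :: "'a::chilbert_space \<Rightarrow> real"
  assumes "bounded_linear g"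
  shows "\<exists>x. \<forall>a. Re (cinner a x) = g a"
proof -
  interpret g: bounded_linear g by (rule assms)
  obtain K where K: "\<And>a. norm (g a) \<le> norm a * K" using g.bounded by blast
  define L where "L a = Complex (g a) (- g (\<i> *\<^sub>C a))" for a
  have L_scale: "L (c *\<^sub>C a) = c * L a" for c a
  proof -
    have *: "c *\<^sub>C a = Re c *\<^sub>R a + Im c *\<^sub>R (\<i> *\<^sub>C a)"
      unfolding scaleR_scaleC scaleC_scaleC scaleC_add_left[symmetric]
      by (rule arg_cong[where f = "\<lambda>c. c *\<^sub>C a"]) (simp add: complex_eq_iff)
    have **: "\<i> *\<^sub>C c *\<^sub>C a = (- Im c) *\<^sub>R a + Re c *\<^sub>R (\<i> *\<^sub>C a)"
      unfolding scaleR_scaleC scaleC_scaleC scaleC_add_left[symmetric]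
      by (rule arg_cong[where f = "\<lambda>c. c *\<^sub>C a"]) (simp add: complex_eq_iff)
    have "g (c *\<^sub>C a) = Re c * g a + Im c * g (\<i> *\<^sub>C a)"
      by (simp only: * g.add g.scaleR real_scaleR_def)
    moreover have "g (\<i> *\<^sub>C c *\<^sub>C a) = (- Im c) * g a + Re c * g (\<i> *\<^sub>C a)"
      by (simp only: ** g.add g.scaleR real_scaleR_def)
    ultimately show ?thesis by (simp add: L_def complex_eq_iff algebra_simps)
  qed
  have "\<exists>x\<in>UNIV. \<forall>y\<in>UNIV. cinner y x = L y"
  proof (rule riesz_closed_subspace[OF closed_csubspace_UNIV, where K = "2 * K"])
    show "cmod (L x) \<le> 2 * K * norm x" for x
    proof -
      have "\<bar>g x\<bar> \<le> norm x * K" "\<bar>g (\<i> *\<^sub>C x)\<bar> \<le> norm x * K"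
        using K[of x] K[of "\<i> *\<^sub>C x"] by (simp_all add: norm_scaleC)
      then show ?thesis using cmod_le[of "L x"] by (simp add: L_def mult_ac)
    qed
  qed (auto simp: L_scale, auto simp: L_def complex_eq_iff g.add scaleC_add_right)
  then obtain x where "\<And>y. cinner y x = L y" by blast
  then show ?thesis by (intro exI[of _ x]) (simp add: L_def)
qed

lemma eq_if_Re_cinner_eq:
  assumes "\<And>a. Re (cinner a x) = Re (cinner a y)"
  shows "x = (y :: 'a::complex_inner)"
proof -
  have "(norm (x - y))\<^sup>2 = 0"
    unfolding norm_sq_cinner using assms[of "x - y"] by (simp add: cinner_simps)
  then show ?thesis by simp
qed

lemma
  fixes T :: "'a::chilbert_space \<Rightarrow>\<^sub>L 'b::complex_inner"
  shows Re_cinner_cadj: "Re (cinner a (cadj T y)) = Re (cinner (T a) y)"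
    and norm_cadj_le: "norm (cadj T) \<le> norm T"
proof -
  define t where "t y = (SOME x. \<forall>a. Re (cinner a x) = Re (cinner (T a) y))" for y
  have t: "Re (cinner a (t y)) = Re (cinner (T a) y)" for a y
  proof -
    have "bounded_linear (\<lambda>a. Re (cinner (T a) y))"
      by (intro bounded_linear_compose[OF bounded_linear_Re]
          bounded_linear_compose[OF bounded_bilinear.bounded_linear_left[OF bounded_bilinear_cinner]]
          blinfun.bounded_linear_right)
    from real_riesz[OF this] show ?thesis unfolding t_def by (rule someI2_ex) blast
  qed
  have norm_t: "norm (t y) \<le> norm y * norm T" for y
  proof -
    have "(norm (t y))\<^sup>2 = Re (cinner (T (t y)) y)" by (simp add: norm_sq_cinner t)
    also have "\<dots> \<le> norm (T (t y)) * norm y" by (rule Re_cinner_le)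
    also have "\<dots> \<le> (norm T * norm (t y)) * norm y"
      by (intro mult_right_mono norm_blinfun norm_ge_zero)
    finally have "norm (t y) * norm (t y) \<le> norm (t y) * (norm y * norm T)"
      by (simp add: power2_eq_square mult_ac)
    then show ?thesis by (cases "norm (t y) = 0") (auto simp: mult_le_cancel_left)
  qed
  have "bounded_linear t"
    by (rule bounded_linear_intro[OF _ _ norm_t])
       (rule eq_if_Re_cinner_eq, simp add: t cinner_simps scaleR_scaleC)+
  then have eq: "blinfun_apply (cadj T) = t"
    unfolding cadj_def t_def[symmetric] by (rule bounded_linear_Blinfun_apply)
  show "Re (cinner a (cadj T y)) = Re (cinner (T a) y)" by (simp add: eq t)
  show "norm (cadj T) \<le> norm T"
    by (rule norm_blinfun_bound) (auto simp: eq norm_t mult.commute)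
qed

lemma bounded_linear_cadj: "bounded_linear cadj"
proof (rule bounded_linear_intro[where K = 1])
  show "cadj (S + T) = cadj S + cadj T" for S T :: "'a::chilbert_space \<Rightarrow>\<^sub>L 'b::complex_inner"
    by (rule blinfun_eqI, rule eq_if_Re_cinner_eq)
       (simp add: Re_cinner_cadj blinfun.add_left cinner_simps)
  show "cadj (r *\<^sub>R T) = r *\<^sub>R cadj T" for r and T :: "'a::chilbert_space \<Rightarrow>\<^sub>L 'b::complex_inner"
    by (rule blinfun_eqI, rule eq_if_Re_cinner_eq)
       (simp add: Re_cinner_cadj blinfun.scaleR_left cinner_scaleR_left cinner_scaleR_right)
qed (simp add: norm_cadj_le)

lemma cinner_cadj:
  assumes "clinear (blinfun_apply T)"
  shows "cinner a (cadj T y) = cinner (T a) y"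
proof -
  have "Re (cinner (\<i> *\<^sub>C a) (cadj T y)) = Re (cinner (\<i> *\<^sub>C T a) y)"
    by (simp only: Re_cinner_cadj clinear_simps(2)[OF assms])
  then show ?thesis
    by (simp add: complex_eq_iff Re_cinner_cadj cinner_scaleC_left)
qed

lemma cinner_cadj_left:
  assumes "clinear (blinfun_apply T)"
  shows "cinner (cadj T y) a = cinner y (T a)"
  using cinner_cadj[OF assms, of a y] by (metis cinner_commute)

lemma clinear_cadj:
  assumes "clinear (blinfun_apply T)"
  shows "clinear (blinfun_apply (cadj T))"
proof (rule clinearI)
  show "cadj T (x + y) = cadj T x + cadj T y" for x y by (rule blinfun.add_right)
  show "cadj T (c *\<^sub>C x) = c *\<^sub>C cadj T x" for c x
    by (rule cinner_eqI) (simp add: cinner_cadj_left[OF assms] cinner_scaleC_left)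
qed

lemma bounded_opsD:
  assumes "T \<in> bounded_ops S"
  shows "x \<in> S \<Longrightarrow> T x \<in> S" "x \<in> S \<Longrightarrow> y \<in> S \<Longrightarrow> T (x + y) = T x + T y"
    "x \<in> S \<Longrightarrow> T (c *\<^sub>C x) = c *\<^sub>C T x" "\<exists>K\<ge>0. \<forall>x\<in>S. norm (T x) \<le> K * norm x"
proof -
  show "x \<in> S \<Longrightarrow> T x \<in> S" "x \<in> S \<Longrightarrow> y \<in> S \<Longrightarrow> T (x + y) = T x + T y"
    "x \<in> S \<Longrightarrow> T (c *\<^sub>C x) = c *\<^sub>C T x"
    using assms by (auto simp: bounded_ops_def clinear_on_def)
  obtain K where "\<And>x. x \<in> S \<Longrightarrow> norm (T x) \<le> K * norm x"
    using assms by (auto simp: bounded_ops_def)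
  then have "norm (T x) \<le> \<bar>K\<bar> * norm x" if "x \<in> S" for x
    using that by (meson abs_ge_self dual_order.trans mult_right_mono norm_ge_zero)
  then show "\<exists>K\<ge>0. \<forall>x\<in>S. norm (T x) \<le> K * norm x" by (intro exI[of _ "\<bar>K\<bar>"]) auto
qed

lemma bounded_opsI:
  assumes "\<And>x. x \<in> S \<Longrightarrow> T x \<in> S" "\<And>x y. x \<in> S \<Longrightarrow> y \<in> S \<Longrightarrow> T (x + y) = T x + T y"
    "\<And>c x. x \<in> S \<Longrightarrow> T (c *\<^sub>C x) = c *\<^sub>C T x" "\<And>x. x \<in> S \<Longrightarrow> norm (T x) \<le> K * norm x"
  shows "T \<in> bounded_ops S"
proof -
  have "\<exists>K. \<forall>x\<in>S. norm (T x) \<le> K * norm x" using assms(4) by blast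
  then show ?thesis using assms(1-3) by (auto simp: bounded_ops_def clinear_on_def)
qed

lemma bounded_ops_diff:
  assumes S: "closed_csubspace S" and T: "T \<in> bounded_ops S" and x: "x \<in> S" and y: "y \<in> S"
  shows "T (x - y) = T x - T y"
  using bounded_opsD(2)[OF T x closed_csubspaceD(5)[OF S y]] bounded_opsD(3)[OF T y, of "-1"]
  by (simp add: scaleC_minus1)

lemma boundedly_invertible_onD:
  assumes "boundedly_invertible_on S T" and "T ` S \<subseteq> S" and "y \<in> S"
  shows "inv_into S T y \<in> S" "T (inv_into S T y) = y" "x \<in> S \<Longrightarrow> inv_into S T (T x) = x"
proof -
  obtain R where R: "R \<in> bounded_ops S" "\<And>x. x \<in> S \<Longrightarrow> R (T x) = x \<and> T (R x) = x"
    using assms(1) by (auto simp: boundedly_invertible_on_def)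
  have y: "y \<in> T ` S" using R(2)[OF assms(3)] bounded_opsD(1)[OF R(1) assms(3)] by force
  have "inj_on T S" by (rule inj_on_inverseI[of S R]) (use R(2) in auto)
  then show "x \<in> S \<Longrightarrow> inv_into S T (T x) = x" by simp
  show "inv_into S T y \<in> S" "T (inv_into S T y) = y"
    using y by (auto intro: inv_into_into f_inv_into_f)
qed

text \<open>A form of the Lax-Milgram lemma.  For small \<open>t > 0\<close> the map \<open>x \<mapsto> x - t (\<mu> T x - y)\<close> is a
  contraction, and its fixed point solves \<open>\<mu> T x = y\<close>.\<close>

lemma boundedly_invertible_on_coercive:
  fixes S :: "'a::chilbert_space set"
  assumes S: "closed_csubspace S" and T: "T \<in> bounded_ops S" and \<delta>: "\<delta> > 0"
    and coercive: "\<And>x. x \<in> S \<Longrightarrow> \<delta> * (norm x)\<^sup>2 \<le> Re (\<mu> * cinner (T x) x)"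
  shows "boundedly_invertible_on S T"
proof -
  obtain K where K: "K \<ge> 0" "\<And>x. x \<in> S \<Longrightarrow> norm (T x) \<le> K * norm x"
    using bounded_opsD(4)[OF T] by blast
  \<comment> \<open>With \<open>t = \<delta> / a\<close> the squared contraction factor \<open>1 - 2 t \<delta> + t\<^sup>2 a\<close> is \<open>1 - t \<delta>\<close>; the summand \<open>\<delta>\<^sup>2\<close>
    keeps \<open>t \<delta> \<le> 1\<close> and \<open>a > 0\<close>.\<close>
  define a where "a = (cmod \<mu> * K)\<^sup>2 + \<delta>\<^sup>2"
  have a: "a > 0" using \<delta> by (auto simp: a_def intro: add_nonneg_pos)
  define t where "t = \<delta> / a"
  have t: "t > 0" using \<delta> a by (simp add: t_def)
  have sub: "T (x - y) = T x - T y" if "x \<in> S" "y \<in> S" for x y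
    by (rule bounded_ops_diff[OF S T that])
  define q where "q = sqrt (1 - t * \<delta>)"
  have td: "t * \<delta> > 0" "t * \<delta> \<le> 1"
    using t \<delta> a by (auto simp: t_def a_def power2_eq_square divide_simps)
  then have q: "0 \<le> q" "q < 1" "q\<^sup>2 = 1 - t * \<delta>"
    by (auto simp: q_def real_sqrt_lt_1_iff)
  have contr: "norm (x - (of_real t * \<mu>) *\<^sub>C T x) \<le> q * norm x" if x: "x \<in> S" for x
  proof -
    have "(norm (x - (of_real t * \<mu>) *\<^sub>C T x))\<^sup>2
        = (norm x)\<^sup>2 - 2 * t * Re (\<mu> * cinner (T x) x) + t\<^sup>2 * (cmod \<mu> * norm (T x))\<^sup>2"
      by (simp add: norm_diff_sq Re_cinner_commute[of x] cinner_scaleC_left norm_scaleC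
          norm_mult power_mult_distrib mult.assoc)
    also have "\<dots> \<le> (norm x)\<^sup>2 - 2 * t * (\<delta> * (norm x)\<^sup>2) + t\<^sup>2 * (a * (norm x)\<^sup>2)"
    proof (intro add_mono diff_mono mult_left_mono)
      have "(cmod \<mu> * norm (T x))\<^sup>2 \<le> (cmod \<mu> * (K * norm x))\<^sup>2"
        by (intro power_mono mult_left_mono K x) auto
      also have "\<dots> \<le> a * (norm x)\<^sup>2"
        by (simp add: a_def power_mult_distrib distrib_right mult.assoc)
      finally show "(cmod \<mu> * norm (T x))\<^sup>2 \<le> a * (norm x)\<^sup>2" .
    qed (use t coercive[OF x] in auto)
    also have "\<dots> = q\<^sup>2 * (norm x)\<^sup>2"
      unfolding q(3) using a by (simp add: t_def field_simps power2_eq_square)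
    finally have "(norm (x - (of_real t * \<mu>) *\<^sub>C T x))\<^sup>2 \<le> (q * norm x)\<^sup>2"
      by (simp add: power_mult_distrib)
    then show ?thesis by (rule power2_le_imp_le) (use q in auto)
  qed
  have ex: "\<exists>x\<in>S. T x = y" if y: "y \<in> S" for y
  proof (cases "\<mu> = 0")
    case True
    have "x = 0" if "x \<in> S" for x
      using coercive[OF that] True \<delta> by (simp add: mult_le_0_iff)
    then show ?thesis using y bounded_opsD(1)[OF T y] by metis
  next
    case False
    define g where "g x = x - (of_real t * \<mu>) *\<^sub>C (T x - y)" for x
    have "\<exists>!x\<in>S. g x = x"
    proof (rule Banach_fix[OF _ _ q(1,2)])
      show "complete S" using closed_csubspaceD(4)[OF S] by (simp add: complete_eq_closed)
      show "S \<noteq> {}" using y by auto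
      show "g ` S \<subseteq> S" unfolding g_def using y bounded_opsD(1)[OF T]
        by (auto intro!: closed_csubspaceD[OF S])
      show "dist (g x) (g z) \<le> q * dist x z" if "x \<in> S" "z \<in> S" for x z
      proof -
        have "g x - g z = (x - z) - (of_real t * \<mu>) *\<^sub>C T (x - z)"
          using that sub by (simp add: g_def scaleC_diff_right)
        then show ?thesis using contr[of "x - z"] that closed_csubspaceD(6)[OF S]
          by (simp add: dist_norm)
      qed
    qed
    then obtain x where "x \<in> S" "g x = x" by blast
    moreover from this(2) have "T x = y" using t False
      by (simp add: g_def scaleC_eq_0_iff)
    ultimately show ?thesis by blast
  qed
  have lower: "\<delta> * norm x \<le> cmod \<mu> * norm (T x)" if x: "x \<in> S" for x
  proof -
    have "\<delta> * (norm x)\<^sup>2 \<le> cmod (\<mu> * cinner (T x) x)"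
      using coercive[OF x] complex_Re_le_cmod order_trans by blast
    also have "\<dots> \<le> cmod \<mu> * (norm (T x) * norm x)"
      unfolding norm_mult by (intro mult_left_mono cinner_cauchy_schwarz) auto
    finally have "norm x * (\<delta> * norm x) \<le> norm x * (cmod \<mu> * norm (T x))"
      by (simp add: power2_eq_square mult_ac)
    then show ?thesis by (cases "norm x = 0") (auto simp: mult_le_cancel_left)
  qed
  have inj: "x = y" if "x \<in> S" "y \<in> S" "T x = T y" for x y
  proof -
    have "\<delta> * norm (x - y) \<le> 0"
      using lower[of "x - y"] closed_csubspaceD(6)[OF S that(1,2)] sub[OF that(1,2)] that(3) by simp
    then show ?thesis using \<delta> by (simp add: mult_le_0_iff)
  qed
  define R where "R y = (SOME x. x \<in> S \<and> T x = y)" for y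
  have R: "R y \<in> S" "T (R y) = y" if "y \<in> S" for y
    using someI_ex[of "\<lambda>x. x \<in> S \<and> T x = y"] ex[OF that] unfolding R_def by blast+
  have "R \<in> bounded_ops S"
  proof (rule bounded_opsI)
    show "R (x + y) = R x + R y" if "x \<in> S" "y \<in> S" for x y
      by (rule inj) (simp_all add: that R bounded_opsD(2)[OF T] closed_csubspaceD(2)[OF S])
    show "R (c *\<^sub>C x) = c *\<^sub>C R x" if "x \<in> S" for c x
      by (rule inj) (simp_all add: that R bounded_opsD(3)[OF T] closed_csubspaceD(3)[OF S])
    show "norm (R x) \<le> (cmod \<mu> / \<delta>) * norm x" if "x \<in> S" for x
      using lower[of "R x"] R[OF that] \<delta> by (simp add: field_simps)
  qed (use R in auto)
  moreover have "R (T x) = x" if "x \<in> S" for x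
    by (rule inj) (simp_all add: that R bounded_opsD(1)[OF T that])
  ultimately show ?thesis unfolding boundedly_invertible_on_def
    by (intro bexI[of _ R] ballI conjI R(2))
qed

section \<open>Anti-unitary involutions\<close>

lemma AUI_onD:
  assumes "AUI_on S \<kappa>" and "x \<in> S"
  shows "\<kappa> x \<in> S" "\<kappa> (\<kappa> x) = x" "y \<in> S \<Longrightarrow> cinner (\<kappa> x) (\<kappa> y) = cinner y x"
  using assms by (auto simp: AUI_on_def)

lemma AUI_swap:
  assumes "AUI_on S \<kappa>" "x \<in> S" "y \<in> S"
  shows "cinner y (\<kappa> x) = cinner x (\<kappa> y)"
  using AUI_onD[OF assms(1)] assms(2,3) by metis

text \<open>An anti-unitary involution maps its domain onto itself, so the images \<open>\<kappa> w\<close> separate points.  Its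
  additivity and antilinearity follow from the inner product identity in this way.\<close>

lemma AUI_eqI:
  assumes S: "closed_csubspace S" and \<kappa>: "AUI_on S \<kappa>" and x: "x \<in> S" and y: "y \<in> S"
    and eq: "\<And>w. w \<in> S \<Longrightarrow> cinner x (\<kappa> w) = cinner y (\<kappa> w)"
  shows "x = y"
proof -
  have d: "x - y \<in> S" by (intro closed_csubspaceD[OF S] x y)
  have "cinner (x - y) (\<kappa> (\<kappa> (x - y))) = 0"
    using eq[OF AUI_onD(1)[OF \<kappa> d]] by (simp add: cinner_diff_left)
  then show ?thesis by (simp add: AUI_onD(2)[OF \<kappa> d])
qed

lemma
  assumes S: "closed_csubspace S" and \<kappa>: "AUI_on S \<kappa>"
  shows AUI_add: "x \<in> S \<Longrightarrow> y \<in> S \<Longrightarrow> \<kappa> (x + y) = \<kappa> x + \<kappa> y"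
    and AUI_scaleC: "x \<in> S \<Longrightarrow> \<kappa> (c *\<^sub>C x) = cnj c *\<^sub>C \<kappa> x"
  by (rule AUI_eqI[OF S \<kappa>];
      simp add: AUI_onD[OF \<kappa>] closed_csubspaceD[OF S] cinner_simps)+

lemma
  assumes S: "closed_csubspace S" and \<kappa>: "AUI_on S \<kappa>"
  shows AUI_zero: "\<kappa> 0 = 0"
    and AUI_minus: "x \<in> S \<Longrightarrow> \<kappa> (- x) = - \<kappa> x"
    and AUI_diff: "x \<in> S \<Longrightarrow> y \<in> S \<Longrightarrow> \<kappa> (x - y) = \<kappa> x - \<kappa> y"
proof -
  show "\<kappa> 0 = 0"
    using AUI_scaleC[OF S \<kappa> closed_csubspaceD(1)[OF S], of 0] by simp
  show m: "x \<in> S \<Longrightarrow> \<kappa> (- x) = - \<kappa> x" for x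
    using AUI_scaleC[OF S \<kappa>, of x "-1"] by (simp add: scaleC_minus1)
  show "x \<in> S \<Longrightarrow> y \<in> S \<Longrightarrow> \<kappa> (x - y) = \<kappa> x - \<kappa> y"
    using AUI_add[OF S \<kappa>, of x "- y"] m[of y] closed_csubspaceD(5)[OF S, of y] by simp
qed

lemma AUI_norm: "AUI_on S \<kappa> \<Longrightarrow> x \<in> S \<Longrightarrow> norm (\<kappa> x) = norm x"
  by (simp add: norm_eq_sqrt_cinner AUI_onD)

lemma AUI_sum:
  assumes S: "closed_csubspace S" and \<kappa>: "AUI_on S \<kappa>"
  shows "(\<And>i. i \<in> F \<Longrightarrow> x i \<in> S) \<Longrightarrow> \<kappa> (\<Sum>i\<in>F. x i) = (\<Sum>i\<in>F. \<kappa> (x i))"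
  by (induction F rule: infinite_finite_induct)
     (auto simp: AUI_zero[OF S \<kappa>] AUI_add[OF S \<kappa>] closed_csubspace_sum[OF S])

lemma AUI_subset: "AUI_on C \<kappa> \<Longrightarrow> S \<subseteq> C \<Longrightarrow> (\<And>x. x \<in> S \<Longrightarrow> \<kappa> x \<in> S) \<Longrightarrow> AUI_on S \<kappa>"
  unfolding AUI_on_def by blast

lemma AUI_map_prod: "AUI_on S \<kappa> \<Longrightarrow> AUI_on T \<mu> \<Longrightarrow> AUI_on (S \<times> T) (map_prod \<kappa> \<mu>)"
  by (auto simp: AUI_on_def cinner_prod_def)

lemma AUI_ccspan:
  assumes C: "closed_csubspace C" and \<kappa>: "AUI_on C \<kappa>" and B: "B \<subseteq> C"
    and inv: "\<And>b. b \<in> B \<Longrightarrow> \<kappa> b \<in> ccspan B" and x: "x \<in> ccspan B"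
  shows "\<kappa> x \<in> ccspan B"
proof -
  define D where "D = {x \<in> C. \<kappa> x \<in> ccspan B}"
  note cl = closed_csubspaceD[OF closed_csubspace_ccspan]
  have "closed_csubspace D"
    unfolding closed_csubspace_def
  proof (intro conjI ballI allI)
    show "closed D"
      unfolding closed_sequential_limits
    proof (intro allI impI, elim conjE)
      fix y l assume y: "\<forall>n. y n \<in> D" and l: "y \<longlonglongrightarrow> l"
      have lC: "l \<in> C" using y l closed_csubspaceD(4)[OF C]
          closed_sequentially[of C y] by (auto simp: D_def)
      have "norm (\<kappa> (y n) - \<kappa> l) = norm (y n - l)" for n
        using AUI_norm[OF \<kappa>, of "y n - l"] AUI_diff[OF C \<kappa>] y lC closed_csubspaceD(6)[OF C]
        by (simp add: D_def)
      then have "(\<lambda>n. \<kappa> (y n)) \<longlonglongrightarrow> \<kappa> l"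
        using l by (simp add: LIMSEQ_iff)
      then have "\<kappa> l \<in> ccspan B"
        using y cl(4)[of B] closed_sequentially[of "ccspan B" "\<lambda>n. \<kappa> (y n)"] by (auto simp: D_def)
      with lC show "l \<in> D" by (simp add: D_def)
    qed
  qed (auto simp: D_def AUI_zero[OF C \<kappa>] AUI_add[OF C \<kappa>] AUI_scaleC[OF C \<kappa>]
      intro!: closed_csubspaceD(1-3)[OF C] cl(1-3))
  moreover have "B \<subseteq> D" using B inv by (auto simp: D_def)
  ultimately show ?thesis using ccspan_minimal x by (auto simp: D_def)
qed

text \<open>Moving the involution across the inner product shows that \<open>\<kappa> (proj S x)\<close> satisfies the equations that
  characterize \<open>proj S (\<kappa> x)\<close>.\<close>

lemma proj_AUI:
  assumes \<kappa>: "AUI_on C \<kappa>" and S: "closed_csubspace S" "S \<subseteq> C"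
    and inv: "\<And>x. x \<in> S \<Longrightarrow> \<kappa> x \<in> S" and x: "x \<in> C"
  shows "proj S (\<kappa> x) = \<kappa> (proj S x)"
proof (rule proj_unique[OF S(1)])
  show "\<kappa> (proj S x) \<in> S" by (intro inv proj_in S)
  fix y assume y: "y \<in> S"
  have "cinner y (\<kappa> (proj S x)) = cinner (proj S x) (\<kappa> y)"
    using S y proj_in[OF S(1)] by (intro AUI_swap[OF \<kappa>]) auto
  also have "\<dots> = cinner x (\<kappa> y)" by (intro cinner_proj_left S inv y)
  also have "\<dots> = cinner y (\<kappa> x)" using S y x by (intro AUI_swap[OF \<kappa>]) auto
  finally show "cinner y (\<kappa> (proj S x)) = cinner y (\<kappa> x)" .
qed

text \<open>The image \<open>\<kappa> x\<close> is prescribed by its moments against the permuted family \<open>\<eta> (\<sigma> i)\<close>.  The moment problem is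
  solvable because both families have the same Gram matrix up to conjugation, and its solution is
  no longer than \<open>x\<close>; as \<open>\<kappa>\<close> is an involution, it is isometric.\<close>

lemma AUI_extension:
  fixes \<eta> :: "'j \<Rightarrow> 'a::chilbert_space"
  assumes \<sigma>: "\<And>i. i \<in> J \<Longrightarrow> \<sigma> i \<in> J" "\<And>i. i \<in> J \<Longrightarrow> \<sigma> (\<sigma> i) = i"
    and gram: "\<And>i j. i \<in> J \<Longrightarrow> j \<in> J \<Longrightarrow> cinner (\<eta> (\<sigma> i)) (\<eta> (\<sigma> j)) = cnj (cinner (\<eta> i) (\<eta> j))"
  shows "\<exists>\<kappa>. AUI_on (ccspan (\<eta> ` J)) \<kappa> \<and> (\<forall>i\<in>J. \<kappa> (\<eta> i) = \<eta> (\<sigma> i))"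
proof -
  define C where "C = ccspan (\<eta> ` J)"
  have C: "closed_csubspace C" unfolding C_def by (rule closed_csubspace_ccspan)
  have \<eta>C: "\<eta> i \<in> C" if "i \<in> J" for i unfolding C_def using that by (intro ccspan_superset) auto
  have ex: "\<exists>y\<in>C. (\<forall>i\<in>J. cinner (\<eta> (\<sigma> i)) y = cnj (cinner (\<eta> i) x)) \<and> (norm y)\<^sup>2 \<le> (norm x)\<^sup>2" for x
  proof -
    have "\<exists>y\<in>ccspan ((\<lambda>i. \<eta> (\<sigma> i)) ` J).
        (\<forall>i\<in>J. cinner (\<eta> (\<sigma> i)) y = cnj (cinner (\<eta> i) x)) \<and> (norm y)\<^sup>2 \<le> (norm x)\<^sup>2"
    proof (rule moment_problem)
      fix F c assume F: "finite F" "F \<subseteq> J"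
      define z where "z = (\<Sum>i\<in>F. cnj (c i) *\<^sub>C \<eta> i)"
      have "cinner (\<Sum>i\<in>F. c i *\<^sub>C \<eta> (\<sigma> i)) (\<Sum>i\<in>F. c i *\<^sub>C \<eta> (\<sigma> i)) = cnj (cinner z z)"
        unfolding z_def cinner_linear_combinations cnj_sum complex_cnj_mult complex_cnj_cnj
        by (intro sum.cong refl) (use F gram in auto)
      then have *: "(norm (\<Sum>i\<in>F. c i *\<^sub>C \<eta> (\<sigma> i)))\<^sup>2 = (norm z)\<^sup>2"
        by (simp add: norm_sq_cinner)
      have "(\<Sum>i\<in>F. c i * cnj (cinner (\<eta> i) x)) = cnj (cinner z x)"
        by (simp add: z_def cinner_sum_left cinner_scaleC_left)
      then have "2 * Re (\<Sum>i\<in>F. c i * cnj (cinner (\<eta> i) x)) = 2 * Re (cinner z x)" by simp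
      also have "\<dots> \<le> (norm z)\<^sup>2 + (norm x)\<^sup>2"
        using norm_diff_sq[of z x] zero_le_power2[of "norm (z - x)"] by linarith
      finally show "2 * Re (\<Sum>i\<in>F. c i * cnj (cinner (\<eta> i) x))
          \<le> (norm (\<Sum>i\<in>F. c i *\<^sub>C \<eta> (\<sigma> i)))\<^sup>2 + (norm x)\<^sup>2"
        by (simp only: *)
    qed
    moreover have "ccspan ((\<lambda>i. \<eta> (\<sigma> i)) ` J) \<subseteq> C"
      unfolding C_def by (rule ccspan_mono) (use \<sigma> in auto)
    ultimately show ?thesis by blast
  qed
  then have "\<forall>x. \<exists>y. y \<in> C \<and> (\<forall>i\<in>J. cinner (\<eta> (\<sigma> i)) y = cnj (cinner (\<eta> i) x)) \<and> (norm y)\<^sup>2 \<le> (norm x)\<^sup>2"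
    by blast
  then obtain \<kappa> where \<kappa>: "\<And>x. \<kappa> x \<in> C"
    "\<And>x i. i \<in> J \<Longrightarrow> cinner (\<eta> (\<sigma> i)) (\<kappa> x) = cnj (cinner (\<eta> i) x)"
    "\<And>x. (norm (\<kappa> x))\<^sup>2 \<le> (norm x)\<^sup>2"
    by metis
  have \<kappa>': "cinner (\<eta> i) (\<kappa> x) = cnj (cinner (\<eta> (\<sigma> i)) x)" if "i \<in> J" for i x
    using \<kappa>(2)[OF \<sigma>(1)[OF that], of x] \<sigma>(2)[OF that] by simp
  have uniq: "x = y" if "x \<in> C" "y \<in> C" "\<And>i. i \<in> J \<Longrightarrow> cinner (\<eta> i) x = cinner (\<eta> i) y" for x y
  proof -
    have "x - y = 0"
      by (rule orthogonal_ccspan_imp_zero[of _ "\<eta> ` J"])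
         (use that closed_csubspaceD(6)[OF C] in \<open>auto simp: C_def[symmetric] cinner_diff_right\<close>)
    then show ?thesis by simp
  qed
  have add: "\<kappa> (x + y) = \<kappa> x + \<kappa> y" for x y
    by (rule uniq) (auto simp: \<kappa> \<kappa>' cinner_simps closed_csubspaceD[OF C])
  have scale: "\<kappa> (c *\<^sub>C x) = cnj c *\<^sub>C \<kappa> x" for c x
    by (rule uniq) (auto simp: \<kappa> \<kappa>' cinner_simps closed_csubspaceD[OF C])
  have inv: "\<kappa> (\<kappa> x) = x" if "x \<in> C" for x
    by (rule uniq) (use that in \<open>auto simp: \<kappa> \<kappa>'\<close>)
  have norm: "(norm (\<kappa> x))\<^sup>2 = (norm x)\<^sup>2" if "x \<in> C" for x
    using \<kappa>(3)[of x] \<kappa>(3)[of "\<kappa> x"] inv[OF that] by simp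
  have Re: "Re (cinner (\<kappa> x) (\<kappa> y)) = Re (cinner x y)" if "x \<in> C" "y \<in> C" for x y
    using norm[OF closed_csubspaceD(2)[OF C that]] norm[OF that(1)] norm[OF that(2)]
    by (simp add: add norm_add_sq)
  have "cinner (\<kappa> x) (\<kappa> y) = cinner y x" if "x \<in> C" "y \<in> C" for x y
  proof -
    have "Re (cinner (\<kappa> x) (\<kappa> (\<i> *\<^sub>C y))) = Re (cinner x (\<i> *\<^sub>C y))"
      by (rule Re) (use that closed_csubspaceD(3)[OF C] in auto)
    then have "Im (cinner (\<kappa> x) (\<kappa> y)) = - Im (cinner x y)"
      by (simp add: scale cinner_scaleC_right)
    then show ?thesis
      using Re[OF that] cinner_commute[of y x] by (simp add: complex_eq_iff)
  qed
  then have "AUI_on C \<kappa>" by (auto simp: AUI_on_def \<kappa> inv)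
  moreover have "\<kappa> (\<eta> i) = \<eta> (\<sigma> i)" if "i \<in> J" for i
  proof (rule uniq)
    fix j assume j: "j \<in> J"
    have "cinner (\<eta> j) (\<kappa> (\<eta> i)) = cnj (cinner (\<eta> (\<sigma> j)) (\<eta> i))" by (rule \<kappa>'[OF j])
    also have "\<dots> = cinner (\<eta> (\<sigma> (\<sigma> j))) (\<eta> (\<sigma> i))" by (rule gram[symmetric]) (use that j \<sigma> in auto)
    finally show "cinner (\<eta> j) (\<kappa> (\<eta> i)) = cinner (\<eta> j) (\<eta> (\<sigma> i))" by (simp only: \<sigma>(2)[OF j])
  qed (use that \<sigma> \<kappa> \<eta>C in auto)
  ultimately show ?thesis unfolding C_def by blast
qed

section \<open>Gram representation of positive semidefinite kernels\<close>

definition psd_kernel_on :: "'j set \<Rightarrow> ('j \<Rightarrow> 'j \<Rightarrow> complex) \<Rightarrow> bool" where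
  "psd_kernel_on J K \<longleftrightarrow> (\<forall>i\<in>J. \<forall>j\<in>J. K j i = cnj (K i j)) \<and>
     (\<forall>F c. finite F \<longrightarrow> F \<subseteq> J \<longrightarrow> 0 \<le> Re (\<Sum>i\<in>F. \<Sum>j\<in>F. c i * cnj (c j) * K i j))"

text \<open>Along a well-order of the index set, the vector for \<open>i\<close> is the solution of the moment problem that
  the earlier vectors impose, corrected in the fresh direction \<open>e i\<close> so as to have the right norm.
  Positive semidefiniteness is the inequality that makes the moment problem solvable with a small
  enough solution.  The representing space is given in advance, and no quotient or completion is formed.\<close>

theorem gram_representation:
  fixes e :: "'i \<Rightarrow> 'a::chilbert_space"
  assumes e: "\<And>i j. cinner (e i) (e j) = (if i = j then 1 else 0)" and K: "psd_kernel_on UNIV K"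
  shows "\<exists>\<eta> :: 'i \<Rightarrow> 'a. \<forall>i j. cinner (\<eta> i) (\<eta> j) = K i j"
proof -
  have herm: "K j i = cnj (K i j)" for i j using K unfolding psd_kernel_on_def by blast
  have psd: "0 \<le> Re (\<Sum>i\<in>F. \<Sum>j\<in>F. c i * cnj (c j) * K i j)" if "finite F" for F c
    using K that unfolding psd_kernel_on_def by blast
  obtain r :: "'i rel" where r: "well_order_on UNIV r" using well_order_on by blast
  define R where "R = r - Id"
  have wfR: "wf R" and r_refl: "\<And>i. (i, i) \<in> r" and trans: "trans r" and anti: "antisym r"
    and total: "\<And>i j. i \<noteq> j \<Longrightarrow> (i, j) \<in> R \<or> (j, i) \<in> R"
    using r by (auto simp: R_def well_order_on_def linear_order_on_def partial_order_on_def
        preorder_on_def refl_on_def total_on_def)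
  define P where "P \<eta> i v \<longleftrightarrow> (\<forall>j. (j, i) \<in> R \<longrightarrow> cinner (\<eta> j) v = K j i) \<and> cinner v v = K i i \<and>
      v \<in> ccspan (e ` {j. (j, i) \<in> r})" for \<eta> :: "'i \<Rightarrow> 'a" and i v
  have gram: "cinner (\<eta> j) (\<eta> k) = K j k" if "P \<eta> j (\<eta> j)" "P \<eta> k (\<eta> k)" for \<eta> j k
  proof (cases "j = k")
    case False
    then consider "(j, k) \<in> R" | "(k, j) \<in> R" using total by blast
    then show ?thesis
    proof cases
      case 2
      then show ?thesis using that herm[of j k] cinner_commute[of "\<eta> j" "\<eta> k"] by (auto simp: P_def)
    qed (use that in \<open>auto simp: P_def\<close>)
  qed (use that in \<open>auto simp: P_def\<close>)
  have "\<exists>\<eta>. \<forall>i. P \<eta> i (\<eta> i)"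
  proof (rule dependent_wf_choice[OF wfR])
    show "P f x v = P g x v" if "\<And>z. (z, x) \<in> R \<Longrightarrow> f z = g z" for f g x v
      using that by (auto simp: P_def)
    fix i and \<eta> :: "'i \<Rightarrow> 'a" assume IH: "\<And>y. (y, i) \<in> R \<Longrightarrow> P \<eta> y (\<eta> y)"
    define D where "D = {j. (j, i) \<in> R}"
    have "\<exists>x\<in>ccspan (\<eta> ` D). (\<forall>j\<in>D. cinner (\<eta> j) x = K j i) \<and> (norm x)\<^sup>2 \<le> Re (K i i)"
    proof (rule moment_problem)
      fix F c assume F: "finite F" "F \<subseteq> D"
      then have iF: "i \<notin> F" by (auto simp: D_def R_def)
      \<comment> \<open>Positivity of the kernel on the coefficient vector \<open>c - \<delta>\<^sub>i\<close> is the bound that is needed.\<close>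
      define d where "d = c(i := -1 :: complex)"
      have d: "d i = -1" "\<And>j. j \<in> F \<Longrightarrow> d j = c j" using iF by (auto simp: d_def)
      have q: "(\<Sum>j\<in>F. \<Sum>k\<in>F. c j * cnj (c k) * K j k)
          = cinner (\<Sum>j\<in>F. c j *\<^sub>C \<eta> j) (\<Sum>j\<in>F. c j *\<^sub>C \<eta> j)"
        unfolding cinner_linear_combinations
        by (intro sum.cong refl) (use F gram IH in \<open>auto simp: D_def subset_iff\<close>)
      have "0 \<le> Re (\<Sum>j\<in>insert i F. \<Sum>k\<in>insert i F. d j * cnj (d k) * K j k)"
        by (rule psd) (use F in simp)
      also have "(\<Sum>j\<in>insert i F. \<Sum>k\<in>insert i F. d j * cnj (d k) * K j k)
          = K i i - (\<Sum>k\<in>F. cnj (c k) * K i k) + ((\<Sum>j\<in>F. \<Sum>k\<in>F. c j * cnj (c k) * K j k)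
            - (\<Sum>j\<in>F. c j * K j i))"
        using F iF by (simp add: d sum.distrib sum_negf sum_subtractf cong: sum.cong)
      also have "(\<Sum>k\<in>F. cnj (c k) * K i k) = cnj (\<Sum>j\<in>F. c j * K j i)"
        unfolding cnj_sum complex_cnj_mult
        by (rule sum.cong[OF refl]) (metis herm)
      finally show "2 * Re (\<Sum>j\<in>F. c j * K j i) \<le> (norm (\<Sum>j\<in>F. c j *\<^sub>C \<eta> j))\<^sup>2 + Re (K i i)"
        unfolding q norm_sq_cinner by simp
    qed
    then obtain x where x: "x \<in> ccspan (\<eta> ` D)" "\<And>j. j \<in> D \<Longrightarrow> cinner (\<eta> j) x = K j i"
      "(norm x)\<^sup>2 \<le> Re (K i i)"
      by blast
    have below: "\<eta> j \<in> ccspan (e ` D)" if "j \<in> D" for j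
    proof -
      have "(k, i) \<in> R" if "(k, j) \<in> r" for k
        using that \<open>j \<in> D\<close> transD[OF trans, of k j i] antisymD[OF anti, of i j]
        by (auto simp: D_def R_def)
      then have "ccspan (e ` {k. (k, j) \<in> r}) \<subseteq> ccspan (e ` D)"
        by (intro ccspan_mono) (auto simp: D_def)
      then show ?thesis using IH[of j] that by (auto simp: P_def D_def)
    qed
    have "ccspan (\<eta> ` D) \<subseteq> ccspan (e ` D)"
      by (rule ccspan_minimal[OF closed_csubspace_ccspan]) (use below in auto)
    with x(1) have xe: "x \<in> ccspan (e ` D)" by blast
    have orth: "cinner w (e i) = 0" if "w \<in> ccspan (e ` D)" for w
      by (rule orthogonal_ccspan[OF that]) (auto simp: D_def R_def e)
    define s where "s = sqrt (Re (K i i) - (norm x)\<^sup>2)"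
    define v where "v = x + complex_of_real s *\<^sub>C e i"
    have "cinner (e i) x = 0" using orth[OF xe] cinner_commute[of "e i" x] by simp
    then have "cinner v v = cinner x x + complex_of_real (s\<^sup>2)"
      by (simp add: v_def cinner_simps orth[OF xe] e power2_eq_square)
    also have "\<dots> = complex_of_real (Re (K i i))"
      using x(3) by (simp add: cinner_self s_def flip: of_real_add)
    also have "\<dots> = K i i" using herm[of i i] by (simp add: complex_eq_iff)
    finally have "cinner v v = K i i" .
    moreover have "cinner (\<eta> j) v = K j i" if "(j, i) \<in> R" for j
      using that x(2)[of j] orth[OF below[of j]] by (simp add: v_def cinner_simps D_def)
    moreover have "v \<in> ccspan (e ` {j. (j, i) \<in> r})"
    proof -
      have "ccspan (e ` D) \<subseteq> ccspan (e ` {j. (j, i) \<in> r})"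
        by (rule ccspan_mono) (auto simp: D_def R_def)
      moreover have "e i \<in> ccspan (e ` {j. (j, i) \<in> r})" using r_refl by (intro ccspan_superset) auto
      ultimately show ?thesis
        unfolding v_def using xe closed_csubspaceD(2,3)[OF closed_csubspace_ccspan] by blast
    qed
    ultimately show "\<exists>v. P \<eta> i v" unfolding P_def by blast
  qed
  then show ?thesis using gram by blast
qed

lemma psd_kernel_on_gram: "psd_kernel_on J (\<lambda>i j. cinner (\<eta> i :: 'a::complex_inner) (\<eta> j))"
  unfolding psd_kernel_on_def
proof (intro conjI ballI allI impI)
  fix F and c :: "'b \<Rightarrow> complex"
  have "(\<Sum>i\<in>F. \<Sum>j\<in>F. c i * cnj (c j) * cinner (\<eta> i) (\<eta> j))
      = cinner (\<Sum>i\<in>F. c i *\<^sub>C \<eta> i) (\<Sum>j\<in>F. c j *\<^sub>C \<eta> j)"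
    by (rule cinner_linear_combinations[symmetric])
  then show "0 \<le> Re (\<Sum>i\<in>F. \<Sum>j\<in>F. c i * cnj (c j) * cinner (\<eta> i) (\<eta> j))"
    by (simp flip: norm_sq_cinner)
qed (rule cinner_commute)

definition ell2_basis :: "'i \<Rightarrow> 'i ell2" where
  "ell2_basis i = Abs_ell2 (\<lambda>j. if j = i then 1 else 0)"

lemma ell2_nth_basis: "ell2_nth (ell2_basis i) j = (if j = i then 1 else 0)"
proof -
  have "(\<lambda>j. (cmod (if j = i then 1 else 0))\<^sup>2) summable_on UNIV \<longleftrightarrow>
      (\<lambda>j. (cmod (if j = i then 1 else 0))\<^sup>2) summable_on {i}"
    by (rule summable_on_cong_neutral) auto
  then show ?thesis unfolding ell2_basis_def by (subst Abs_ell2_inverse) auto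
qed

lemma cinner_ell2_basis: "cinner (ell2_basis i) (ell2_basis j) = (if i = j then 1 else 0)"
proof -
  have "cinner (ell2_basis i) (ell2_basis j)
      = (\<Sum>\<^sub>\<infinity>k. ell2_nth (ell2_basis i) k * cnj (ell2_nth (ell2_basis j) k))"
    by (simp add: cinner_ell2.rep_eq)
  also have "\<dots> = (\<Sum>\<^sub>\<infinity>k\<in>{i}. ell2_nth (ell2_basis i) k * cnj (ell2_nth (ell2_basis j) k))"
    by (rule infsum_cong_neutral) (auto simp: ell2_nth_basis)
  finally show ?thesis by (simp add: ell2_nth_basis)
qed

section \<open>The domains\<close>

text \<open>For \<open>\<bar>l\<bar> = 1\<close> this is the rotated poly-half-plane \<open>(l \<Pi>)\<^sup>N\<close>, described without division.\<close>

definition tilted_halfplane :: "complex \<Rightarrow> (complex ^ 'n) set" where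
  "tilted_halfplane l = {z. \<forall>k. 0 < Re (cnj l * z $ k)}"

lemma mult_cnj_unit: "cmod l = 1 \<Longrightarrow> l * cnj l = 1"
  by (metis complex_norm_square of_real_1 one_power2)

lemma rotated_halfplanes_eq: "rotated_halfplanes = (\<Union>l\<in>sphere 0 1. tilted_halfplane l)"
proof -
  have "z \<in> (\<lambda>p. l * p) ` {p. 0 < Re p} \<longleftrightarrow> 0 < Re (cnj l * z)" if "cmod l = 1" for l z
  proof
    assume "z \<in> (\<lambda>p. l * p) ` {p. 0 < Re p}"
    then obtain p where "z = l * p" "0 < Re p" by auto
    have "cnj l * z = (l * cnj l) * p" using \<open>z = l * p\<close> by simp
    with \<open>0 < Re p\<close> show "0 < Re (cnj l * z)" by (simp only: mult_cnj_unit[OF that] mult_1)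
  next
    assume *: "0 < Re (cnj l * z)"
    have "z = l * (cnj l * z)" using mult_cnj_unit[OF that] by (simp add: mult.assoc[symmetric])
    with * show "z \<in> (\<lambda>p. l * p) ` {p. 0 < Re p}" by blast
  qed
  then show ?thesis by (auto simp: rotated_halfplanes_def tilted_halfplane_def)
qed

lemma poly_halfplane_eq: "poly_halfplane = tilted_halfplane 1"
  by (simp add: poly_halfplane_def tilted_halfplane_def)

lemma tilted_subset_rotated: "cmod l = 1 \<Longrightarrow> tilted_halfplane l \<subseteq> rotated_halfplanes"
  by (auto simp: rotated_halfplanes_eq)

lemma poly_halfplane_subset_rotated: "poly_halfplane \<subseteq> rotated_halfplanes"
  unfolding poly_halfplane_eq by (rule tilted_subset_rotated) simp

lemma open_tilted_halfplane: "open (tilted_halfplane l :: (complex ^ 'n) set)"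
proof -
  have "tilted_halfplane l = (\<Inter>k\<in>UNIV. {z :: complex ^ 'n. 0 < Re (cnj l * z $ k)})"
    by (auto simp: tilted_halfplane_def)
  also have "open \<dots>"
    by (intro open_INT ballI finite open_Collect_less continuous_intros)
  finally show ?thesis .
qed

lemma open_rotated_halfplanes: "open rotated_halfplanes"
  unfolding rotated_halfplanes_eq by (intro open_UN ballI open_tilted_halfplane)

lemma vcnj_vcnj [simp]: "vcnj (vcnj z) = z"
  by (simp add: vcnj_def vec_eq_iff)

lemma vcnj_nth [simp]: "vcnj z $ k = cnj (z $ k)"
  by (simp add: vcnj_def)

lemma vcnj_poly_halfplane [simp]: "vcnj z \<in> poly_halfplane \<longleftrightarrow> z \<in> poly_halfplane"
  by (simp add: poly_halfplane_def)

lemma vcnj_rotated: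
  assumes "z \<in> rotated_halfplanes" shows "vcnj z \<in> rotated_halfplanes"
proof -
  obtain l where l: "cmod l = 1" "z \<in> tilted_halfplane l"
    using assms by (auto simp: rotated_halfplanes_eq)
  have "Re (cnj (cnj l) * vcnj z $ k) = Re (cnj l * z $ k)" for k by simp
  with l(2) have "vcnj z \<in> tilted_halfplane (cnj l)" by (simp only: tilted_halfplane_def mem_Collect_eq simp_thms)
  then show ?thesis using l tilted_subset_rotated[of "cnj l"] by auto
qed

lemma scaleC_vec_nth [simp]: "(c *\<^sub>C x) $ k = c *\<^sub>C (x $ k)"
  by (simp add: scaleC_vec_def)

text \<open>The half-planes tilted by unit numbers \<open>l \<noteq> -m\<close> overlap in a convex open set, so an identity on one of
  them spreads along complex line segments to the other; the opposite half-plane is reached through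
  the one tilted by \<open>\<i>\<close>.\<close>

lemma rotated_identity_theorem:
  fixes F :: "complex ^ 'n \<Rightarrow> 'a::complex_inner"
  assumes holo: "\<And>z. z \<in> rotated_halfplanes \<Longrightarrow> \<exists>D. clinear D \<and> (F has_derivative D) (at z)"
    and zero: "\<And>z. z \<in> poly_halfplane \<Longrightarrow> F z = 0" and z: "z \<in> rotated_halfplanes"
  shows "F z = 0"
proof -
  have step: "F p = 0"
    if m: "cmod m = 1" and l: "cmod l = 1" and ml: "l \<noteq> - m" and p: "p \<in> tilted_halfplane l"
      and zm: "\<And>z. z \<in> tilted_halfplane m \<Longrightarrow> F z = 0" for l m p
  proof -
    \<comment> \<open>\<open>m + l = m (1 + l / m) = l (1 + m / l)\<close> lies in both rotated half-planes.\<close>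
    define q :: "complex ^ 'n" where "q = (\<chi> k. m + l)"
    have pos: "0 < Re (1 + a)" if "cmod a = 1" "a \<noteq> -1" for a
    proof -
      have "- 1 \<le> Re a" using abs_Re_le_cmod[of a] that by linarith
      moreover have "Re a \<noteq> - 1"
      proof
        assume Re: "Re a = - 1"
        then have "(Im a)\<^sup>2 = 0" using cmod_power2[of a] that(1) by simp
        then show False using Re that(2) by (simp add: complex_eq_iff)
      qed
      ultimately show ?thesis by simp
    qed
    have "0 < Re (cnj m * (m + l))"
    proof -
      have "cnj m * (m + l) = 1 + cnj m * l"
        using mult_cnj_unit[OF m] by (simp add: distrib_left mult.commute)
      moreover have "cnj m * l \<noteq> - 1"
      proof
        assume "cnj m * l = - 1"
        then have "m * (cnj m * l) = - m" by simp
        then show False using mult_cnj_unit[OF m] ml by (simp add: mult.assoc[symmetric])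
      qed
      ultimately show ?thesis using pos[of "cnj m * l"] m l by (simp add: norm_mult)
    qed
    then have qm: "q \<in> tilted_halfplane m" by (simp add: q_def tilted_halfplane_def)
    have "0 < Re (cnj l * (m + l))"
    proof -
      have "cnj l * (m + l) = 1 + cnj l * m"
        using mult_cnj_unit[OF l] by (simp add: distrib_left mult.commute)
      moreover have "cnj l * m \<noteq> - 1"
      proof
        assume "cnj l * m = - 1"
        then have "l * (cnj l * m) = - l" by simp
        then have "m = - l" using mult_cnj_unit[OF l] by (simp add: mult.assoc[symmetric])
        then show False using ml by simp
      qed
      ultimately show ?thesis using pos[of "cnj l * m"] m l by (simp add: norm_mult)
    qed
    then have ql: "q \<in> tilted_halfplane l" by (simp add: q_def tilted_halfplane_def)
    define \<gamma> where "\<gamma> t = q + t *\<^sub>C (p - q)" for t :: complex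
    have \<gamma>_deriv: "(\<gamma> has_derivative (\<lambda>t. t *\<^sub>C (p - q))) (at t)" for t
      unfolding \<gamma>_def
      by (auto intro!: derivative_eq_intros
          bounded_linear_imp_has_derivative
          bounded_bilinear.bounded_linear_left[OF bounded_bilinear_scaleC])
    then have cont: "continuous_on UNIV \<gamma>"
      by (meson has_derivative_continuous continuous_at_imp_continuous_on)
    define S where "S = \<gamma> -` tilted_halfplane l"
    define S0 where "S0 = S \<inter> \<gamma> -` tilted_halfplane m"
    have oS: "open S" "open S0"
      unfolding S_def S0_def
      by (intro open_Int open_vimage open_tilted_halfplane cont)+
    have "convex S"
    proof -
      have "S = (\<Inter>k. {t. 0 < Re (cnj l * (q $ k + t * (p $ k - q $ k)))})"
        by (auto simp: S_def \<gamma>_def tilted_halfplane_def scaleC_complex_def)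
      also have "convex \<dots>"
      proof (intro convex_INT)
        fix k
        have "{t. 0 < Re (cnj l * (q $ k + t * (p $ k - q $ k)))}
            = {t. - Re (cnj l * q $ k) < inner (cnj (cnj l * (p $ k - q $ k))) t}"
          by (simp add: inner_complex_def algebra_simps)
        then show "convex {t. 0 < Re (cnj l * (q $ k + t * (p $ k - q $ k)))}"
          by (simp only: convex_halfspace_gt)
      qed
      finally show ?thesis .
    qed
    have "cinner (F p) v = 0" for v
    proof -
      have hol: "(\<lambda>t. cinner (F (\<gamma> t)) v) holomorphic_on S"
        unfolding holomorphic_on_open[OF oS(1)]
      proof (intro ballI allI)
        fix t assume "t \<in> S"
        then have "\<gamma> t \<in> rotated_halfplanes"
          using tilted_subset_rotated[OF l] by (auto simp: S_def)
        then obtain D where D: "clinear D" "(F has_derivative D) (at (\<gamma> t))" using holo by blast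
        have "((\<lambda>t. F (\<gamma> t)) has_derivative (\<lambda>t. D (t *\<^sub>C (p - q)))) (at t)"
          by (rule has_derivative_compose[OF \<gamma>_deriv D(2)])
        then have "((\<lambda>t. cinner (F (\<gamma> t)) v) has_derivative (\<lambda>t. cinner (D (t *\<^sub>C (p - q))) v)) (at t)"
          by (rule bounded_linear.has_derivative[OF
                bounded_bilinear.bounded_linear_left[OF bounded_bilinear_cinner]])
        moreover have "(\<lambda>t. cinner (D (t *\<^sub>C (p - q))) v) = (*) (cinner (D (p - q)) v)"
          by (auto simp: clinear_simps[OF D(1)] cinner_scaleC_left)
        ultimately show "\<exists>f'. ((\<lambda>t. cinner (F (\<gamma> t)) v) has_field_derivative f') (at t)"
          unfolding has_field_derivative_def by metis
      qed
      have "cinner (F (\<gamma> 1)) v = 0"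
      proof (rule analytic_continuation_open[where s = S0 and s' = S and z = 1
            and f = "\<lambda>t. cinner (F (\<gamma> t)) v" and g = "\<lambda>_. 0"])
        have "0 \<in> S0" using qm ql by (simp add: S0_def S_def \<gamma>_def)
        then show "S0 \<noteq> {}" by blast
        show "1 \<in> S" using p by (simp add: S_def \<gamma>_def)
      qed (use oS hol convex_connected[OF \<open>convex S\<close>] zm in \<open>auto simp: S0_def\<close>)
      then show ?thesis by (simp add: \<gamma>_def)
    qed
    then show ?thesis using cinner_self_eq_0_iff by blast
  qed
  obtain l where l: "cmod l = 1" "z \<in> tilted_halfplane l"
    using z by (auto simp: rotated_halfplanes_eq)
  have zero1: "F z = 0" if "z \<in> tilted_halfplane 1" for z
    using zero that by (simp add: poly_halfplane_eq)
  show ?thesis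
  proof (cases "l = - 1")
    case True
    have "F z = 0" if "z \<in> tilted_halfplane \<i>" for z
      by (rule step[OF _ _ _ that zero1]) (auto simp: complex_eq_iff)
    then show ?thesis using True l by (intro step[of \<i> l z]) (auto simp: complex_eq_iff)
  next
    case False
    then show ?thesis by (intro step[OF _ l(1) _ l(2) zero1]) auto
  qed
qed

section \<open>Schur complements of operator pencils\<close>

lemma pencil_in_bounded_ops:
  assumes S: "closed_csubspace S" and A: "\<And>k. A k \<in> bounded_ops S"
  shows "pencil A z \<in> bounded_ops S"
proof -
  have "\<exists>K. \<forall>x\<in>S. norm (A k x) \<le> K * norm x" for k
    using bounded_opsD(4)[OF A] by blast
  then obtain K where K: "\<And>k x. x \<in> S \<Longrightarrow> norm (A k x) \<le> K k * norm x" by metis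
  show ?thesis
  proof (rule bounded_opsI)
    show "pencil A z x \<in> S" if "x \<in> S" for x
      unfolding pencil_def using bounded_opsD(1)[OF A that]
      by (intro closed_csubspace_sum[OF S] closed_csubspaceD(3)[OF S])
    show "pencil A z (x + y) = pencil A z x + pencil A z y" if "x \<in> S" "y \<in> S" for x y
      using that by (simp add: pencil_def bounded_opsD(2)[OF A] scaleC_add_right sum.distrib)
    show "pencil A z (c *\<^sub>C x) = c *\<^sub>C pencil A z x" if "x \<in> S" for c x
      using that by (simp add: pencil_def bounded_opsD(3)[OF A] scaleC_scaleC scaleC_sum_right mult.commute)
    show "norm (pencil A z x) \<le> (\<Sum>k\<in>UNIV. cmod (z $ k) * K k) * norm x" if "x \<in> S" for x
      unfolding pencil_def sum_distrib_right
      by (rule sum_norm_le) (auto simp: norm_scaleC mult.assoc intro!: mult_left_mono K that)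
  qed
qed

lemma block_sum:
  assumes H: "closed_csubspace H" and T: "T \<in> bounded_ops (UNIV \<times> H)" and y: "y \<in> H"
  shows "T (u, y) = (block11 T u + block12 T y, block21 T u + block22 T y)"
proof -
  have "T ((u, 0) + (0, y)) = T (u, 0) + T (0, y)"
    by (rule bounded_opsD(2)[OF T]) (use y closed_csubspaceD(1)[OF H] in auto)
  then show ?thesis by (simp add: block11_def block12_def block21_def block22_def prod_eq_iff)
qed

lemma
  assumes H: "closed_csubspace H" and T: "T \<in> bounded_ops (UNIV \<times> H)"
  shows block22_bounded_ops: "block22 T \<in> bounded_ops H"
    and block21_in: "block21 T u \<in> H"
    and block12_minus: "y \<in> H \<Longrightarrow> block12 T (- y) = - block12 T y"
proof -
  note H0 = closed_csubspaceD(1)[OF H]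
  have 0: "T (0, y) \<in> UNIV \<times> H" if "y \<in> H" for y using bounded_opsD(1)[OF T] that by auto
  obtain K where K: "K \<ge> 0" "\<And>x. x \<in> UNIV \<times> H \<Longrightarrow> norm (T x) \<le> K * norm x"
    using bounded_opsD(4)[OF T] by blast
  have scale: "T (0, c *\<^sub>C x) = c *\<^sub>C T (0, x)" if "x \<in> H" for c x
    using bounded_opsD(3)[OF T, of "(0, x)" c] that by (simp add: scaleC_prod_def)
  show "block22 T \<in> bounded_ops H"
  proof (rule bounded_opsI)
    show "block22 T x \<in> H" if "x \<in> H" for x using 0[OF that] by (auto simp: block22_def)
    show "block22 T (x + y) = block22 T x + block22 T y" if "x \<in> H" "y \<in> H" for x y
      using bounded_opsD(2)[OF T, of "(0, x)" "(0, y)"] that by (simp add: block22_def)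
    show "block22 T (c *\<^sub>C x) = c *\<^sub>C block22 T x" if "x \<in> H" for c x
      by (simp add: block22_def scale[OF that] scaleC_prod_def)
    show "norm (block22 T x) \<le> K * norm x" if "x \<in> H" for x
      using K(2)[of "(0, x)"] norm_snd_le[of "snd (T (0, x))" "fst (T (0, x))"] that
      by (simp add: block22_def norm_Pair)
  qed
  show "block21 T u \<in> H"
    using bounded_opsD(1)[OF T, of "(u, 0)"] H0 by (auto simp: block21_def)
  show "y \<in> H \<Longrightarrow> block12 T (- y) = - block12 T y"
    using scale[of y "-1"] by (simp add: block12_def scaleC_minus1)
qed

text \<open>The value \<open>v\<close> of the Schur complement at \<open>u\<close> is characterized by \<open>T (u, y) = (v, 0)\<close> for some
  \<open>y\<close>; in this form no inverse has to be mentioned.\<close>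

lemma schur_complement_iff:
  assumes H: "closed_csubspace H" and T: "T \<in> bounded_ops (UNIV \<times> H)"
    and inv: "boundedly_invertible_on H (block22 T)"
  shows "block11 T u - block12 T (inv_into H (block22 T) (block21 T u)) = v
    \<longleftrightarrow> (\<exists>y\<in>H. T (u, y) = (v, 0))"
proof -
  note d = block22_bounded_ops[OF H T]
  define x where "x = inv_into H (block22 T) (block21 T u)"
  have sub: "block22 T ` H \<subseteq> H" using bounded_opsD(1)[OF d] by auto
  have x: "x \<in> H" "block22 T x = block21 T u"
    unfolding x_def using boundedly_invertible_onD(1,2)[OF inv sub block21_in[OF H T]] by auto
  have neg: "block22 T (- y) = - block22 T y" if "y \<in> H" for y
    using bounded_opsD(3)[OF d that, of "-1"] by (simp add: scaleC_minus1)
  have yx: "y = - x" if "y \<in> H" "block21 T u + block22 T y = 0" for y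
  proof -
    have "block22 T (- y) = block22 T x"
      using that x by (simp add: neg add_eq_0_iff)
    then show ?thesis
      using boundedly_invertible_onD(3)[OF inv sub x(1) x(1)]
        boundedly_invertible_onD(3)[OF inv sub x(1) closed_csubspaceD(5)[OF H that(1)]] by simp
  qed
  have "T (u, - x) = (block11 T u - block12 T x, 0)"
    using x closed_csubspaceD(5)[OF H x(1)] by (simp add: block_sum[OF H T] neg block12_minus[OF H T])
  then show ?thesis
    unfolding x_def[symmetric] using yx block_sum[OF H T] closed_csubspaceD(5)[OF H x(1)]
    by (metis Pair_inject)
qed

lemma bessmertnyi_schur:
  assumes H: "closed_csubspace H" and rep: "bessmertnyi_representation f H A"
    and z: "z \<in> rotated_halfplanes"
  shows "f z u = v \<longleftrightarrow> (\<exists>y\<in>H. pencil A z (u, y) = (v, 0))"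
proof -
  have "pencil A z \<in> bounded_ops (UNIV \<times> H)"
    using rep by (intro pencil_in_bounded_ops closed_csubspace_Times closed_csubspace_UNIV H)
      (auto simp: bessmertnyi_representation_def)
  then show ?thesis
    using schur_complement_iff[OF H, of "pencil A z" u v] rep z
    by (auto simp: bessmertnyi_representation_def)
qed

section \<open>Holomorphy of the solution operator of a pencil\<close>

lemma scaleC_blinfun_apply [simp]: "blinfun_apply (c *\<^sub>C T) x = c *\<^sub>C blinfun_apply T x"
  by (simp add: scaleC_blinfun.rep_eq)

lemma bounded_linear_scaleC_blinfun:
  "bounded_linear (\<lambda>c. c *\<^sub>C (T :: 'a::real_normed_vector \<Rightarrow>\<^sub>L 'b::complex_inner))"
proof (rule bounded_linear_intro[where K = "norm T"])
  show "norm (c *\<^sub>C T) \<le> norm c * norm T" for c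
    by (rule norm_blinfun_bound)
       (auto simp: norm_scaleC mult.assoc intro!: mult_left_mono norm_blinfun)
qed (auto simp: scaleC_add_left scaleR_scaleC scaleC_scaleC scaleR_conv_of_real scaleC_complex_def)

definition blinfun_pencil ::
  "('n::finite \<Rightarrow> 'a::complex_inner \<Rightarrow>\<^sub>L 'a) \<Rightarrow> complex ^ 'n \<Rightarrow> 'a \<Rightarrow>\<^sub>L 'a" where
  "blinfun_pencil T z = (\<Sum>k\<in>UNIV. z $ k *\<^sub>C T k)"

lemma blinfun_pencil_apply: "blinfun_pencil T z x = pencil (\<lambda>k. blinfun_apply (T k)) z x"
  by (simp add: blinfun_pencil_def pencil_def blinfun.sum_left)

lemma bounded_linear_blinfun_pencil: "bounded_linear (blinfun_pencil T)"
  unfolding blinfun_pencil_def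
  by (intro bounded_linear_sum bounded_linear_compose[OF bounded_linear_scaleC_blinfun]
      bounded_linear_vec_nth)

lemma blinfun_pencil_scaleC: "blinfun_pencil T (c *\<^sub>C z) = c *\<^sub>C blinfun_pencil T z"
  by (simp add: blinfun_pencil_def scaleC_sum_right scaleC_scaleC scaleC_complex_def)

lemma clinear_pencil: "(\<And>k. clinear (T k)) \<Longrightarrow> clinear (pencil T z)"
  by (rule clinearI)
     (simp_all add: pencil_def clinear_simps scaleC_add_right sum.distrib scaleC_scaleC
       scaleC_sum_right mult.commute)

lemma clinear_blinfun_pencil:
  "(\<And>k. clinear (blinfun_apply (T k))) \<Longrightarrow> clinear (blinfun_apply (blinfun_pencil T z))"
  using clinear_pencil[of "\<lambda>k. blinfun_apply (T k)"] by (simp add: blinfun_pencil_apply[abs_def])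

lemma blinfun_compose_assoc: "(S o\<^sub>L T) o\<^sub>L U = S o\<^sub>L (T o\<^sub>L U)"
  by (rule blinfun_eqI) simp

text \<open>The resolvent identity first bounds \<open>R\<close> near \<open>z0\<close>, and inserting it into itself leaves a remainder
  of second order.\<close>

lemma resolvent_has_derivative:
  fixes R :: "'z::real_normed_vector \<Rightarrow> 'a::real_normed_vector \<Rightarrow>\<^sub>L 'a"
  assumes S: "open S" "z0 \<in> S" and D: "bounded_linear D"
    and resolvent: "\<And>z. z \<in> S \<Longrightarrow> R z = R z0 - (R z o\<^sub>L D (z - z0) o\<^sub>L R z0)"
  shows "(R has_derivative (\<lambda>h. - (R z0 o\<^sub>L D h o\<^sub>L R z0))) (at z0)"
  unfolding has_derivative_at_alt
proof (intro conjI allI impI)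
  show "bounded_linear (\<lambda>h. - (R z0 o\<^sub>L D h o\<^sub>L R z0))"
    by (intro bounded_linear_minus
        bounded_linear_compose[OF bounded_bilinear.bounded_linear_left[OF bounded_bilinear_blinfun_compose]]
        bounded_linear_compose[OF bounded_bilinear.bounded_linear_right[OF bounded_bilinear_blinfun_compose]] D)
  obtain K where K: "K > 0" "\<And>h. norm (D h) \<le> norm h * K"
    using bounded_linear.pos_bounded[OF D] by blast
  define r where "r = norm (R z0) + 1"
  have r: "r > 0" "norm (R z0) \<le> r" by (auto simp: r_def intro: add_nonneg_pos)
  obtain d where d: "d > 0" "ball z0 d \<subseteq> S" using S open_contains_ball by blast
  fix e :: real assume e: "e > 0"
  \<comment> \<open>The second radius makes \<open>\<parallel>D h R z0\<parallel> \<le> 1/2\<close>, hence \<open>\<parallel>R z\<parallel> \<le> 2 r\<close>; the third makes the remainder, which is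
    at most \<open>2 r\<^sup>3 K\<^sup>2 \<parallel>h\<parallel>\<^sup>2\<close>, smaller than \<open>e \<parallel>h\<parallel>\<close>.\<close>
  define d' where "d' = min d (min (1 / (2 * K * r)) (e / (2 * r ^ 3 * K\<^sup>2)))"
  have "norm (R z - R z0 - - (R z0 o\<^sub>L D (z - z0) o\<^sub>L R z0)) \<le> e * norm (z - z0)"
    if z: "norm (z - z0) < d'" for z
  proof -
    define h where "h = z - z0"
    define E where "E = D h o\<^sub>L R z0"
    have h: "norm h \<le> 1 / (2 * K * r)" "norm h \<le> e / (2 * r ^ 3 * K\<^sup>2)"
      using z by (auto simp: d'_def h_def)
    have "z \<in> S" using z d by (auto simp: d'_def dist_norm norm_minus_commute)
    then have Rz: "R z = R z0 - (R z o\<^sub>L E)"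
      using resolvent by (simp add: E_def h_def blinfun_compose_assoc)
    have E: "norm E \<le> norm h * K * r"
      unfolding E_def by (rule order_trans[OF norm_blinfun_compose]) (use K r in \<open>auto intro!: mult_mono\<close>)
    also have "\<dots> \<le> 1 / 2"
      using mult_right_mono[OF h(1), of "K * r"] K r by (simp add: field_simps)
    finally have E2: "norm E \<le> 1 / 2" .
    have "norm (R z) \<le> norm (R z0) + norm (R z o\<^sub>L E)"
      by (subst Rz) (rule norm_triangle_ineq4)
    also have "\<dots> \<le> r + norm (R z) * (1 / 2)"
      by (intro add_mono r order_trans[OF norm_blinfun_compose] mult_left_mono E2) auto
    finally have Rbound: "norm (R z) \<le> 2 * r" by simp
    have "R z - R z0 + (R z0 o\<^sub>L E) = R z o\<^sub>L E o\<^sub>L E"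
    proof (rule blinfun_eqI)
      fix x
      have "R z v = R z0 v - R z (E v)" for v
        using arg_cong[OF Rz, of "\<lambda>T. blinfun_apply T v"] by (simp add: blinfun.diff_left)
      from this[of x] this[of "E x"]
      show "(R z - R z0 + (R z0 o\<^sub>L E)) x = (R z o\<^sub>L E o\<^sub>L E) x"
        by (simp add: blinfun.add_left blinfun.diff_left)
    qed
    then have "norm (R z - R z0 - - (R z0 o\<^sub>L D (z - z0) o\<^sub>L R z0)) = norm (R z o\<^sub>L E o\<^sub>L E)"
      by (simp add: E_def h_def blinfun_compose_assoc)
    also have "\<dots> \<le> norm (R z) * norm E * norm E"
      by (intro order_trans[OF norm_blinfun_compose] mult_right_mono norm_blinfun_compose) auto
    also have "\<dots> \<le> (2 * r) * (norm h * K * r) * (norm h * K * r)"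
      by (intro mult_mono Rbound E) (use r K in auto)
    also have "\<dots> = (2 * r ^ 3 * K\<^sup>2 * norm h) * norm h"
      by (simp add: power2_eq_square power3_eq_cube)
    also have "\<dots> \<le> e * norm h"
      by (intro mult_right_mono) (use h(2) r K in \<open>auto simp: field_simps\<close>)
    finally show ?thesis by (simp add: h_def)
  qed
  moreover have "d' > 0" using d e K r by (auto simp: d'_def)
  ultimately show "\<exists>d>0. \<forall>y. norm (y - z0) < d \<longrightarrow>
      norm (R y - R z0 - - (R z0 o\<^sub>L D (y - z0) o\<^sub>L R z0)) \<le> e * norm (y - z0)"
    by blast
qed

text \<open>The solution \<open>y\<close> of \<open>c(z) u + d(z) y = 0\<close> is packaged as \<open>\<psi> z u = (u, y)\<close>, so that
  \<open>A(z) (\<psi> z u) = (f(z) u, 0)\<close> for the Schur complement \<open>f\<close>.  The operators \<open>B\<^sub>k\<close> extend \<open>A\<^sub>k\<close> to the ambient type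
  by the projection onto \<open>\<H>\<close>; the inverse of \<open>d(z)\<close> is extended in the same way, satisfies the resolvent
  identity there, and makes \<open>\<psi>\<close> complex differentiable in the operator norm.\<close>

lemma pencil_solution_operator:
  fixes A :: "'n::finite \<Rightarrow> 'u::chilbert_space \<times> 'h::chilbert_space \<Rightarrow> 'u \<times> 'h"
  assumes H: "closed_csubspace H" and A: "\<And>k. A k \<in> bounded_ops (UNIV \<times> H)"
    and \<Omega>: "open \<Omega>" and inv: "\<And>z. z \<in> \<Omega> \<Longrightarrow> boundedly_invertible_on H (block22 (pencil A z))"
  shows "\<exists>(\<psi> :: complex ^ 'n \<Rightarrow> 'u \<Rightarrow>\<^sub>L ('u \<times> 'h)) (B :: 'n \<Rightarrow> ('u \<times> 'h) \<Rightarrow>\<^sub>L ('u \<times> 'h)).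
    (\<forall>k. clinear (blinfun_apply (B k)) \<and> (\<forall>p\<in>UNIV \<times> H. B k p = A k p)) \<and>
    (\<forall>z\<in>\<Omega>. clinear (blinfun_apply (\<psi> z)) \<and>
      (\<forall>u. \<psi> z u \<in> {u} \<times> H \<and> snd (pencil A z (\<psi> z u)) = 0) \<and>
      (\<exists>D. clinear D \<and> (\<forall>h. clinear (blinfun_apply (D h))) \<and> (\<psi> has_derivative D) (at z)))"
proof -
  define W where "W = (UNIV :: 'u set) \<times> H"
  have W: "closed_csubspace W"
    unfolding W_def by (intro closed_csubspace_Times closed_csubspace_UNIV H)
  define Q where "Q p = (fst p, proj H (snd p))" for p :: "'u \<times> 'h"
  have Q: "Q p \<in> W" "p \<in> W \<Longrightarrow> Q p = p" "norm (Q p) \<le> norm p"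
    "Q (p + q) = Q p + Q q" "Q (c *\<^sub>C p) = c *\<^sub>C Q p" for p q c
    using proj_in[OF H] norm_proj_le[OF H, of "snd p"]
    by (auto simp: Q_def W_def proj_fixed[OF H] norm_prod_def proj_add[OF H] proj_scaleC[OF H]
        scaleC_prod_def intro!: power_mono)
  define B where "B k = Blinfun (\<lambda>p. A k (Q p))" for k
  have B: "blinfun_apply (B k) = (\<lambda>p. A k (Q p))" for k
  proof -
    note Ak = bounded_opsD[OF A[of k], folded W_def]
    obtain K where K: "K \<ge> 0" "\<And>p. p \<in> W \<Longrightarrow> norm (A k p) \<le> K * norm p" using Ak(4) by blast
    have "bounded_linear (\<lambda>p. A k (Q p))"
    proof (rule bounded_linear_intro[where K = K])
      show "norm (A k (Q p)) \<le> norm p * K" for p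
        using K(2)[OF Q(1), of p] mult_left_mono[OF Q(3) K(1), of p] by (simp add: mult.commute)
    qed (simp_all add: Q Ak scaleR_scaleC)
    then show ?thesis unfolding B_def by (rule bounded_linear_Blinfun_apply)
  qed
  have Bl: "clinear (blinfun_apply (B k))" for k
    using bounded_opsD(2,3)[OF A[of k], folded W_def] by (intro clinearI) (simp_all add: B Q)
  have BA: "B k p = A k p" if "p \<in> W" for k p using that by (simp add: B Q)
  define P where "P = blinfun_pencil B"
  have Pl: "clinear (blinfun_apply (P z))" for z unfolding P_def by (intro clinear_blinfun_pencil Bl)
  have PA: "P z p = pencil A z p" if "p \<in> W" for z p
    using that by (simp add: P_def blinfun_pencil_apply pencil_def BA)
  have Pbl: "bounded_linear P" unfolding P_def by (rule bounded_linear_blinfun_pencil)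
  have Pscale: "P (c *\<^sub>C z) = c *\<^sub>C P z" for c z unfolding P_def by (rule blinfun_pencil_scaleC)
  have T: "pencil A z \<in> bounded_ops W" for z
    unfolding W_def using pencil_in_bounded_ops[OF W, of A] A by (simp add: W_def)
  define d where "d z = block22 (pencil A z)" for z
  have d: "d z \<in> bounded_ops H" for z
    unfolding d_def by (rule block22_bounded_ops[OF H T[unfolded W_def]])
  define inl :: "'u \<Rightarrow>\<^sub>L ('u \<times> 'h)" where "inl = Blinfun (\<lambda>u. (u, 0))"
  define inr :: "'h \<Rightarrow>\<^sub>L ('u \<times> 'h)" where "inr = Blinfun (\<lambda>y. (0, y))"
  define sec :: "('u \<times> 'h) \<Rightarrow>\<^sub>L 'h" where "sec = Blinfun snd"
  have app: "inl u = (u, 0)" "inr y = (0, y)" "sec p = snd p" for u y p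
    unfolding inl_def inr_def sec_def
    by (simp_all add: bounded_linear_Blinfun_apply bounded_linear_Pair bounded_linear_zero
        bounded_linear_ident bounded_linear_snd)
  have dP: "d z y = snd (P z (0, y))" if "y \<in> H" for z y
    using that by (simp add: d_def block22_def PA W_def)
  have dH: "d z y \<in> H" if "y \<in> H" for z y by (rule bounded_opsD(1)[OF d that])
  define R where "R z = Blinfun (\<lambda>x. inv_into H (d z) (proj H x))" for z
  have R: "blinfun_apply (R z) = (\<lambda>x. inv_into H (d z) (proj H x))" "clinear (blinfun_apply (R z))"
    if z: "z \<in> \<Omega>" for z
  proof -
    obtain r where r: "r \<in> bounded_ops H" "\<And>x. x \<in> H \<Longrightarrow> r (d z x) = x \<and> d z (r x) = x"
      using inv[OF z] by (auto simp: d_def boundedly_invertible_on_def)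
    have sub: "d z ` H \<subseteq> H" using dH by auto
    have eq: "inv_into H (d z) (proj H x) = r (proj H x)" for x
      using boundedly_invertible_onD(3)[OF inv[OF z, folded d_def] sub proj_in[OF H], of "r (proj H x)"]
        r bounded_opsD(1)[OF r(1)] proj_in[OF H] by metis
    obtain K where K: "K \<ge> 0" "\<And>x. x \<in> H \<Longrightarrow> norm (r x) \<le> K * norm x"
      using bounded_opsD(4)[OF r(1)] by blast
    have "bounded_linear (\<lambda>x. inv_into H (d z) (proj H x))"
      unfolding eq
    proof (rule bounded_linear_intro[where K = K])
      show "norm (r (proj H x)) \<le> norm x * K" for x
        using K(2)[OF proj_in[OF H], of x] mult_left_mono[OF norm_proj_le[OF H] K(1), of x]
        by (simp add: mult.commute)
    qed (simp_all add: proj_add[OF H] proj_scaleC[OF H] proj_in[OF H] bounded_opsD(2,3)[OF r(1)]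
        scaleR_scaleC)
    then show *: "blinfun_apply (R z) = (\<lambda>x. inv_into H (d z) (proj H x))"
      unfolding R_def by (rule bounded_linear_Blinfun_apply)
    show "clinear (blinfun_apply (R z))"
      by (rule clinearI) (simp_all add: * eq proj_add[OF H] proj_scaleC[OF H] proj_in[OF H]
          bounded_opsD(2,3)[OF r(1)])
  qed
  have Rin: "R z x \<in> H" and dR: "d z (R z x) = proj H x" and Rproj: "R z (proj H x) = R z x"
    and Rd: "y \<in> H \<Longrightarrow> R z (d z y) = y" if z: "z \<in> \<Omega>" for z x y
  proof -
    have sub: "d z ` H \<subseteq> H" using dH by auto
    note i = boundedly_invertible_onD[OF inv[OF z, folded d_def] sub]
    show "R z x \<in> H" "d z (R z x) = proj H x" "R z (proj H x) = R z x"
      using i(1,2)[OF proj_in[OF H]] by (simp_all add: R[OF z] proj_fixed[OF H proj_in[OF H]])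
    show "y \<in> H \<Longrightarrow> R z (d z y) = y"
      using i(3)[OF dH] by (simp add: R[OF z] proj_fixed[OF H] dH closed_csubspaceD(1)[OF H])
  qed
  define Dd where "Dd h = sec o\<^sub>L P h o\<^sub>L inr" for h
  define M where "M h = sec o\<^sub>L P h o\<^sub>L inl" for h
  note comp_left = bounded_linear_compose[OF bounded_bilinear.bounded_linear_left[OF bounded_bilinear_blinfun_compose]]
  note comp_right = bounded_linear_compose[OF bounded_bilinear.bounded_linear_right[OF bounded_bilinear_blinfun_compose]]
  have Ddbl: "bounded_linear Dd" and Mbl: "bounded_linear M"
    unfolding Dd_def M_def by (intro comp_left comp_right Pbl)+
  have resolvent: "R z = R z0 - (R z o\<^sub>L Dd (z - z0) o\<^sub>L R z0)" if z: "z \<in> \<Omega>" and z0: "z0 \<in> \<Omega>" for z z0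
  proof (rule blinfun_eqI)
    fix x
    define y where "y = R z0 x"
    have y: "y \<in> H" unfolding y_def by (rule Rin[OF z0])
    have "Dd (z - z0) y = d z y - d z0 y"
      using y by (simp add: Dd_def app dP bounded_linear.linear[OF Pbl, THEN linear_diff] blinfun.diff_left)
    also have "d z0 y = proj H x" unfolding y_def by (rule dR[OF z0])
    finally have "R z (Dd (z - z0) y) = y - R z x"
      by (simp add: blinfun.diff_right Rd[OF z y] Rproj[OF z])
    then show "R z x = (R z0 - (R z o\<^sub>L Dd (z - z0) o\<^sub>L R z0)) x"
      by (simp add: blinfun.diff_left y_def)
  qed
  define \<psi> where "\<psi> z = inl - (inr o\<^sub>L (R z o\<^sub>L M z))" for z
  have \<psi>: "\<psi> z u = (u, - R z (M z u))" for z u by (simp add: \<psi>_def blinfun.diff_left app)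
  have Mapp: "M z u = snd (P z (u, 0))" for z u by (simp add: M_def app)
  have Ml: "clinear (blinfun_apply (M z))" for z
    using clinear_simps(1)[OF Pl[of z], of "(_, 0)" "(_, 0)"] clinear_simps(2)[OF Pl[of z], of _ "(_, 0)"]
    by (intro clinearI) (simp_all add: Mapp scaleC_prod_def)
  have Ddl: "clinear (blinfun_apply (Dd z))" for z
    using clinear_simps(1)[OF Pl[of z], of "(0, _)" "(0, _)"] clinear_simps(2)[OF Pl[of z], of _ "(0, _)"]
    by (intro clinearI) (simp_all add: Dd_def app scaleC_prod_def)
  have main: "clinear (blinfun_apply (\<psi> z)) \<and>
      (\<forall>u. \<psi> z u \<in> {u} \<times> H \<and> snd (pencil A z (\<psi> z u)) = 0) \<and>
      (\<exists>D. clinear D \<and> (\<forall>h. clinear (blinfun_apply (D h))) \<and> (\<psi> has_derivative D) (at z))"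
    if z: "z \<in> \<Omega>" for z
  proof (intro conjI allI)
    note Rl = R(2)[OF z]
    show "clinear (blinfun_apply (\<psi> z))"
      by (rule clinearI) (simp_all add: \<psi> scaleC_prod_def clinear_simps[OF Ml] clinear_simps[OF Rl]
          scaleC_minus_right)
    fix u
    have y: "- R z (M z u) \<in> H" by (intro closed_csubspaceD(5)[OF H] Rin[OF z])
    then show "\<psi> z u \<in> {u} \<times> H" by (simp add: \<psi>)
    have MH: "M z u \<in> H"
      using block21_in[OF H T[unfolded W_def]] by (simp add: Mapp PA W_def closed_csubspaceD(1)[OF H] block21_def)
    have "P z (\<psi> z u) = P z (u, 0) - P z (0, R z (M z u))"
      by (simp add: \<psi> blinfun.diff_right[symmetric])
    then have "snd (P z (\<psi> z u)) = M z u - d z (R z (M z u))"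
      by (simp add: Mapp dP[OF Rin[OF z]])
    also have "\<dots> = 0" by (simp add: dR[OF z] proj_fixed[OF H MH])
    finally show "snd (pencil A z (\<psi> z u)) = 0"
      using PA[of "\<psi> z u" z] y by (simp add: W_def \<psi>)
    define DN where "DN h = (R z o\<^sub>L M h) + ((- (R z o\<^sub>L Dd h o\<^sub>L R z)) o\<^sub>L M z)" for h
    define D where "D h = - (inr o\<^sub>L DN h)" for h
    have "((\<lambda>z. R z o\<^sub>L M z) has_derivative DN) (at z)"
      unfolding DN_def
      by (rule bounded_bilinear.FDERIV[OF bounded_bilinear_blinfun_compose
            resolvent_has_derivative[OF \<Omega> z Ddbl resolvent[OF _ z]] bounded_linear_imp_has_derivative[OF Mbl]])
    then have "((\<lambda>z. inr o\<^sub>L (R z o\<^sub>L M z)) has_derivative (\<lambda>h. inr o\<^sub>L DN h)) (at z)"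
      by (rule bounded_linear.has_derivative[OF
            bounded_bilinear.bounded_linear_right[OF bounded_bilinear_blinfun_compose]])
    then have "(\<psi> has_derivative D) (at z)"
      unfolding \<psi>_def D_def using has_derivative_diff[OF has_derivative_const] by fastforce
    moreover have Dapp: "D h u = (0, - (R z (M h u) - R z (Dd h (R z (M z u)))))" for h u
      by (simp add: D_def DN_def app blinfun.minus_left blinfun.add_left)
    have "clinear (blinfun_apply (D h))" for h
      by (rule clinearI) (simp_all add: Dapp scaleC_prod_def clinear_simps[OF Ml] clinear_simps[OF Rl]
          clinear_simps[OF Ddl] scaleC_minus_right scaleC_diff_right)
    moreover have "clinear D"
    proof (rule clinearI)
      have M2: "M (h + k) = M h + M k" "Dd (h + k) = Dd h + Dd k" for h k
        using bounded_linear.linear[OF Mbl] bounded_linear.linear[OF Ddbl] by (simp_all add: linear_add)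
      have M3: "M (c *\<^sub>C h) = c *\<^sub>C M h" "Dd (c *\<^sub>C h) = c *\<^sub>C Dd h" for c h
        by (rule blinfun_eqI, simp add: M_def Dd_def app Pscale scaleC_prod_def)+
      show "D (h + k) = D h + D k" for h k
        by (rule blinfun_eqI) (simp add: Dapp blinfun.add_left M2 blinfun.add_right)
      show "D (c *\<^sub>C h) = c *\<^sub>C D h" for c h
        by (rule blinfun_eqI) (simp add: Dapp M3 scaleC_prod_def clinear_simps[OF Rl]
          scaleC_minus_right scaleC_diff_right)
    qed
    ultimately show "\<exists>D. clinear D \<and> (\<forall>h. clinear (blinfun_apply (D h))) \<and> (\<psi> has_derivative D) (at z)"
      by blast
  qed
  show ?thesis
    by (rule exI[of _ \<psi>], rule exI[of _ B]) (use main Bl BA in \<open>auto simp: W_def\<close>)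
qed

section \<open>Kernel identities for functions on the poly-half-plane\<close>

lemma psd_kernel_on_hermitian:
  "psd_kernel_on J K \<Longrightarrow> i \<in> J \<Longrightarrow> j \<in> J \<Longrightarrow> K j i = cnj (K i j)"
  unfolding psd_kernel_on_def by blast

lemma psd_kernel_on_nonneg:
  "psd_kernel_on J K \<Longrightarrow> finite F \<Longrightarrow> F \<subseteq> J \<Longrightarrow> 0 \<le> Re (\<Sum>i\<in>F. \<Sum>j\<in>F. c i * cnj (c j) * K i j)"
  unfolding psd_kernel_on_def by blast

lemma psd_kernel_on_pullback:
  fixes J :: "'j set"
  assumes K: "psd_kernel_on J' K" and s: "inj_on s J" "s ` J \<subseteq> J'"
  shows "psd_kernel_on J (\<lambda>i j. K (s i) (s j))"
  unfolding psd_kernel_on_def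
proof (intro conjI ballI allI impI)
  show "K (s j) (s i) = cnj (K (s i) (s j))" if "i \<in> J" "j \<in> J" for i j
  proof -
    have "s i \<in> J'" "s j \<in> J'" using that s by auto
    then show ?thesis by (rule psd_kernel_on_hermitian[OF K])
  qed
  fix F :: "'j set" and c :: "'j \<Rightarrow> complex" assume F: "finite F" "F \<subseteq> J"
  have inj: "inj_on s F" using s(1) F(2) inj_on_subset by blast
  have "0 \<le> Re (\<Sum>i\<in>s ` F. \<Sum>j\<in>s ` F. c (inv_into F s i) * cnj (c (inv_into F s j)) * K i j)"
    by (rule psd_kernel_on_nonneg[OF K]) (use F s(2) in auto)
  then show "0 \<le> Re (\<Sum>i\<in>F. \<Sum>j\<in>F. c i * cnj (c j) * K (s i) (s j))"
    by (simp add: sum.reindex[OF inj] inj cong: sum.cong)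
qed

lemma psd_kernel_on_zero_extension:
  fixes J :: "'j set"
  assumes K: "psd_kernel_on J K"
  shows "psd_kernel_on UNIV (\<lambda>i j. if i \<in> J \<and> j \<in> J then K i j else 0)"
  unfolding psd_kernel_on_def
proof (intro conjI ballI allI impI)
  show "(if j \<in> J \<and> i \<in> J then K j i else 0) = cnj (if i \<in> J \<and> j \<in> J then K i j else 0)" for i j
  proof (cases "i \<in> J \<and> j \<in> J")
    case True
    then have "K j i = cnj (K i j)" using psd_kernel_on_hermitian[OF K] by blast
    with True show ?thesis by (simp only: simp_thms if_True)
  qed auto
  fix F :: "'j set" and c :: "'j \<Rightarrow> complex" assume F: "finite F"
  let ?K = "\<lambda>i j. if i \<in> J \<and> j \<in> J then K i j else 0"
  have "(\<Sum>i\<in>F. \<Sum>j\<in>F. c i * cnj (c j) * ?K i j) = (\<Sum>i\<in>F \<inter> J. \<Sum>j\<in>F. c i * cnj (c j) * ?K i j)"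
    by (rule sum.mono_neutral_right) (use F in auto)
  also have "\<dots> = (\<Sum>i\<in>F \<inter> J. \<Sum>j\<in>F \<inter> J. c i * cnj (c j) * K i j)"
    by (intro sum.cong[OF refl] sum.mono_neutral_cong_right) (use F in auto)
  finally show "0 \<le> Re (\<Sum>i\<in>F. \<Sum>j\<in>F. c i * cnj (c j) * ?K i j)"
    using psd_kernel_on_nonneg[OF K, of "F \<inter> J" c] F by simp
qed

lemma psd_kernel_on_sum:
  fixes J :: "'j set"
  assumes K: "\<And>k. k \<in> A \<Longrightarrow> psd_kernel_on J (K k)"
  shows "psd_kernel_on J (\<lambda>i j. \<Sum>k\<in>A. K k i j)"
  unfolding psd_kernel_on_def
proof (intro conjI ballI allI impI)
  show "(\<Sum>k\<in>A. K k j i) = cnj (\<Sum>k\<in>A. K k i j)" if "i \<in> J" "j \<in> J" for i j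
    unfolding cnj_sum by (intro sum.cong[OF refl] psd_kernel_on_hermitian[OF K] that)
  fix F :: "'j set" and c :: "'j \<Rightarrow> complex" assume F: "finite F" "F \<subseteq> J"
  have "(\<Sum>i\<in>F. \<Sum>j\<in>F. c i * cnj (c j) * (\<Sum>k\<in>A. K k i j))
      = (\<Sum>i\<in>F. \<Sum>k\<in>A. \<Sum>j\<in>F. c i * cnj (c j) * K k i j)"
    unfolding sum_distrib_left by (intro sum.cong[OF refl] sum.swap)
  also have "\<dots> = (\<Sum>k\<in>A. \<Sum>i\<in>F. \<Sum>j\<in>F. c i * cnj (c j) * K k i j)" by (rule sum.swap)
  finally have eq: "(\<Sum>i\<in>F. \<Sum>j\<in>F. c i * cnj (c j) * (\<Sum>k\<in>A. K k i j))
      = (\<Sum>k\<in>A. \<Sum>i\<in>F. \<Sum>j\<in>F. c i * cnj (c j) * K k i j)" .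
  show "0 \<le> Re (\<Sum>i\<in>F. \<Sum>j\<in>F. c i * cnj (c j) * (\<Sum>k\<in>A. K k i j))"
    by (subst eq, subst Re_sum) (intro sum_nonneg psd_kernel_on_nonneg[OF K F])
qed

lemma psd_kernel_on_average_cnj:
  fixes J :: "'j set"
  assumes K: "psd_kernel_on J K" and L: "psd_kernel_on J L"
  shows "psd_kernel_on J (\<lambda>i j. (K i j + cnj (L i j)) / 2)"
  unfolding psd_kernel_on_def
proof (intro conjI ballI allI impI)
  show "(K j i + cnj (L j i)) / 2 = cnj ((K i j + cnj (L i j)) / 2)" if "i \<in> J" "j \<in> J" for i j
  proof -
    have "K j i = cnj (K i j)" "L j i = cnj (L i j)"
      using psd_kernel_on_hermitian[OF K that] psd_kernel_on_hermitian[OF L that] by simp_all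
    then show ?thesis by (simp only: complex_cnj_add complex_cnj_cnj complex_cnj_divide complex_cnj_numeral)
  qed
  fix F :: "'j set" and c :: "'j \<Rightarrow> complex" assume F: "finite F" "F \<subseteq> J"
  have "0 \<le> Re (\<Sum>i\<in>F. \<Sum>j\<in>F. cnj (c i) * cnj (cnj (c j)) * L i j)"
    by (rule psd_kernel_on_nonneg[OF L F])
  also have "\<dots> = Re (cnj (\<Sum>i\<in>F. \<Sum>j\<in>F. cnj (c i) * cnj (cnj (c j)) * L i j))" by (rule cnj.simps(1)[symmetric])
  also have "cnj (\<Sum>i\<in>F. \<Sum>j\<in>F. cnj (c i) * cnj (cnj (c j)) * L i j)
      = (\<Sum>i\<in>F. \<Sum>j\<in>F. c i * cnj (c j) * cnj (L i j))" by simp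
  finally have "0 \<le> Re (\<Sum>i\<in>F. \<Sum>j\<in>F. c i * cnj (c j) * cnj (L i j))" .
  moreover have "0 \<le> Re (\<Sum>i\<in>F. \<Sum>j\<in>F. c i * cnj (c j) * K i j)"
    by (rule psd_kernel_on_nonneg[OF K F])
  moreover have "0 \<le> Re ((x + y) / 2)" if "0 \<le> Re y" "0 \<le> Re x" for x y using that by simp
  moreover have eq: "(\<Sum>i\<in>F. \<Sum>j\<in>F. c i * cnj (c j) * ((K i j + cnj (L i j)) / 2))
      = ((\<Sum>i\<in>F. \<Sum>j\<in>F. c i * cnj (c j) * K i j) + (\<Sum>i\<in>F. \<Sum>j\<in>F. c i * cnj (c j) * cnj (L i j))) / 2"
    by (simp add: distrib_left add_divide_distrib sum.distrib sum_divide_distrib)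
  ultimately show "0 \<le> Re (\<Sum>i\<in>F. \<Sum>j\<in>F. c i * cnj (c j) * ((K i j + cnj (L i j)) / 2))"
    unfolding eq by blast
qed

lemma bounded_ops_linear_combination:
  assumes S: "closed_csubspace S" and T: "T \<in> bounded_ops S" and x: "\<And>i. i \<in> F \<Longrightarrow> x i \<in> S"
  shows "T (\<Sum>i\<in>F. c i *\<^sub>C x i) = (\<Sum>i\<in>F. c i *\<^sub>C T (x i))"
  using x
proof (induction F rule: infinite_finite_induct)
  case (insert i F)
  then show ?case
    by (simp add: bounded_opsD(2,3)[OF T] closed_csubspaceD(3)[OF S] closed_csubspace_sum[OF S])
qed (use bounded_opsD(3)[OF T closed_csubspaceD(1)[OF S], of 0] in simp_all)

text \<open>The kernels that come from a pencil are values of one positive form on a family of vectors.\<close>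

lemma psd_kernel_on_operator:
  fixes J :: "'j set"
  assumes S: "closed_csubspace S" and T: "T \<in> bounded_ops S" "selfadjoint_on S T" "psd_on S T"
    and x: "\<And>i. i \<in> J \<Longrightarrow> x i \<in> S"
  shows "psd_kernel_on J (\<lambda>i j. cinner (T (x i)) (x j))"
  unfolding psd_kernel_on_def
proof (intro conjI ballI allI impI)
  show "cinner (T (x j)) (x i) = cnj (cinner (T (x i)) (x j))" if "i \<in> J" "j \<in> J" for i j
    using T(2) x that cinner_commute[of "x j" "T (x i)"] by (simp add: selfadjoint_on_def)
  fix F :: "'j set" and c :: "'j \<Rightarrow> complex" assume F: "finite F" "F \<subseteq> J"
  then have xF: "\<And>i. i \<in> F \<Longrightarrow> x i \<in> S" using x by auto
  define y where "y = (\<Sum>i\<in>F. c i *\<^sub>C x i)"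
  have "y \<in> S" unfolding y_def
    using xF by (intro closed_csubspace_sum[OF S] closed_csubspaceD(3)[OF S])
  have "(\<Sum>i\<in>F. \<Sum>j\<in>F. c i * cnj (c j) * cinner (T (x i)) (x j)) = cinner (T y) y"
  proof -
    have Ty: "T y = (\<Sum>i\<in>F. c i *\<^sub>C T (x i))"
      unfolding y_def by (rule bounded_ops_linear_combination[OF S T(1) xF])
    show ?thesis unfolding Ty unfolding y_def by (rule cinner_linear_combinations[symmetric])
  qed
  then show "0 \<le> Re (\<Sum>i\<in>F. \<Sum>j\<in>F. c i * cnj (c j) * cinner (T (x i)) (x j))"
    using T(3) \<open>y \<in> S\<close> by (simp add: psd_on_def complex_nonneg_Reals_iff)
qed

text \<open>The hub of the proof: for holomorphic \<open>f\<close>, the existence of a solution \<open>G\<close> of this scalar kernel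
  problem is equivalent to each of the four conditions.  The pair \<open>(z, u)\<close> is a single index, so that the
  conjugation \<open>(z, u) \<mapsto> (cnj z, \<iota> u)\<close> is a symmetry of the index set.\<close>

definition gram_solution :: "(complex ^ 'n \<Rightarrow> 'u::chilbert_space \<Rightarrow>\<^sub>L 'u) \<Rightarrow> ('u \<Rightarrow> 'u) \<Rightarrow>
    ('n \<Rightarrow> (complex ^ 'n) \<times> 'u \<Rightarrow> (complex ^ 'n) \<times> 'u \<Rightarrow> complex) \<Rightarrow> bool" where
  "gram_solution f \<iota> G \<longleftrightarrow> (\<forall>k. psd_kernel_on (poly_halfplane \<times> UNIV) (G k)) \<and>
     (\<forall>z\<in>poly_halfplane. \<forall>\<zeta>\<in>poly_halfplane. \<forall>u v.
        (\<Sum>k\<in>UNIV. z $ k * G k (z, u) (\<zeta>, v)) = cinner (f z u) v \<and>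
        (\<forall>k. G k (vcnj z, \<iota> u) (vcnj \<zeta>, \<iota> v) = cnj (G k (z, u) (\<zeta>, v))))"

text \<open>If \<open>f\<close> is real, the conjugated kernels decompose \<open>f\<close> as well, and the average of both
  decompositions is real.\<close>

lemma gram_solution_symmetrize:
  fixes f :: "complex ^ 'n \<Rightarrow> 'u::chilbert_space \<Rightarrow>\<^sub>L 'u"
  assumes \<iota>: "AUI_on UNIV \<iota>" and f: "\<And>z u. z \<in> poly_halfplane \<Longrightarrow> \<iota> (f (vcnj z) (\<iota> u)) = f z u"
    and psd: "\<And>k. psd_kernel_on (poly_halfplane \<times> UNIV) (G k)"
    and eq: "\<And>z \<zeta> u v. z \<in> poly_halfplane \<Longrightarrow> \<zeta> \<in> poly_halfplane \<Longrightarrow>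
      (\<Sum>k\<in>UNIV. z $ k * G k (z, u) (\<zeta>, v)) = cinner (f z u) v"
  shows "\<exists>G. gram_solution f \<iota> G"
proof -
  have \<iota>2: "\<iota> (\<iota> u) = u" for u using AUI_onD(2)[OF \<iota>] by simp
  define s where "s = map_prod (vcnj :: complex ^ 'n \<Rightarrow> _) \<iota>"
  have s: "inj_on s (poly_halfplane \<times> UNIV)" "s ` (poly_halfplane \<times> UNIV) \<subseteq> poly_halfplane \<times> UNIV"
    by (auto simp: s_def intro!: inj_on_inverseI[of _ s] \<iota>2)
  define G' where "G' k p q = (G k p q + cnj (G k (s p) (s q))) / 2" for k p q
  have "gram_solution f \<iota> G'"
    unfolding gram_solution_def
  proof (intro conjI allI ballI)
    show "psd_kernel_on (poly_halfplane \<times> UNIV) (G' k)" for k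
      unfolding G'_def by (intro psd_kernel_on_average_cnj psd psd_kernel_on_pullback[OF psd s])
    fix z \<zeta> :: "complex ^ 'n" and u v
    assume z: "z \<in> poly_halfplane" and \<zeta>: "\<zeta> \<in> poly_halfplane"
    show "G' k (vcnj z, \<iota> u) (vcnj \<zeta>, \<iota> v) = cnj (G' k (z, u) (\<zeta>, v))" for k
      by (simp add: G'_def s_def \<iota>2 add.commute)
    have "(\<Sum>k\<in>UNIV. z $ k * cnj (G k (s (z, u)) (s (\<zeta>, v))))
        = cnj (\<Sum>k\<in>UNIV. vcnj z $ k * G k (vcnj z, \<iota> u) (vcnj \<zeta>, \<iota> v))"
      by (simp add: s_def)
    also have "\<dots> = cnj (cinner (f (vcnj z) (\<iota> u)) (\<iota> v))"
      using eq[of "vcnj z" "vcnj \<zeta>"] z \<zeta> by simp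
    also have "\<dots> = cnj (cinner v (\<iota> (f (vcnj z) (\<iota> u))))"
      by (simp add: AUI_swap[OF \<iota>, of v "f (vcnj z) (\<iota> u)"])
    also have "\<dots> = cinner (f z u) v" by (simp add: f[OF z] cinner_commute[of "f z u"])
    finally show "(\<Sum>k\<in>UNIV. z $ k * G' k (z, u) (\<zeta>, v)) = cinner (f z u) v"
      using eq[OF z \<zeta>, of u v]
      by (simp add: G'_def distrib_left add_divide_distrib sum.distrib sum_divide_distrib[symmetric])
  qed
  then show ?thesis by blast
qed

lemma bessmertnyi_representationD:
  assumes "bessmertnyi_representation f H A"
  shows "A k \<in> bounded_ops (UNIV \<times> H)" "selfadjoint_on (UNIV \<times> H) (A k)" "psd_on (UNIV \<times> H) (A k)"
    "z \<in> rotated_halfplanes \<Longrightarrow> boundedly_invertible_on H (block22 (pencil A z))"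
  using assms by (auto simp: bessmertnyi_representation_def)

lemma bessmertnyi_solution_operator:
  fixes f :: "complex ^ 'n \<Rightarrow> 'u::chilbert_space \<Rightarrow>\<^sub>L 'u" and H :: "'h::chilbert_space set"
  assumes H: "closed_csubspace H" and rep: "bessmertnyi_representation f H A"
  shows "\<exists>(\<psi> :: complex ^ 'n \<Rightarrow> 'u \<Rightarrow>\<^sub>L ('u \<times> 'h)) (B :: 'n \<Rightarrow> ('u \<times> 'h) \<Rightarrow>\<^sub>L ('u \<times> 'h)).
    (\<forall>k. clinear (blinfun_apply (B k)) \<and> (\<forall>p\<in>UNIV \<times> H. B k p = A k p)) \<and>
    (\<forall>z\<in>rotated_halfplanes. clinear (blinfun_apply (\<psi> z)) \<and>
      (\<forall>u. \<psi> z u \<in> {u} \<times> H \<and> pencil A z (\<psi> z u) = (f z u, 0)) \<and>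
      (\<exists>D. clinear D \<and> (\<forall>h. clinear (blinfun_apply (D h))) \<and> (\<psi> has_derivative D) (at z)))"
proof -
  obtain \<psi> :: "complex ^ 'n \<Rightarrow> 'u \<Rightarrow>\<^sub>L ('u \<times> 'h)" and B :: "'n \<Rightarrow> ('u \<times> 'h) \<Rightarrow>\<^sub>L ('u \<times> 'h)" where
    B: "\<forall>k. clinear (blinfun_apply (B k)) \<and> (\<forall>p\<in>UNIV \<times> H. B k p = A k p)" and
    \<psi>: "\<forall>z\<in>rotated_halfplanes. clinear (blinfun_apply (\<psi> z)) \<and>
      (\<forall>u. \<psi> z u \<in> {u} \<times> H \<and> snd (pencil A z (\<psi> z u)) = 0) \<and>
      (\<exists>D. clinear D \<and> (\<forall>h. clinear (blinfun_apply (D h))) \<and> (\<psi> has_derivative D) (at z))"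
    using pencil_solution_operator[OF H bessmertnyi_representationD(1)[OF rep]
        open_rotated_halfplanes bessmertnyi_representationD(4)[OF rep]] by metis
  have "pencil A z (\<psi> z u) = (f z u, 0)" if z: "z \<in> rotated_halfplanes" for z u
  proof -
    have p: "\<psi> z u \<in> {u} \<times> H" "snd (pencil A z (\<psi> z u)) = 0" using \<psi> z by auto
    then have "\<psi> z u = (u, snd (\<psi> z u))" by (auto simp: prod_eq_iff)
    then have "pencil A z (u, snd (\<psi> z u)) = (fst (pencil A z (\<psi> z u)), 0)"
      by (metis p(2) prod.collapse)
    then have "f z u = fst (pencil A z (\<psi> z u))"
      using bessmertnyi_schur[OF H rep z, of u "fst (pencil A z (\<psi> z u))"] p by auto
    then show ?thesis using p by (simp add: prod_eq_iff)
  qed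
  then show ?thesis using B \<psi> by (intro exI[of _ \<psi>] exI[of _ B]) auto
qed

lemma bessmertnyi_imp_gram_solution:
  fixes f :: "complex ^ 'n \<Rightarrow> 'u::chilbert_space \<Rightarrow>\<^sub>L 'u"
  assumes \<iota>: "AUI_on UNIV \<iota>" and f: "f \<in> real_bessmertnyi_class TYPE('h::chilbert_space) \<iota>"
  shows "\<exists>G. gram_solution f \<iota> G"
proof -
  obtain H :: "'h set" and A where H: "closed_csubspace H" and rep: "bessmertnyi_representation f H A"
    and real: "iota_real_fun_on rotated_halfplanes UNIV \<iota> (\<lambda>z. blinfun_apply (f z))"
    using f by (auto simp: real_bessmertnyi_class_def bessmertnyi_class_def)
  obtain \<psi> where \<psi>: "\<And>z u. z \<in> rotated_halfplanes \<Longrightarrow> blinfun_apply (\<psi> z) u \<in> {u} \<times> H"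
    "\<And>z u. z \<in> rotated_halfplanes \<Longrightarrow> pencil A z (blinfun_apply (\<psi> z) u) = (f z u, 0)"
    using bessmertnyi_solution_operator[OF H rep] by metis
  note sub = subsetD[OF poly_halfplane_subset_rotated]
  note S = closed_csubspace_Times[OF closed_csubspace_UNIV H]
  show ?thesis
  proof (rule gram_solution_symmetrize[OF \<iota>])
    show "\<iota> (f (vcnj z) (\<iota> u)) = f z u" if "z \<in> poly_halfplane" for z u
      using real sub[OF that] by (auto simp: iota_real_fun_on_def sharp_def)
    show "psd_kernel_on (poly_halfplane \<times> UNIV)
        (\<lambda>p q. cinner (A k (case p of (z, u) \<Rightarrow> \<psi> z u)) (case q of (z, u) \<Rightarrow> \<psi> z u))" for k
    proof (rule psd_kernel_on_operator[OF S bessmertnyi_representationD(1-3)[OF rep]])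
      fix p :: "(complex ^ 'n) \<times> 'u" assume "p \<in> poly_halfplane \<times> UNIV"
      then show "(case p of (z, u) \<Rightarrow> \<psi> z u) \<in> UNIV \<times> H"
        using \<psi>(1)[OF sub, of "fst p" "snd p"] by (auto simp: case_prod_unfold)
    qed
    fix z \<zeta> :: "complex ^ 'n" and u v assume z: "z \<in> poly_halfplane" and \<zeta>: "\<zeta> \<in> poly_halfplane"
    have "(\<Sum>k\<in>UNIV. z $ k * cinner (A k (\<psi> z u)) (\<psi> \<zeta> v)) = cinner (pencil A z (\<psi> z u)) (\<psi> \<zeta> v)"
      by (simp add: pencil_def cinner_sum_left cinner_scaleC_left)
    also have "\<dots> = cinner (f z u) v"
      using \<psi>(1)[OF sub[OF \<zeta>], of v] by (auto simp: \<psi>(2)[OF sub[OF z]] cinner_prod_def)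
    finally show "(\<Sum>k\<in>UNIV. z $ k * cinner (A k (case (z, u) of (z, u) \<Rightarrow> \<psi> z u))
        (case (\<zeta>, v) of (z, u) \<Rightarrow> \<psi> z u)) = cinner (f z u) v"
      by simp
  qed
qed

text \<open>The models below control \<open>f\<close> only on \<open>\<Pi>\<^sup>N\<close>.  The Schur complement is holomorphic wherever \<open>d(z)\<close> is
  invertible, so the identity theorem transports the representation to all of \<open>\<Omega>\<^sub>N\<close>.\<close>

lemma bessmertnyi_representation_extend:
  fixes f :: "complex ^ 'n \<Rightarrow> 'u::chilbert_space \<Rightarrow>\<^sub>L 'u" and H :: "'h::chilbert_space set"
  assumes H: "closed_csubspace H" and holo: "holomorphic_op_on f rotated_halfplanes"
    and A: "\<And>k. A k \<in> bounded_ops (UNIV \<times> H)" "\<And>k. selfadjoint_on (UNIV \<times> H) (A k)"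
      "\<And>k. psd_on (UNIV \<times> H) (A k)"
    and inv: "\<And>z. z \<in> rotated_halfplanes \<Longrightarrow> boundedly_invertible_on H (block22 (pencil A z))"
    and sol: "\<And>z u. z \<in> poly_halfplane \<Longrightarrow> \<exists>y\<in>H. pencil A z (u, y) = (f z u, 0)"
  shows "bessmertnyi_representation f H A"
proof -
  obtain \<psi> :: "complex ^ 'n \<Rightarrow> 'u \<Rightarrow>\<^sub>L ('u \<times> 'h)" and B :: "'n \<Rightarrow> ('u \<times> 'h) \<Rightarrow>\<^sub>L ('u \<times> 'h)" where
    B: "\<forall>k. clinear (blinfun_apply (B k)) \<and> (\<forall>p\<in>UNIV \<times> H. B k p = A k p)" and
    \<psi>: "\<forall>z\<in>rotated_halfplanes. clinear (blinfun_apply (\<psi> z)) \<and>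
      (\<forall>u. \<psi> z u \<in> {u} \<times> H \<and> snd (pencil A z (\<psi> z u)) = 0) \<and>
      (\<exists>D. clinear D \<and> (\<forall>h. clinear (blinfun_apply (D h))) \<and> (\<psi> has_derivative D) (at z))"
    using pencil_solution_operator[OF H A(1) open_rotated_halfplanes inv] by metis
  have T: "pencil A z \<in> bounded_ops (UNIV \<times> H)" for z
    by (intro pencil_in_bounded_ops closed_csubspace_Times closed_csubspace_UNIV H A)
  define g where "g z u = fst (blinfun_pencil B z (\<psi> z u))" for z u
  have BA: "blinfun_pencil B z p = pencil A z p" if "p \<in> UNIV \<times> H" for z p
  proof -
    have "B k p = A k p" for k using B that by blast
    then show ?thesis by (simp add: blinfun_pencil_apply pencil_def)
  qed
  have \<psi>g: "\<exists>y\<in>H. pencil A z (u, y) = (g z u, 0)" if z: "z \<in> rotated_halfplanes" for z u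
  proof -
    have p: "\<psi> z u \<in> {u} \<times> H" "snd (pencil A z (\<psi> z u)) = 0" using \<psi> z by auto
    then have "\<psi> z u = (u, snd (\<psi> z u))" by (auto simp: prod_eq_iff)
    moreover have "blinfun_pencil B z (\<psi> z u) = pencil A z (\<psi> z u)"
      by (rule BA) (use p in auto)
    ultimately have "pencil A z (u, snd (\<psi> z u)) = (g z u, 0)"
      unfolding g_def by (metis p(2) prod.collapse)
    then show ?thesis using p by auto
  qed
  have schur: "block11 (pencil A z) u - block12 (pencil A z)
      (inv_into H (block22 (pencil A z)) (block21 (pencil A z) u)) = g z u"
    if z: "z \<in> rotated_halfplanes" for z u
    using schur_complement_iff[OF H T inv[OF z], of u "g z u"] \<psi>g[OF z] by simp
  have "f z u - g z u = 0" if z: "z \<in> rotated_halfplanes" for z u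
  proof (rule rotated_identity_theorem[OF _ _ z])
    show "f z u - g z u = 0" if z: "z \<in> poly_halfplane" for z
    proof -
      have z': "z \<in> rotated_halfplanes" using z poly_halfplane_subset_rotated by auto
      show ?thesis
        using schur_complement_iff[OF H T inv[OF z'], of u "f z u"] sol[OF z, of u] schur[OF z', of u]
        by simp
    qed
    fix z :: "complex ^ 'n" assume z: "z \<in> rotated_halfplanes"
    obtain D1 where D1: "clinear D1" "(f has_derivative D1) (at z)"
      using holo z by (auto simp: holomorphic_op_on_def)
    obtain D2 where D2: "clinear D2" "(\<psi> has_derivative D2) (at z)" using \<psi> z by blast
    have Bl: "clinear (blinfun_apply (blinfun_pencil B z))" for z
      by (rule clinear_blinfun_pencil) (use B in auto)
    have "((\<lambda>z. blinfun_pencil B z o\<^sub>L \<psi> z) has_derivative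
        (\<lambda>h. (blinfun_pencil B z o\<^sub>L D2 h) + (blinfun_pencil B h o\<^sub>L \<psi> z))) (at z)"
      by (rule bounded_bilinear.FDERIV[OF bounded_bilinear_blinfun_compose
            bounded_linear_imp_has_derivative[OF bounded_linear_blinfun_pencil] D2(2)])
    then have "((\<lambda>z. fst ((blinfun_pencil B z o\<^sub>L \<psi> z) u)) has_derivative
        (\<lambda>h. fst (((blinfun_pencil B z o\<^sub>L D2 h) + (blinfun_pencil B h o\<^sub>L \<psi> z)) u))) (at z)"
      by (intro bounded_linear.has_derivative[OF bounded_linear_fst]
          bounded_linear.has_derivative[OF blinfun.bounded_linear_left])
    from has_derivative_diff[OF bounded_linear.has_derivative[OF blinfun.bounded_linear_left D1(2)] this]
    have "((\<lambda>z. f z u - g z u) has_derivative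
        (\<lambda>h. D1 h u - fst (blinfun_pencil B z (D2 h u) + blinfun_pencil B h (\<psi> z u)))) (at z)"
      by (simp add: g_def blinfun.add_left)
    moreover have "clinear (\<lambda>h. D1 h u - fst (blinfun_pencil B z (D2 h u) + blinfun_pencil B h (\<psi> z u)))"
      using bounded_linear.linear[OF bounded_linear_blinfun_pencil, of B]
      by (intro clinearI) (simp_all add: clinear_simps[OF D1(1)] clinear_simps[OF D2(1)]
          clinear_simps[OF Bl] blinfun_pencil_scaleC linear_add blinfun.add_left
          scaleC_diff_right scaleC_add_right)
    ultimately show "\<exists>D. clinear D \<and> ((\<lambda>z. f z u - g z u) has_derivative D) (at z)" by blast
  qed
  then show ?thesis
    unfolding bessmertnyi_representation_def using A inv schur by simp
qed

text \<open>The kernels for different \<open>k\<close> are represented by one Gram family, over the disjoint union of their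
  index sets; this makes the resulting vectors orthogonal for different \<open>k\<close>.\<close>

lemma gram_solution_vectors:
  fixes f :: "complex ^ 'n \<Rightarrow> 'u::chilbert_space \<Rightarrow>\<^sub>L 'u"
    and e :: "'n \<times> (complex ^ 'n) \<times> 'u \<Rightarrow> 'w::chilbert_space"
  assumes e: "\<And>i j. cinner (e i) (e j) = (if i = j then 1 else 0)" and G: "gram_solution f \<iota> G"
  shows "\<exists>\<eta> :: 'n \<Rightarrow> complex ^ 'n \<Rightarrow> 'u \<Rightarrow> 'w. \<forall>z\<in>poly_halfplane. \<forall>\<zeta>\<in>poly_halfplane. \<forall>k l u v.
    cinner (\<eta> k z u) (\<eta> l \<zeta> v) = (if k = l then G k (z, u) (\<zeta>, v) else 0)"
proof -
  define J where "J k = {i :: 'n \<times> (complex ^ 'n) \<times> 'u. fst i = k \<and> fst (snd i) \<in> poly_halfplane}" for k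
  define K where "K i j = (\<Sum>k\<in>UNIV. if i \<in> J k \<and> j \<in> J k then G k (snd i) (snd j) else 0)" for i j
  have "psd_kernel_on UNIV K"
    unfolding K_def
  proof (intro psd_kernel_on_sum psd_kernel_on_zero_extension)
    fix k
    have "psd_kernel_on (poly_halfplane \<times> UNIV) (G k)" using G by (auto simp: gram_solution_def)
    then show "psd_kernel_on (J k) (\<lambda>i j. G k (snd i) (snd j))"
      by (rule psd_kernel_on_pullback) (auto simp: J_def inj_on_def)
  qed
  from gram_representation[OF e this]
  obtain \<eta> :: "'n \<times> (complex ^ 'n) \<times> 'u \<Rightarrow> 'w" where \<eta>: "\<And>i j. cinner (\<eta> i) (\<eta> j) = K i j" by blast
  show ?thesis
  proof (rule exI[of _ "\<lambda>k z u. \<eta> (k, z, u)"], intro ballI allI)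
    fix z \<zeta> :: "complex ^ 'n" and k l u v
    assume z: "z \<in> poly_halfplane" and \<zeta>: "\<zeta> \<in> poly_halfplane"
    have "K (k, z, u) (l, \<zeta>, v) = (\<Sum>m\<in>UNIV. if m = k then if k = l then G k (z, u) (\<zeta>, v) else 0 else 0)"
      unfolding K_def by (intro sum.cong[OF refl]) (use z \<zeta> in \<open>auto simp: J_def\<close>)
    then show "cinner (\<eta> (k, z, u)) (\<eta> (l, \<zeta>, v)) = (if k = l then G k (z, u) (\<zeta>, v) else 0)"
      by (simp add: \<eta>)
  qed
qed

section \<open>Operator models from a kernel decomposition\<close>

text \<open>The common starting point of both operator models: vectors \<open>\<eta> k z u\<close> whose Gram matrices solve the
  kernel identity for \<open>f\<close>.  They span orthogonal subspaces \<open>M k\<close> of one space, which carry a conjugation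
  \<open>\<kappa>\<close> with \<open>\<kappa> (\<eta> k z u) = \<eta> k (cnj z) (\<iota> u)\<close>.\<close>

locale gram_vectors =
  fixes f :: "complex ^ 'n \<Rightarrow> 'u::chilbert_space \<Rightarrow>\<^sub>L 'u"
    and \<iota> :: "'u \<Rightarrow> 'u"
    and \<eta> :: "'n \<Rightarrow> complex ^ 'n \<Rightarrow> 'u \<Rightarrow> 'w::chilbert_space"
  assumes f_clinear: "z \<in> poly_halfplane \<Longrightarrow> clinear (blinfun_apply (f z))"
    and AUI_\<iota>: "AUI_on UNIV \<iota>"
    and \<eta>_orth: "z \<in> poly_halfplane \<Longrightarrow> \<zeta> \<in> poly_halfplane \<Longrightarrow> k \<noteq> l \<Longrightarrow> cinner (\<eta> k z u) (\<eta> l \<zeta> v) = 0"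
    and \<eta>_gram: "z \<in> poly_halfplane \<Longrightarrow> \<zeta> \<in> poly_halfplane \<Longrightarrow>
      (\<Sum>k\<in>UNIV. z $ k * cinner (\<eta> k z u) (\<eta> k \<zeta> v)) = cinner (f z u) v"
    and \<eta>_real: "z \<in> poly_halfplane \<Longrightarrow> \<zeta> \<in> poly_halfplane \<Longrightarrow>
      cinner (\<eta> k (vcnj z) (\<iota> u)) (\<eta> k (vcnj \<zeta>) (\<iota> v)) = cnj (cinner (\<eta> k z u) (\<eta> k \<zeta> v))"
begin

lemma f_accretive:
  assumes z: "z \<in> poly_halfplane"
  shows "Re (cinner (f z u) u) = (\<Sum>k\<in>UNIV. Re (z $ k) * (norm (\<eta> k z u))\<^sup>2)"
  using arg_cong[OF \<eta>_gram[OF z z, of u u], of Re] by (simp add: norm_sq_cinner)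

text \<open>The defect \<open>d\<close> of linearity satisfies \<open>\<Sum> z\<^sub>l \<langle>d\<^sub>l, d\<^sub>l\<rangle> = 0\<close>, because the right-hand side of the kernel
  identity is sesquilinear.  As the coefficients have positive real parts, the defect vanishes.\<close>

lemma \<eta>_combination:
  assumes z: "z \<in> poly_halfplane"
  shows "\<eta> k z (a *\<^sub>C u + b *\<^sub>C v) = a *\<^sub>C \<eta> k z u + b *\<^sub>C \<eta> k z v"
proof -
  define w where "w = a *\<^sub>C u + b *\<^sub>C v"
  define d where "d l = \<eta> l z w - a *\<^sub>C \<eta> l z u - b *\<^sub>C \<eta> l z v" for l
  have x: "(\<Sum>l\<in>UNIV. z $ l * cinner (\<eta> l z x) (d l)) = 0" for x
  proof -
    have "(\<Sum>l\<in>UNIV. z $ l * cinner (\<eta> l z x) (d l))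
        = (\<Sum>l\<in>UNIV. z $ l * cinner (\<eta> l z x) (\<eta> l z w))
          - cnj a * (\<Sum>l\<in>UNIV. z $ l * cinner (\<eta> l z x) (\<eta> l z u))
          - cnj b * (\<Sum>l\<in>UNIV. z $ l * cinner (\<eta> l z x) (\<eta> l z v))"
      by (simp add: d_def cinner_simps sum_subtractf sum_distrib_left right_diff_distrib mult_ac)
    also have "\<dots> = cinner (f z x) w - cnj a * cinner (f z x) u - cnj b * cinner (f z x) v"
      by (simp only: \<eta>_gram[OF z z])
    also have "\<dots> = 0" by (simp add: w_def cinner_simps)
    finally show ?thesis .
  qed
  have "(\<Sum>l\<in>UNIV. z $ l * cinner (d l) (d l))
      = (\<Sum>l\<in>UNIV. z $ l * cinner (\<eta> l z w) (d l)) - a * (\<Sum>l\<in>UNIV. z $ l * cinner (\<eta> l z u) (d l))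
        - b * (\<Sum>l\<in>UNIV. z $ l * cinner (\<eta> l z v) (d l))"
  proof -
    have "cinner (d l) y = cinner (\<eta> l z w) y - a * cinner (\<eta> l z u) y - b * cinner (\<eta> l z v) y" for l y
      by (simp add: d_def cinner_simps)
    then show ?thesis
      by (simp add: sum_subtractf sum_distrib_left right_diff_distrib mult_ac)
  qed
  then have "Re (\<Sum>l\<in>UNIV. z $ l * cinner (d l) (d l)) = 0" by (simp add: x)
  then have "(\<Sum>l\<in>UNIV. Re (z $ l) * (norm (d l))\<^sup>2) = 0"
    by (simp add: norm_sq_cinner)
  then have "Re (z $ k) * (norm (d k))\<^sup>2 = 0"
    using z by (subst (asm) sum_nonneg_eq_0_iff) (auto simp: poly_halfplane_def less_imp_le)
  then have "d k = 0" using z by (simp add: poly_halfplane_def less_le)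
  then show ?thesis unfolding d_def w_def by (simp add: diff_diff_eq)
qed

lemma \<eta>_add: "z \<in> poly_halfplane \<Longrightarrow> \<eta> k z (u + v) = \<eta> k z u + \<eta> k z v"
  using \<eta>_combination[of z k 1 u 1 v] by simp

lemma \<eta>_scaleC: "z \<in> poly_halfplane \<Longrightarrow> \<eta> k z (c *\<^sub>C u) = c *\<^sub>C \<eta> k z u"
  using \<eta>_combination[of z k c u 0 u] by simp

definition M :: "'n \<Rightarrow> 'w set" where
  "M k = ccspan {\<eta> k z u | z u. z \<in> poly_halfplane}"

definition C :: "'w set" where
  "C = ccspan {\<eta> k z u | k z u. z \<in> poly_halfplane}"

lemma closed_M: "closed_csubspace (M k)"
  unfolding M_def by (rule closed_csubspace_ccspan)

lemma closed_C: "closed_csubspace C"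
  unfolding C_def by (rule closed_csubspace_ccspan)

lemma \<eta>_in_M: "z \<in> poly_halfplane \<Longrightarrow> \<eta> k z u \<in> M k"
  unfolding M_def by (rule ccspan_superset) blast

lemma M_subset_C: "M k \<subseteq> C"
  unfolding M_def C_def by (rule ccspan_mono) blast

lemma \<eta>_in_C: "z \<in> poly_halfplane \<Longrightarrow> \<eta> k z u \<in> C"
  using \<eta>_in_M M_subset_C by blast

lemma M_orth:
  assumes "k \<noteq> l" "x \<in> M k" "y \<in> M l"
  shows "cinner x y = 0"
proof (rule orthogonal_ccspan[OF assms(2)[unfolded M_def]])
  fix b assume "b \<in> {\<eta> k z u |z u. z \<in> poly_halfplane}"
  then obtain z u where b: "b = \<eta> k z u" "z \<in> poly_halfplane" by blast
  have "cinner y b = 0"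
    by (rule orthogonal_ccspan[OF assms(3)[unfolded M_def]]) (use b assms(1) \<eta>_orth in auto)
  then show "cinner b y = 0" using cinner_commute[of b y] by simp
qed

lemma proj_\<eta>:
  assumes z: "z \<in> poly_halfplane"
  shows "proj (M k) (\<eta> l z u) = (if l = k then \<eta> k z u else 0)"
proof (cases "l = k")
  case False
  have "proj (M k) (\<eta> l z u) = 0"
    by (rule proj_unique[OF closed_M closed_csubspaceD(1)[OF closed_M]])
       (use M_orth[of k l] False \<eta>_in_M[OF z] in auto)
  then show ?thesis using False by simp
qed (simp add: proj_fixed[OF closed_M \<eta>_in_M[OF z]])

lemma sum_proj:
  assumes "x \<in> C"
  shows "(\<Sum>k\<in>UNIV. proj (M k) x) = x"
  using assms unfolding C_def
proof (induction rule: ccspan_induct)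
  case zero
  show ?case using proj_scaleC[OF closed_M, of _ 0] by simp
next
  case closed
  show ?case
    by (intro closed_Collect_eq continuous_intros
        linear_continuous_on bounded_linear_proj closed_M)
qed (auto simp: proj_\<eta> proj_add[OF closed_M] proj_scaleC[OF closed_M] sum.distrib
    scaleC_sum_right[symmetric])

lemma sum_norm_proj:
  assumes "x \<in> C"
  shows "(\<Sum>k\<in>UNIV. (norm (proj (M k) x))\<^sup>2) = (norm x)\<^sup>2"
proof -
  have "(\<Sum>k\<in>UNIV. (norm (proj (M k) x))\<^sup>2) = Re (cinner (\<Sum>k\<in>UNIV. proj (M k) x) x)"
    by (simp add: norm_sq_cinner cinner_proj_proj[OF closed_M] cinner_sum_left)
  then show ?thesis by (simp add: sum_proj[OF assms] norm_sq_cinner)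
qed

lemma conjugation_exists:
  "\<exists>\<kappa>. AUI_on C \<kappa> \<and> (\<forall>k. \<forall>z\<in>poly_halfplane. \<forall>u. \<kappa> (\<eta> k z u) = \<eta> k (vcnj z) (\<iota> u))"
proof -
  define J where "J = (UNIV :: 'n set) \<times> (poly_halfplane :: (complex ^ 'n) set) \<times> (UNIV :: 'u set)"
  define \<sigma> where "\<sigma> = (\<lambda>(k :: 'n, z :: complex ^ 'n, u :: 'u). (k, vcnj z, \<iota> u))"
  define g where "g = (\<lambda>(k, z, u). \<eta> k z u)"
  have \<iota>2: "\<iota> (\<iota> u) = u" for u using AUI_onD(2)[OF AUI_\<iota>] by simp
  have "\<exists>\<kappa>. AUI_on (ccspan (g ` J)) \<kappa> \<and> (\<forall>i\<in>J. \<kappa> (g i) = g (\<sigma> i))"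
  proof (rule AUI_extension)
    fix i j assume "i \<in> J" "j \<in> J"
    then obtain k z u l \<zeta> v where i: "i = (k, z, u)" "z \<in> poly_halfplane"
      and j: "j = (l, \<zeta>, v)" "\<zeta> \<in> poly_halfplane"
      by (auto simp: J_def)
    then show "cinner (g (\<sigma> i)) (g (\<sigma> j)) = cnj (cinner (g i) (g j))"
      by (cases "k = l") (auto simp: g_def \<sigma>_def \<eta>_real \<eta>_orth)
  qed (auto simp: J_def \<sigma>_def \<iota>2)
  moreover have "g ` J = {\<eta> k z u | k z u. z \<in> poly_halfplane}"
    by (force simp: g_def J_def image_iff)
  ultimately obtain \<kappa> where "AUI_on C \<kappa>" and \<kappa>: "\<And>i. i \<in> J \<Longrightarrow> \<kappa> (g i) = g (\<sigma> i)"
    unfolding C_def by auto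
  moreover have "\<kappa> (\<eta> k z u) = \<eta> k (vcnj z) (\<iota> u)" if "z \<in> poly_halfplane" for k z u
    using \<kappa>[of "(k, z, u)"] that by (simp add: J_def g_def \<sigma>_def)
  ultimately show ?thesis by blast
qed

definition \<kappa> :: "'w \<Rightarrow> 'w" where
  "\<kappa> = (SOME \<kappa>. AUI_on C \<kappa> \<and> (\<forall>k. \<forall>z\<in>poly_halfplane. \<forall>u. \<kappa> (\<eta> k z u) = \<eta> k (vcnj z) (\<iota> u)))"

lemma AUI_\<kappa>: "AUI_on C \<kappa>"
  and \<kappa>_\<eta>: "z \<in> poly_halfplane \<Longrightarrow> \<kappa> (\<eta> k z u) = \<eta> k (vcnj z) (\<iota> u)"
  using someI_ex[OF conjugation_exists] unfolding \<kappa>_def[symmetric] by auto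

lemma \<kappa>_M: "x \<in> M k \<Longrightarrow> \<kappa> x \<in> M k"
  unfolding M_def
proof (rule AUI_ccspan[OF closed_C AUI_\<kappa>])
  show "{\<eta> k z u |z u. z \<in> poly_halfplane} \<subseteq> C" using \<eta>_in_C by blast
  fix b assume "b \<in> {\<eta> k z u |z u. z \<in> poly_halfplane}"
  then obtain z u where b: "b = \<eta> k z u" "z \<in> poly_halfplane" by blast
  have "vcnj z \<in> poly_halfplane" using b(2) by simp
  then show "\<kappa> b \<in> ccspan {\<eta> k z u |z u. z \<in> poly_halfplane}"
    unfolding b(1) \<kappa>_\<eta>[OF b(2)] by (intro ccspan_superset) blast
qed

lemma \<kappa>_proj: "x \<in> C \<Longrightarrow> proj (M k) (\<kappa> x) = \<kappa> (proj (M k) x)"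
  by (rule proj_AUI[OF AUI_\<kappa> closed_M M_subset_C \<kappa>_M])

definition h :: "complex ^ 'n \<Rightarrow> 'u \<Rightarrow> 'w" where
  "h z u = (\<Sum>k\<in>UNIV. \<eta> k z u)"

lemma h_in_C: "z \<in> poly_halfplane \<Longrightarrow> h z u \<in> C"
  unfolding h_def by (intro closed_csubspace_sum[OF closed_C] \<eta>_in_C)

lemma proj_sum: "closed_csubspace S \<Longrightarrow> proj S (\<Sum>i\<in>F. x i) = (\<Sum>i\<in>F. proj S (x i))"
  using linear_sum[OF bounded_linear.linear[OF bounded_linear_proj]] by blast

lemma proj_h: "z \<in> poly_halfplane \<Longrightarrow> proj (M k) (h z u) = \<eta> k z u"
  by (simp add: h_def proj_sum[OF closed_M] proj_\<eta> if_distrib cong: if_cong)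

lemma h_add: "z \<in> poly_halfplane \<Longrightarrow> h z (u + v) = h z u + h z v"
  by (simp add: h_def \<eta>_add sum.distrib)

lemma h_scaleC: "z \<in> poly_halfplane \<Longrightarrow> h z (c *\<^sub>C u) = c *\<^sub>C h z u"
  by (simp add: h_def \<eta>_scaleC scaleC_sum_right)

lemma \<kappa>_h: "z \<in> poly_halfplane \<Longrightarrow> \<kappa> (h z u) = h (vcnj z) (\<iota> u)"
  unfolding h_def by (simp add: AUI_sum[OF closed_C AUI_\<kappa>] \<eta>_in_C \<kappa>_\<eta>)

lemma cinner_\<eta>_h:
  assumes "z \<in> poly_halfplane" "\<zeta> \<in> poly_halfplane"
  shows "cinner (\<eta> k z u) (h \<zeta> v) = cinner (\<eta> k z u) (\<eta> k \<zeta> v)"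
  unfolding cinner_proj_right[OF closed_M \<eta>_in_M[OF assms(1)], symmetric, of _ _ "h \<zeta> v"]
  by (simp only: proj_h[OF assms(2)])

lemma gram_h:
  assumes "z \<in> poly_halfplane" "\<zeta> \<in> poly_halfplane"
  shows "cinner (\<Sum>k\<in>UNIV. z $ k *\<^sub>C \<eta> k z u) (h \<zeta> v) = cinner (f z u) v"
  by (simp add: cinner_sum_left cinner_scaleC_left cinner_\<eta>_h[OF assms] \<eta>_gram[OF assms])

text \<open>The pencil model.  The state space \<open>\<H>\<close> is spanned by the differences \<open>h z u - h 1 u\<close>, and \<open>A\<^sub>k\<close> is
  the compression \<open>X\<^sup>* P\<^sub>k X\<close> of the \<open>k\<close>-th projection, where \<open>X (u, x) = h 1 u + x\<close>.  As \<open>X\<close> maps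
  \<open>(u, h z u - h 1 u)\<close> to \<open>h z u\<close>, the kernel identity says exactly that the pencil maps this vector to
  \<open>(f z u, 0)\<close>: differences are annihilated because the right-hand side does not depend on \<open>\<zeta>\<close>.\<close>

theorem pencil_model:
  assumes holo: "holomorphic_op_on f rotated_halfplanes"
  shows "\<exists>(H :: 'w set) A \<iota>H. closed_csubspace H \<and> bessmertnyi_representation f H A \<and> AUI_on H \<iota>H \<and>
    iota_real_fun_on rotated_halfplanes (UNIV \<times> H) (map_prod \<iota> \<iota>H) (pencil A)"
proof -
  define one :: "complex ^ 'n" where "one = (\<chi> k. 1)"
  have one: "one \<in> poly_halfplane" "vcnj one = one" and one_nth: "one $ k = 1" for k
    by (simp_all add: one_def poly_halfplane_def vcnj_def)
  define D where "D = {h z u - h one u | z u. z \<in> poly_halfplane}"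
  define H where "H = ccspan D"
  have H: "closed_csubspace H" unfolding H_def by (rule closed_csubspace_ccspan)
  have DC: "D \<subseteq> C" using h_in_C one closed_csubspaceD(6)[OF closed_C] by (auto simp: D_def)
  then have HC: "H \<subseteq> C" unfolding H_def by (rule ccspan_minimal[OF closed_C])
  have \<iota>_add: "\<iota> (u + v) = \<iota> u + \<iota> v" and \<iota>_scaleC: "\<iota> (c *\<^sub>C u) = cnj c *\<^sub>C \<iota> u" and
    \<iota>2: "\<iota> (\<iota> u) = u" for u v c
    using AUI_add[OF closed_csubspace_UNIV AUI_\<iota>] AUI_scaleC[OF closed_csubspace_UNIV AUI_\<iota>]
      AUI_onD(2)[OF AUI_\<iota>] by auto
  have \<kappa>H: "\<kappa> x \<in> H" if "x \<in> H" for x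
    unfolding H_def
  proof (rule AUI_ccspan[OF closed_C AUI_\<kappa> DC])
    fix b assume "b \<in> D"
    then obtain z u where b: "b = h z u - h one u" "z \<in> poly_halfplane" by (auto simp: D_def)
    then have "\<kappa> b = h (vcnj z) (\<iota> u) - h one (\<iota> u)"
      by (simp add: AUI_diff[OF closed_C AUI_\<kappa>] h_in_C one \<kappa>_h)
    then show "\<kappa> b \<in> ccspan D" using b by (auto simp: D_def intro!: ccspan_superset)
  qed (use that in \<open>simp add: H_def\<close>)
  define X where "X = Blinfun (\<lambda>p. h one (fst p) + proj H (snd p))"
  have X: "blinfun_apply X = (\<lambda>p. h one (fst p) + proj H (snd p))"
  proof -
    \<comment> \<open>At the real point \<open>1\<close> the kernel identity reads \<open>\<parallel>h 1 u\<parallel>\<^sup>2 = Re \<langle>f(1) u, u\<rangle>\<close>.\<close>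
    define K where "K = sqrt (norm (f one))"
    have hK: "norm (h one u) \<le> K * norm u" for u
    proof -
      have "(norm (h one u))\<^sup>2 = Re (cinner (f one u) u)"
        using f_accretive[OF one(1), of u] sum_norm_proj[OF h_in_C[OF one(1)], of u]
        by (simp add: proj_h[OF one(1)] one_nth)
      also have "\<dots> \<le> norm (f one u) * norm u" by (rule Re_cinner_le)
      also have "\<dots> \<le> (norm (f one) * norm u) * norm u"
        by (intro mult_right_mono norm_blinfun norm_ge_zero)
      also have "\<dots> = (K * norm u)\<^sup>2" by (simp add: K_def power2_eq_square)
      finally show ?thesis by (rule power2_le_imp_le) (simp add: K_def)
    qed
    have "bounded_linear (\<lambda>p. h one (fst p) + proj H (snd p))"
    proof (rule bounded_linear_add)
      have "bounded_linear (h one)"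
        by (rule bounded_linear_intro[where K = K])
           (use hK in \<open>auto simp: h_add[OF one(1)] h_scaleC[OF one(1)] scaleR_scaleC mult.commute\<close>)
      then show "bounded_linear (\<lambda>p :: 'u \<times> 'w. h one (fst p))"
        by (rule bounded_linear_compose) (rule bounded_linear_fst)
      show "bounded_linear (\<lambda>p :: 'u \<times> 'w. proj H (snd p))"
        by (rule bounded_linear_compose[OF bounded_linear_proj[OF H] bounded_linear_snd])
    qed
    then show ?thesis unfolding X_def by (rule bounded_linear_Blinfun_apply)
  qed
  have X_clinear: "clinear (blinfun_apply X)"
    by (rule clinearI) (simp_all add: X h_add[OF one(1)] h_scaleC[OF one(1)] proj_add[OF H]
        proj_scaleC[OF H] scaleC_add_right)
  define A where "A k p = cadj X (proj (M k) (X p))" for k p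
  have A: "cinner (A k p) q = cinner (proj (M k) (X p)) (X q)" for k p q
    unfolding A_def by (rule cinner_cadj_left[OF X_clinear])
  define S where "S = (UNIV :: 'u set) \<times> H"
  have S: "closed_csubspace S" unfolding S_def by (intro closed_csubspace_Times closed_csubspace_UNIV H)
  have cadj_S: "cadj X w \<in> S" for w
  proof -
    have "snd (cadj X w) = proj H w"
    proof (rule cinner_eqI)
      fix x
      have "h one 0 = 0" using h_scaleC[OF one(1), of 0 0] by simp
      then have "cinner (cadj X w) (0, x) = cinner w (proj H x)"
        by (simp add: cinner_cadj_left[OF X_clinear] X)
      then show "cinner (snd (cadj X w)) x = cinner (proj H w) x"
        by (simp add: cinner_prod_def cinner_proj_swap[OF H])
    qed
    then show ?thesis using proj_in[OF H] by (cases "cadj X w") (auto simp: S_def)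
  qed
  have A_ops: "A k \<in> bounded_ops S" for k
  proof (rule bounded_opsI)
    show "A k p \<in> S" for p unfolding A_def by (rule cadj_S)
    show "A k (p + q) = A k p + A k q" for p q
      by (simp add: A_def clinear_simps[OF X_clinear] proj_add[OF closed_M]
          clinear_simps[OF clinear_cadj[OF X_clinear]])
    show "A k (c *\<^sub>C p) = c *\<^sub>C A k p" for c p
      by (simp add: A_def clinear_simps[OF X_clinear] proj_scaleC[OF closed_M]
          clinear_simps[OF clinear_cadj[OF X_clinear]])
    show "norm (A k p) \<le> (norm (cadj X) * norm X) * norm p" for p
    proof -
      have "norm (A k p) \<le> norm (cadj X) * norm (proj (M k) (X p))" unfolding A_def by (rule norm_blinfun)
      also have "\<dots> \<le> norm (cadj X) * (norm X * norm p)"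
        by (intro mult_left_mono order_trans[OF norm_proj_le[OF closed_M] norm_blinfun]) auto
      finally show ?thesis by (simp add: mult.assoc)
    qed
  qed
  have A_sa: "selfadjoint_on S (A k)" for k
    unfolding selfadjoint_on_def
  proof (intro ballI)
    fix p q
    have "cinner p (A k q) = cnj (cinner (A k q) p)" by (rule cinner_commute)
    also have "\<dots> = cinner (X p) (proj (M k) (X q))" by (simp add: A cinner_commute[of "X p"])
    finally show "cinner (A k p) q = cinner p (A k q)" by (simp add: A cinner_proj_swap[OF closed_M])
  qed
  have A_psd: "psd_on S (A k)" for k
    unfolding psd_on_def
    by (simp add: A cinner_proj_proj[OF closed_M, of _ _ "X _", symmetric] complex_nonneg_Reals_iff
        flip: norm_sq_cinner)
  have pencil_A: "cinner (pencil A z p) q = (\<Sum>k\<in>UNIV. z $ k * cinner (proj (M k) (X p)) (X q))" for z p q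
    by (simp add: pencil_def cinner_sum_left cinner_scaleC_left A)
  have pencil_S: "pencil A z \<in> bounded_ops S" for z by (intro pencil_in_bounded_ops S A_ops)
  have X0: "X (0, x) = x" if "x \<in> H" for x
    using h_scaleC[OF one(1), of 0 0] that by (simp add: X proj_fixed[OF H])
  have inv: "boundedly_invertible_on H (block22 (pencil A z))" if z: "z \<in> rotated_halfplanes" for z
  proof -
    obtain l where l: "z \<in> tilted_halfplane l" using z by (auto simp: rotated_halfplanes_eq)
    \<comment> \<open>On \<open>\<H>\<close> the quadratic form of \<open>d(z)\<close> is \<open>\<Sum> z\<^sub>k \<parallel>P\<^sub>k x\<parallel>\<^sup>2\<close>, and \<open>\<Sum> \<parallel>P\<^sub>k x\<parallel>\<^sup>2 = \<parallel>x\<parallel>\<^sup>2\<close>.\<close>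
    define \<delta> where "\<delta> = Min (range (\<lambda>k. Re (cnj l * z $ k)))"
    have \<delta>: "\<delta> > 0" "\<delta> \<le> Re (cnj l * z $ k)" for k
      unfolding \<delta>_def using l by (auto simp: tilted_halfplane_def)
    show ?thesis
    proof (rule boundedly_invertible_on_coercive[OF H block22_bounded_ops[OF H pencil_S[unfolded S_def]] \<delta>(1)])
      fix x assume x: "x \<in> H"
      have "cinner (block22 (pencil A z) x) x = cinner (pencil A z (0, x)) (0, x)"
        by (simp add: block22_def cinner_prod_def)
      also have "\<dots> = (\<Sum>k\<in>UNIV. z $ k * complex_of_real ((norm (proj (M k) x))\<^sup>2))"
        by (simp add: pencil_A X0[OF x] cinner_proj_proj[OF closed_M, of _ x x, symmetric] cinner_self)
      finally have "Re (cnj l * cinner (block22 (pencil A z) x) x)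
          = (\<Sum>k\<in>UNIV. Re (cnj l * z $ k) * (norm (proj (M k) x))\<^sup>2)"
        by (simp add: sum_distrib_left mult.assoc[symmetric] del: times_complex.sel)
           (simp add: distrib_right)
      also have "\<dots> \<ge> (\<Sum>k\<in>UNIV. \<delta> * (norm (proj (M k) x))\<^sup>2)"
        by (intro sum_mono mult_right_mono \<delta>) auto
      also have "(\<Sum>k\<in>UNIV. \<delta> * (norm (proj (M k) x))\<^sup>2) = \<delta> * (norm x)\<^sup>2"
        using sum_norm_proj[of x] x HC by (simp add: sum_distrib_left[symmetric] subset_iff)
      finally show "\<delta> * (norm x)\<^sup>2 \<le> Re (cnj l * cinner (block22 (pencil A z) x) x)" .
    qed
  qed
  have sol: "\<exists>y\<in>H. pencil A z (u, y) = (f z u, 0)" if z: "z \<in> poly_halfplane" for z u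
  proof
    define y where "y = h z u - h one u"
    show y: "y \<in> H" unfolding H_def y_def by (rule ccspan_superset) (use z in \<open>auto simp: D_def\<close>)
    have Xy: "X (u, y) = h z u" by (simp add: X proj_fixed[OF H y]) (simp add: y_def)
    define g where "g = (\<Sum>k\<in>UNIV. z $ k *\<^sub>C \<eta> k z u)"
    have gH: "cinner x g = 0" if "x \<in> H" for x
    proof (rule orthogonal_ccspan[OF that[unfolded H_def]])
      fix b assume "b \<in> D"
      then obtain \<zeta> v where b: "b = h \<zeta> v - h one v" "\<zeta> \<in> poly_halfplane" by (auto simp: D_def)
      have "cinner g b = 0"
        unfolding g_def b(1) cinner_diff_right by (simp add: gram_h[OF z b(2)] gram_h[OF z one(1)])
      then show "cinner b g = 0" using cinner_commute[of b g] by simp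
    qed
    show "pencil A z (u, y) = (f z u, 0)"
    proof (rule cinner_eqI)
      fix q
      have "cinner (pencil A z (u, y)) q = cinner g (X q)"
        by (simp add: pencil_A Xy proj_h[OF z] g_def cinner_sum_left cinner_scaleC_left)
      also have "\<dots> = cinner g (h one (fst q)) + cinner g (proj H (snd q))"
        by (simp add: X cinner_add_right)
      also have "cinner g (proj H (snd q)) = 0"
        using gH[OF proj_in[OF H]] cinner_commute[of g] by simp
      also have "cinner g (h one (fst q)) = cinner (f z u) (fst q)"
        unfolding g_def by (rule gram_h[OF z one(1)])
      finally show "cinner (pencil A z (u, y)) q = cinner (f z u, 0) q"
        by (simp add: cinner_prod_def)
    qed
  qed
  have rep: "bessmertnyi_representation f H A"
    by (rule bessmertnyi_representation_extend[OF H holo A_ops[unfolded S_def] A_sa[unfolded S_def]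
          A_psd[unfolded S_def] inv sol])
  define J where "J = map_prod \<iota> \<kappa>"
  have AUI_H: "AUI_on H \<kappa>" by (rule AUI_subset[OF AUI_\<kappa> HC \<kappa>H])
  have J: "AUI_on S J" unfolding J_def S_def by (rule AUI_map_prod[OF AUI_\<iota> AUI_H])
  have XC: "X p \<in> C" if "p \<in> S" for p
    using that HC h_in_C[OF one(1)] proj_in[OF H]
    by (auto simp: X S_def intro!: closed_csubspaceD(2)[OF closed_C])
  have XJ: "X (J p) = \<kappa> (X p)" if "p \<in> S" for p
  proof -
    have "snd p \<in> H" "\<kappa> (snd p) \<in> H" using that \<kappa>H by (auto simp: S_def)
    then show ?thesis
      using \<kappa>_h[OF one(1), of "fst p"] HC
      by (auto simp: X J_def proj_fixed[OF H] AUI_add[OF closed_C AUI_\<kappa>] h_in_C one subset_iff)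
  qed
  have AJ: "J (A k (J p)) = A k p" if p: "p \<in> S" for k p
  proof (rule AUI_eqI[OF S J])
    note JS = AUI_onD(1)[OF J]
    have AS: "A k p \<in> S" for p unfolding A_def by (rule cadj_S)
    show "J (A k (J p)) \<in> S" "A k p \<in> S" by (intro JS AS)+
    fix w assume w: "w \<in> S"
    have "cinner (J (A k (J p))) (J w) = cinner w (A k (J p))"
      by (rule AUI_onD(3)[OF J AS w])
    also have "\<dots> = cnj (cinner (\<kappa> (proj (M k) (X p))) (X w))"
      by (simp add: A XJ[OF p] \<kappa>_proj[OF XC[OF p]] cinner_commute[of w])
    also have "\<dots> = cinner (X w) (\<kappa> (proj (M k) (X p)))" by (simp add: cinner_commute[of "X w"])
    also have "\<dots> = cinner (proj (M k) (X p)) (\<kappa> (X w))"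
      using proj_in[OF closed_M] M_subset_C by (intro AUI_swap[OF AUI_\<kappa>] XC w) blast
    also have "\<dots> = cinner (A k p) (J w)" by (simp add: A XJ[OF w])
    finally show "cinner (J (A k (J p))) (J w) = cinner (A k p) (J w)" .
  qed
  have "iota_real_fun_on rotated_halfplanes S J (pencil A)"
    unfolding iota_real_fun_on_def sharp_def
  proof (intro ballI)
    fix z :: "complex ^ 'n" and p assume p: "p \<in> S"
    have AS: "A k p \<in> S" for k p unfolding A_def by (rule cadj_S)
    have "J (pencil A (vcnj z) (J p)) = (\<Sum>k\<in>UNIV. z $ k *\<^sub>C J (A k (J p)))"
      unfolding pencil_def
      by (simp add: AUI_sum[OF S J] AUI_scaleC[OF S J] AS closed_csubspaceD(3)[OF S])
    then show "J (pencil A (vcnj z) (J p)) = pencil A z p" by (simp add: AJ[OF p] pencil_def)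
  qed
  then show ?thesis using H rep AUI_H unfolding S_def J_def by blast
qed

end

section \<open>Colligations and the double Cayley transform\<close>

lemma closed_csubspace_orth_sum:
  assumes "\<And>k. closed_csubspace (X k)"
  shows "closed_csubspace (orth_sum X)"
proof -
  have eq: "orth_sum X = (\<Inter>k. {x. x $ k \<in> X k})" by (auto simp: orth_sum_def)
  have "closed {x. x $ k \<in> X k}" for k
    using continuous_closed_vimage[OF closed_csubspaceD(4)[OF assms[of k]], of "\<lambda>x. x $ k"]
    by (auto simp: vimage_def intro!: continuous_intros)
  then have "closed (orth_sum X)" unfolding eq by (intro closed_INT) auto
  then show ?thesis
    using closed_csubspaceD[OF assms] by (auto simp: closed_csubspace_def orth_sum_def)
qed

lemma pencil_coord_proj: "pencil coord_proj c x = (\<chi> k. c $ k *\<^sub>C x $ k)"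
  by (simp add: pencil_def coord_proj_def vec_eq_iff if_distrib[of "(*\<^sub>C) _"] cong: if_cong)

lemma pencil_coord_proj_nth [simp]: "pencil coord_proj c x $ k = c $ k *\<^sub>C x $ k"
  by (simp add: pencil_coord_proj)

lemma pencil_coord_proj_in:
  "(\<And>k. closed_csubspace (X k)) \<Longrightarrow> x \<in> orth_sum X \<Longrightarrow> pencil coord_proj c x \<in> orth_sum X"
  by (auto simp: orth_sum_def intro: closed_csubspaceD(3))

lemma unitary_onD:
  assumes "unitary_on S U"
  shows "U \<in> bounded_ops S" "x \<in> S \<Longrightarrow> U x \<in> S"
    "x \<in> S \<Longrightarrow> y \<in> S \<Longrightarrow> cinner (U x) (U y) = cinner x y"
    "x \<in> S \<Longrightarrow> norm (U x) = norm x"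
  using assms by (auto simp: unitary_on_def norm_eq_sqrt_cinner)

lemma agler_unitary_colligationD:
  assumes "agler_unitary_colligation X U"
  shows "closed_csubspace (X k)" "closed_csubspace (orth_sum X)"
    "unitary_on (orth_sum X \<times> UNIV) U" "closed_csubspace (orth_sum X \<times> (UNIV :: 'u::chilbert_space set))"
  using assms
  by (auto simp: agler_unitary_colligation_def intro: closed_csubspace_orth_sum
      intro!: closed_csubspace_Times closed_csubspace_UNIV)

lemma colligation_blocks:
  assumes "agler_unitary_colligation X U" and x: "x \<in> orth_sum X"
  shows "U (x, u) = (block11 U x + block12 U u, block21 U x + block22 U u)"
proof -
  note c = agler_unitary_colligationD[OF assms(1)]
  have "U ((x, 0) + (0, u)) = U (x, 0) + U (0, u)"
    by (rule bounded_opsD(2)[OF unitary_onD(1)[OF c(3)]]) (use x closed_csubspaceD(1)[OF c(2)] in auto)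
  then show ?thesis by (simp add: block11_def block12_def block21_def block22_def prod_eq_iff)
qed

text \<open>Since \<open>A\<close> is a contraction and \<open>\<parallel>P(w)\<parallel> \<le> r < 1\<close>, the operator \<open>I - A P(w)\<close> is coercive with constant \<open>1 - r\<close>.\<close>

lemma colligation_boundedly_invertible:
  fixes U :: "('h::chilbert_space ^ 'n) \<times> 'u::chilbert_space \<Rightarrow> ('h ^ 'n) \<times> 'u"
  assumes "agler_unitary_colligation X U" and w: "w \<in> polydisc"
  shows "boundedly_invertible_on (orth_sum X) (\<lambda>x. x - block11 U (pencil coord_proj w x))"
    "(\<lambda>x. x - block11 U (pencil coord_proj w x)) ` orth_sum X \<subseteq> orth_sum X"
proof -
  note c = agler_unitary_colligationD[OF assms(1)]
  let ?S = "orth_sum X" and ?P = "pencil coord_proj w"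
  let ?T = "\<lambda>x. x - block11 U (?P x)"
  note S = closed_csubspaceD[OF c(2)]
  note P_in = pencil_coord_proj_in[OF c(1)]
  note U = bounded_opsD[OF unitary_onD(1)[OF c(3)]]
  define r where "r = Max (range (\<lambda>k. cmod (w $ k)))"
  have "r \<in> range (\<lambda>k. cmod (w $ k))" unfolding r_def by (rule Max_in) auto
  then have r: "r < 1" "0 \<le> r" using w by (auto simp: polydisc_def)
  have rk: "cmod (w $ k) \<le> r" for k unfolding r_def by (rule Max_ge) auto
  have normP: "norm (?P x) \<le> r * norm x" for x :: "'h ^ 'n"
    unfolding norm_vec_def L2_set_right_distrib[OF r(2)]
    by (rule L2_set_mono) (auto simp: norm_scaleC intro!: mult_right_mono rk)
  have norm11: "norm (block11 U x) \<le> norm x" if "x \<in> ?S" for x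
    using norm_fst_le[of "fst (U (x, 0))" "snd (U (x, 0))"] unitary_onD(4)[OF c(3), of "(x, 0)"] that
    by (simp add: block11_def norm_Pair)
  have in11: "block11 U x \<in> ?S" if "x \<in> ?S" for x
    using U(1)[of "(x, 0)"] that by (auto simp: block11_def)
  have add11: "block11 U (x + y) = block11 U x + block11 U y" if "x \<in> ?S" "y \<in> ?S" for x y
    using U(2)[of "(x, 0)" "(y, 0)"] that by (simp add: block11_def)
  have scale11: "block11 U (a *\<^sub>C x) = a *\<^sub>C block11 U x" if "x \<in> ?S" for a x
    using U(3)[of "(x, 0)" a] that by (simp add: block11_def scaleC_prod_def)
  have P_lin: "?P (x + y) = ?P x + ?P y" "?P (a *\<^sub>C x) = a *\<^sub>C ?P x" for x y a
    by (simp_all add: vec_eq_iff scaleC_add_right scaleC_scaleC mult.commute)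
  have T: "?T \<in> bounded_ops ?S"
  proof (rule bounded_opsI)
    show "?T x \<in> ?S" if "x \<in> ?S" for x by (intro S(6) in11 P_in that)
    show "?T (x + y) = ?T x + ?T y" if "x \<in> ?S" "y \<in> ?S" for x y
      by (simp add: P_lin add11[OF P_in[OF that(1)] P_in[OF that(2)]])
    show "?T (a *\<^sub>C x) = a *\<^sub>C ?T x" if "x \<in> ?S" for a x
      by (simp add: P_lin scale11[OF P_in[OF that]] scaleC_diff_right)
    show "norm (?T x) \<le> (1 + r) * norm x" if "x \<in> ?S" for x
      using norm_triangle_ineq4[of x "block11 U (?P x)"] order_trans[OF norm11[OF P_in[OF that]] normP]
      by (simp add: distrib_right)
  qed
  then show "?T ` ?S \<subseteq> ?S" by (auto dest: bounded_opsD(1))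
  show "boundedly_invertible_on ?S ?T"
  proof (rule boundedly_invertible_on_coercive[OF c(2) T, where \<delta> = "1 - r" and \<mu> = 1])
    show "(1 - r) * (norm x)\<^sup>2 \<le> Re (1 * cinner (?T x) x)" if x: "x \<in> ?S" for x
    proof -
      have "Re (cinner (block11 U (?P x)) x) \<le> norm (block11 U (?P x)) * norm x" by (rule Re_cinner_le)
      also have "\<dots> \<le> (r * norm x) * norm x"
        by (intro mult_right_mono order_trans[OF norm11[OF P_in[OF x]] normP]) auto
      finally show ?thesis
        by (simp add: cinner_diff_left norm_sq_cinner[symmetric] power2_eq_square algebra_simps)
    qed
  qed (use r in auto)
qed

text \<open>As for the Schur complement, the inverse is traded for an auxiliary state \<open>x\<close>.\<close>

lemma transfer_function_iff:
  fixes U :: "('h::chilbert_space ^ 'n) \<times> 'u::chilbert_space \<Rightarrow> ('h ^ 'n) \<times> 'u"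
  assumes "agler_unitary_colligation X U" and w: "w \<in> polydisc"
  shows "transfer_function X U w u = y \<longleftrightarrow> (\<exists>x\<in>orth_sum X. U (pencil coord_proj w x, u) = (x, y))"
proof -
  note c = agler_unitary_colligationD[OF assms(1)]
  define P where "P = (pencil coord_proj w :: 'h ^ 'n \<Rightarrow> _)"
  define T where "T = (\<lambda>x. x - block11 U (P x))"
  note inv = boundedly_invertible_onD[OF colligation_boundedly_invertible[OF assms],
      folded P_def, folded T_def]
  define x where "x = inv_into (orth_sum X) T (block12 U u)"
  have "block12 U u \<in> orth_sum X"
    using bounded_opsD(1)[OF unitary_onD(1)[OF c(3)], of "(0, u)"] closed_csubspaceD(1)[OF c(2)]
    by (auto simp: block12_def)
  note x = inv(1,2)[OF this, folded x_def]
  have P_in: "P x \<in> orth_sum X" if "x \<in> orth_sum X" for x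
    unfolding P_def by (rule pencil_coord_proj_in[OF c(1) that])
  have tf: "transfer_function X U w u = block22 U u + block21 U (P x)"
    by (simp add: transfer_function_def Let_def x_def T_def P_def)
  have blocks: "U (P x, u) = (block11 U (P x) + block12 U u, block21 U (P x) + block22 U u)"
    if "x \<in> orth_sum X" for x
    by (rule colligation_blocks[OF assms(1) P_in[OF that]])
  have uniq: "x' = x" if "x' \<in> orth_sum X" "block11 U (P x') + block12 U u = x'" for x'
  proof -
    have "x' - block11 U (P x') = block12 U u" using that(2) by (simp add: algebra_simps)
    then show ?thesis using inv(3)[OF x(1) that(1)] by (simp add: x_def)
  qed
  have "U (P x, u) = (x, transfer_function X U w u)"
    using x(2) by (simp add: blocks[OF x(1)] tf T_def algebra_simps)
  then show ?thesis
    unfolding P_def[symmetric] using x(1) uniq blocks by (metis Pair_inject)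
qed

lemma cayley_denominators:
  assumes "0 < Re z"
  shows "z + 1 \<noteq> 0" "cmod ((z - 1) / (z + 1)) < 1"
    "(1 + (z - 1) / (z + 1)) / (1 - (z - 1) / (z + 1)) = z"
proof -
  show nz: "z + 1 \<noteq> 0" using assms by (auto simp: complex_eq_iff)
  have "(cmod (z - 1))\<^sup>2 < (cmod (z + 1))\<^sup>2"
    unfolding cmod_power2 using assms by (simp add: power2_eq_square algebra_simps)
  then have "cmod (z - 1) < cmod (z + 1)" by (rule power_less_imp_less_base) simp
  then show "cmod ((z - 1) / (z + 1)) < 1" using nz by (simp add: norm_divide divide_simps)
  have "1 + (z - 1) / (z + 1) = 2 * z / (z + 1)" "1 - (z - 1) / (z + 1) = 2 / (z + 1)"
    using nz by (simp_all add: field_simps)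
  then show "(1 + (z - 1) / (z + 1)) / (1 - (z - 1) / (z + 1)) = z" using nz by simp
qed

lemma inverse_cayley:
  assumes "cmod w < 1"
  shows "0 < Re ((1 + w) / (1 - w))" "w * ((1 + w) / (1 - w) + 1) = (1 + w) / (1 - w) - 1"
proof -
  have nz: "1 - w \<noteq> 0" using assms by auto
  have "Re ((1 + w) * cnj (1 - w)) = 1 - (cmod w)\<^sup>2"
    unfolding cmod_power2 by (simp add: power2_eq_square algebra_simps)
  moreover have "(cmod w)\<^sup>2 < 1" using assms by (simp add: abs_square_less_1)
  ultimately have "0 < Re ((1 + w) * cnj (1 - w))" by simp
  moreover have "(1 + w) / (1 - w) = ((1 + w) * cnj (1 - w)) / complex_of_real ((cmod (1 - w))\<^sup>2)"
    using nz by (simp add: complex_norm_square del: of_real_power)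
  ultimately show "0 < Re ((1 + w) / (1 - w))"
    using nz by (simp del: of_real_power times_complex.sel)
  show "w * ((1 + w) / (1 - w) + 1) = (1 + w) / (1 - w) - 1"
    using nz by (simp add: field_simps)
qed

text \<open>In half-plane coordinates, with the substitution \<open>x = (z + 1) g\<close> for the state and
  \<open>u\<^sub>1 = f(z) u + u\<close> for the input, the transfer function representation becomes a statement without
  inverses.  Both coordinates \<open>w\<close> and \<open>z = (1 + w) / (1 - w)\<close> run through their whole domain.\<close>

lemma cayley_transfer_function_iff:
  fixes f :: "complex ^ 'n \<Rightarrow> 'u::chilbert_space \<Rightarrow>\<^sub>L 'u"
    and U :: "('h::chilbert_space ^ 'n) \<times> 'u \<Rightarrow> ('h ^ 'n) \<times> 'u"
  assumes XU: "agler_unitary_colligation X U" and df: "double_cayley_defined f"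
  shows "(\<forall>w\<in>polydisc. \<forall>u. double_cayley f w u = transfer_function X U w u) \<longleftrightarrow>
    (\<forall>z\<in>poly_halfplane. \<forall>u. \<exists>g\<in>orth_sum X.
      U (pencil coord_proj (\<chi> k. z $ k - 1) g, f z u + u) = (pencil coord_proj (\<chi> k. z $ k + 1) g, f z u - u))"
    (is "?L \<longleftrightarrow> ?R")
proof -
  note c = agler_unitary_colligationD[OF XU]
  have cay: "double_cayley f w (cayley_arg f w u + u) = cayley_arg f w u - u"
    and surj: "\<exists>u. u1 = cayley_arg f w u + u" if w: "w \<in> polydisc" for w u u1
  proof -
    have inv: "boundedly_invertible_on UNIV (\<lambda>u. cayley_arg f w u + u)"
      using df w by (simp add: double_cayley_defined_def)
    note i = boundedly_invertible_onD[OF inv subset_UNIV UNIV_I]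
    show "double_cayley f w (cayley_arg f w u + u) = cayley_arg f w u - u"
      using i(3)[of u] by (simp add: double_cayley_def)
    show "\<exists>u. u1 = cayley_arg f w u + u" using i(2)[of u1] by metis
  qed
  show ?thesis
  proof (intro iffI ballI allI)
    assume L: ?L
    fix z :: "complex ^ 'n" and u assume z: "z \<in> poly_halfplane"
    then have zk: "0 < Re (z $ k)" for k by (simp add: poly_halfplane_def)
    define w :: "complex ^ 'n" where "w = (\<chi> k. (z $ k - 1) / (z $ k + 1))"
    have w: "w \<in> polydisc" by (simp add: polydisc_def w_def cayley_denominators[OF zk])
    have "cayley_arg f w = f z"
      unfolding cayley_arg_def by (simp add: w_def cayley_denominators(3)[OF zk])
    then have "transfer_function X U w (f z u + u) = f z u - u" using L w cay[OF w, of u] by simp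
    then obtain x where x: "x \<in> orth_sum X" "U (pencil coord_proj w x, f z u + u) = (x, f z u - u)"
      unfolding transfer_function_iff[OF XU w] by blast
    define g where "g = pencil coord_proj (\<chi> k. inverse (z $ k + 1)) x"
    have "pencil coord_proj (\<chi> k. z $ k + 1) g = x" "pencil coord_proj (\<chi> k. z $ k - 1) g = pencil coord_proj w x"
      by (simp_all add: vec_eq_iff g_def w_def scaleC_scaleC cayley_denominators(1)[OF zk] divide_inverse)
    moreover have "g \<in> orth_sum X" unfolding g_def by (rule pencil_coord_proj_in[OF c(1) x(1)])
    ultimately show "\<exists>g\<in>orth_sum X. U (pencil coord_proj (\<chi> k. z $ k - 1) g, f z u + u)
        = (pencil coord_proj (\<chi> k. z $ k + 1) g, f z u - u)"
      using x(2) by metis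
  next
    assume R: ?R
    fix w :: "complex ^ 'n" and u1 assume w: "w \<in> polydisc"
    then have wk: "cmod (w $ k) < 1" for k by (simp add: polydisc_def)
    define z :: "complex ^ 'n" where "z = (\<chi> k. (1 + w $ k) / (1 - w $ k))"
    have z: "z \<in> poly_halfplane" by (simp add: poly_halfplane_def z_def inverse_cayley[OF wk] del: Re_divide)
    have fz: "cayley_arg f w = f z" by (simp add: cayley_arg_def z_def)
    obtain u where u: "u1 = f z u + u" using surj[OF w, of u1] fz by auto
    obtain g where g: "g \<in> orth_sum X" "U (pencil coord_proj (\<chi> k. z $ k - 1) g, u1)
        = (pencil coord_proj (\<chi> k. z $ k + 1) g, f z u - u)"
      using R z u by blast
    define x where "x = pencil coord_proj (\<chi> k. z $ k + 1) g"
    have "pencil coord_proj w x = pencil coord_proj (\<chi> k. z $ k - 1) g"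
      by (simp add: vec_eq_iff x_def scaleC_scaleC z_def inverse_cayley(2)[OF wk])
    then have "U (pencil coord_proj w x, u1) = (x, f z u - u)" using g(2) by (simp add: x_def)
    then have "transfer_function X U w u1 = f z u - u"
      unfolding transfer_function_iff[OF XU w]
      using pencil_coord_proj_in[OF c(1) g(1)] by (auto simp: x_def)
    then show "double_cayley f w u1 = transfer_function X U w u1"
      using cay[OF w, of u] by (simp add: u fz)
  qed
qed

text \<open>Pairing with \<open>coord_proj k x\<close> isolates the \<open>k\<close>-th coordinate; the involution respects this because it
  commutes with the coordinate projections.\<close>

lemma AUI_orth_sum_coordinate:
  fixes X :: "'n::finite \<Rightarrow> 'h::chilbert_space set"
  assumes X: "\<And>k. closed_csubspace (X k)" and \<kappa>: "AUI_on (orth_sum X) \<kappa>"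
    and comm: "\<And>k x. x \<in> orth_sum X \<Longrightarrow> \<kappa> (coord_proj k x) = coord_proj k (\<kappa> x)"
    and x: "x \<in> orth_sum X"
  shows "y \<in> orth_sum X \<Longrightarrow> cinner (\<kappa> x $ k) (\<kappa> y $ k) = cinner (y $ k) (x $ k)"
    and "\<kappa> (pencil coord_proj c x) = pencil coord_proj (vcnj c) (\<kappa> x)"
proof -
  have in_S: "coord_proj k x \<in> orth_sum X" if "x \<in> orth_sum X" for k x
    using that closed_csubspaceD(1)[OF X] by (auto simp: orth_sum_def coord_proj_def)
  have coord: "cinner (coord_proj k x) y = cinner (x $ k) (y $ k)" for k and x y :: "'h ^ 'n"
    by (simp add: cinner_vec_def coord_proj_def if_distrib[of "\<lambda>v. cinner v _"] cong: if_cong)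
  note S = closed_csubspace_orth_sum[OF X]
  show "cinner (\<kappa> x $ k) (\<kappa> y $ k) = cinner (y $ k) (x $ k)" if y: "y \<in> orth_sum X"
  proof -
    have "cinner (\<kappa> x $ k) (\<kappa> y $ k) = cinner (\<kappa> (coord_proj k x)) (\<kappa> y)"
      by (simp add: comm[OF x] coord)
    also have "\<dots> = cinner y (coord_proj k x)" by (rule AUI_onD(3)[OF \<kappa> in_S[OF x] y])
    also have "\<dots> = cinner (y $ k) (x $ k)"
      using coord[of k x y] by (metis cinner_commute)
    finally show ?thesis .
  qed
  show "\<kappa> (pencil coord_proj c x) = pencil coord_proj (vcnj c) (\<kappa> x)"
    unfolding pencil_def
    by (simp add: AUI_sum[OF S \<kappa>] AUI_scaleC[OF S \<kappa>] closed_csubspaceD(3)[OF S] in_S[OF x] comm[OF x])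
qed

text \<open>From a self-adjoint unitary \<open>U\<close> back to kernels.  With \<open>p = ((z - 1) g, f u + u)\<close> one has
  \<open>U p = ((z + 1) g, f u - u)\<close>, so that \<open>p + U p = 2 (z g, f u)\<close> and \<open>U p - p = 2 (g, -u)\<close> lie in the
  eigenspaces of \<open>U\<close> for \<open>1\<close> and \<open>-1\<close>; orthogonality of these is the kernel identity.\<close>

lemma colligation_imp_gram_solution:
  fixes f :: "complex ^ 'n \<Rightarrow> 'u::chilbert_space \<Rightarrow>\<^sub>L 'u"
    and X :: "'n \<Rightarrow> 'h::chilbert_space set"
  assumes XU: "agler_unitary_colligation X U" and sa: "selfadjoint_on (orth_sum X \<times> UNIV) U"
    and df: "double_cayley_defined f"
    and tf: "\<forall>w\<in>polydisc. \<forall>u. double_cayley f w u = transfer_function X U w u"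
    and \<iota>: "AUI_on UNIV \<iota>" and \<kappa>: "AUI_on (orth_sum X) \<kappa>"
    and comm: "\<And>k x. x \<in> orth_sum X \<Longrightarrow> \<kappa> (coord_proj k x) = coord_proj k (\<kappa> x)"
    and real: "iota_real_op_on (orth_sum X \<times> UNIV) (map_prod \<kappa> \<iota>) U"
  shows "\<exists>G. gram_solution f \<iota> G"
proof -
  note c = agler_unitary_colligationD[OF XU]
  note X_in = pencil_coord_proj_in[OF c(1)]
  have coord: "cinner (\<kappa> x $ k) (\<kappa> y $ k) = cinner (y $ k) (x $ k)"
      "\<kappa> (pencil coord_proj a x) = pencil coord_proj (vcnj a) (\<kappa> x)"
    if "x \<in> orth_sum X" "y \<in> orth_sum X" for x y k a
    using AUI_orth_sum_coordinate[OF c(1) \<kappa> _ that(1)] comm that(2) by blast+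
  define S where "S = orth_sum X \<times> (UNIV :: 'u set)"
  define sol where "sol z g u v \<longleftrightarrow> g \<in> orth_sum X \<and>
    U (pencil coord_proj (\<chi> k. z $ k - 1) g, v + u) = (pencil coord_proj (\<chi> k. z $ k + 1) g, v - u)"
    for z :: "complex ^ 'n" and g u v
  have kernel_id: "(\<Sum>k\<in>UNIV. z $ k * cinner (g $ k) (g' $ k)) = cinner v u'"
    if "sol z g u v" "sol z' g' u' v'" for z z' :: "complex ^ 'n" and g g' u u' v v'
  proof -
    define p where "p = (pencil coord_proj (\<chi> k. z $ k - 1) g, v + u)"
    define q where "q = (pencil coord_proj (\<chi> k. z' $ k - 1) g', v' + u')"
    have pq: "p \<in> S" "q \<in> S" using that X_in by (auto simp: p_def q_def S_def sol_def)
    have "cinner (U p) q = cinner p (U q)"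
      using sa pq unfolding selfadjoint_on_def S_def by blast
    then have "cinner (p + U p) (U q - q) = 0"
      using unitary_onD(3)[OF c(3), folded S_def, OF pq] by (simp add: cinner_simps)
    moreover have "p + U p = 2 *\<^sub>C (pencil coord_proj z g, v)"
      using that(1) by (simp add: sol_def p_def scaleC_two vec_eq_iff scaleC_add_left scaleC_diff_left)
    moreover have "U q - q = 2 *\<^sub>C (g', - u')"
      using that(2) by (simp add: sol_def q_def scaleC_two vec_eq_iff scaleC_add_left scaleC_diff_left)
    ultimately have "cinner (pencil coord_proj z g, v) (g', - u') = 0"
      by (simp add: cinner_scaleC_left cinner_scaleC_right)
    then show ?thesis by (simp add: cinner_prod_def cinner_vec_def cinner_simps)
  qed
  have "\<forall>z\<in>poly_halfplane. \<forall>u. \<exists>g. sol z g u (f z u)"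
    using tf unfolding cayley_transfer_function_iff[OF XU df] sol_def by blast
  then obtain g where g: "\<And>z u. z \<in> poly_halfplane \<Longrightarrow> sol z (g z u) u (f z u)" by metis
  \<comment> \<open>The kernel identity shows uniqueness of the state \<open>g\<close>, which therefore commutes with the conjugation.\<close>
  have unique: "a = a'" if z: "z \<in> poly_halfplane" and s: "sol z a u v" "sol z a' u v'" for z a a' u v v'
  proof -
    have *: "(\<Sum>k\<in>UNIV. z $ k * cinner ((a - a') $ k) (b $ k)) = cinner (v - v') u'"
      if "sol z' b u' w" for z' b u' w
      using kernel_id[OF s(1) that] kernel_id[OF s(2) that]
      by (simp add: cinner_diff_left right_diff_distrib sum_subtractf)
    have "(\<Sum>k\<in>UNIV. z $ k * cinner ((a - a') $ k) ((a - a') $ k))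
        = cinner (v - v') u - cinner (v - v') u"
      using *[OF s(1)] *[OF s(2)]
      by (simp add: cinner_diff_right right_diff_distrib sum_subtractf)
    then have "Re (\<Sum>k\<in>UNIV. z $ k * cinner ((a - a') $ k) ((a - a') $ k)) = 0" by simp
    then have "(\<Sum>k\<in>UNIV. Re (z $ k) * (norm ((a - a') $ k))\<^sup>2) = 0" by (simp add: norm_sq_cinner)
    then have "Re (z $ k) * (norm ((a - a') $ k))\<^sup>2 = 0" for k
      using z by (subst (asm) sum_nonneg_eq_0_iff) (auto simp: poly_halfplane_def less_imp_le)
    then show ?thesis using z by (simp add: poly_halfplane_def vec_eq_iff less_le)
  qed
  have \<iota>_add: "\<iota> (u + v) = \<iota> u + \<iota> v" "\<iota> (u - v) = \<iota> u - \<iota> v" for u v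
    using AUI_add[OF closed_csubspace_UNIV \<iota>] AUI_diff[OF closed_csubspace_UNIV \<iota>] by auto
  have conj: "sol (vcnj z) (\<kappa> a) (\<iota> u) (\<iota> v)" if s: "sol z a u v" for z a u v
  proof -
    have a: "a \<in> orth_sum X" using s by (simp add: sol_def)
    have vc: "vcnj (\<chi> k. z $ k - 1) = (\<chi> k. vcnj z $ k - 1)" "vcnj (\<chi> k. z $ k + 1) = (\<chi> k. vcnj z $ k + 1)"
      by (simp_all add: vec_eq_iff)
    have "map_prod \<kappa> \<iota> (U (pencil coord_proj (\<chi> k. z $ k - 1) a, v + u))
        = U (map_prod \<kappa> \<iota> (pencil coord_proj (\<chi> k. z $ k - 1) a, v + u))"
      using real X_in[OF a] unfolding iota_real_op_on_def by blast
    then show ?thesis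
      using s AUI_onD(1)[OF \<kappa> a] unfolding sol_def by (simp add: coord(2)[OF a a] vc \<iota>_add)
  qed
  have g_real: "g (vcnj z) (\<iota> u) = \<kappa> (g z u)" if z: "z \<in> poly_halfplane" for z u
    by (rule unique[of "vcnj z", OF _ g conj[OF g]]) (use z in auto)
  have gS: "g z u \<in> orth_sum X" if "z \<in> poly_halfplane" for z u using g[OF that] by (simp add: sol_def)
  define G where "G k p q = cinner (g (fst p) (snd p) $ k) (g (fst q) (snd q) $ k)" for k p q
  have "gram_solution f \<iota> G"
    unfolding gram_solution_def
  proof (intro conjI allI ballI)
    show "psd_kernel_on (poly_halfplane \<times> UNIV) (G k)" for k
      unfolding G_def by (rule psd_kernel_on_gram)
    fix z \<zeta> :: "complex ^ 'n" and u v assume z: "z \<in> poly_halfplane" and \<zeta>: "\<zeta> \<in> poly_halfplane"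
    show "(\<Sum>k\<in>UNIV. z $ k * G k (z, u) (\<zeta>, v)) = cinner (f z u) v"
      using kernel_id[OF g[OF z] g[OF \<zeta>]] by (simp add: G_def)
    show "G k (vcnj z, \<iota> u) (vcnj \<zeta>, \<iota> v) = cnj (G k (z, u) (\<zeta>, v))" for k
      using coord(1)[OF gS[OF z] gS[OF \<zeta>]] by (simp add: G_def g_real z \<zeta>) (rule cinner_commute)
  qed
  then show ?thesis by blast
qed

context gram_vectors
begin

text \<open>The colligation model.  Here \<open>U = I - 2 P\<^sub>L\<close> is the reflection along the closed span \<open>L\<close> of the
  vectors \<open>(- \<eta>(z) u, u)\<close>.  The kernel identity says that \<open>(z \<eta>(z) u, f(z) u)\<close> is orthogonal to \<open>L\<close>.  Hence the sum
  \<open>((z - 1) \<eta>(z) u, f(z) u + u)\<close> of these two vectors is reflected to their difference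
  \<open>((z + 1) \<eta>(z) u, f(z) u - u)\<close>, which is the transfer function relation in half-plane coordinates.\<close>

theorem colligation_model:
  shows "double_cayley_defined f \<and>
    (\<exists>(X :: 'n \<Rightarrow> 'w set) U \<iota>X.
       agler_unitary_colligation X U \<and> selfadjoint_on (orth_sum X \<times> UNIV) U \<and>
       (\<forall>w\<in>polydisc. \<forall>u. double_cayley f w u = transfer_function X U w u) \<and>
       AUI_on (orth_sum X) \<iota>X \<and>
       (\<forall>k. \<forall>x\<in>orth_sum X. \<iota>X (coord_proj k x) = coord_proj k (\<iota>X x)) \<and>
       iota_real_op_on (orth_sum X \<times> UNIV) (map_prod \<iota>X \<iota>) U)"
proof -
  have df: "double_cayley_defined f"
    unfolding double_cayley_defined_def
  proof
    fix w :: "complex ^ 'n" assume "w \<in> polydisc"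
    then have z: "(\<chi> k. (1 + w $ k) / (1 - w $ k)) \<in> poly_halfplane" (is "?z \<in> _")
      by (simp add: poly_halfplane_def polydisc_def inverse_cayley del: Re_divide)
    note fl = clinear_simps[OF f_clinear[OF z]]
    show "boundedly_invertible_on UNIV (\<lambda>u. cayley_arg f w u + u)"
      unfolding cayley_arg_def
    proof (rule boundedly_invertible_on_coercive[OF closed_csubspace_UNIV, where \<delta> = 1 and \<mu> = 1])
      show "(\<lambda>u. f ?z u + u) \<in> bounded_ops UNIV"
      proof (rule bounded_opsI)
        show "norm (f ?z u + u) \<le> (norm (f ?z) + 1) * norm u" for u
          using norm_triangle_ineq[of "f ?z u" u] norm_blinfun[of "f ?z" u] by (simp add: distrib_right)
      qed (simp_all add: fl scaleC_add_right)
      have "0 \<le> Re (cinner (f ?z u) u)" for u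
        unfolding f_accretive[OF z] using z
        by (intro sum_nonneg mult_nonneg_nonneg) (auto simp: poly_halfplane_def less_imp_le simp del: Re_divide)
      then show "1 * (norm u)\<^sup>2 \<le> Re (1 * cinner (f ?z u + u) u)" for u
        by (simp add: cinner_add_left norm_sq_cinner)
    qed simp
  qed
  define S where "S = orth_sum M \<times> (UNIV :: 'u set)"
  have oM: "closed_csubspace (orth_sum M)" by (rule closed_csubspace_orth_sum[OF closed_M])
  have S: "closed_csubspace S" unfolding S_def by (intro closed_csubspace_Times oM closed_csubspace_UNIV)
  define H where "H z u = (\<chi> k. \<eta> k z u)" for z u
  have H_in: "H z u \<in> orth_sum M" if "z \<in> poly_halfplane" for z u
    using \<eta>_in_M[OF that] by (simp add: orth_sum_def H_def)
  define D where "D = {(- H z u, u) | z u. z \<in> poly_halfplane}"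
  define L where "L = ccspan D"
  have L: "closed_csubspace L" unfolding L_def by (rule closed_csubspace_ccspan)
  have DS: "D \<subseteq> S" using H_in closed_csubspaceD(5)[OF oM] by (auto simp: D_def S_def)
  then have LS: "L \<subseteq> S" unfolding L_def by (rule ccspan_minimal[OF S])
  define U where "U p = p - 2 *\<^sub>C proj L p" for p
  have U_in: "U p \<in> S" if "p \<in> S" for p
    unfolding U_def by (intro closed_csubspaceD[OF S] that subsetD[OF LS proj_in[OF L]])
  have U_add: "U (p + q) = U p + U q" and U_scaleC: "U (c *\<^sub>C p) = c *\<^sub>C U p" for p q c
    by (simp_all add: U_def proj_add[OF L] proj_scaleC[OF L] scaleC_add_right scaleC_diff_right
        scaleC_scaleC mult.commute)
  have U_sa: "cinner (U p) q = cinner p (U q)" for p q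
    by (simp add: U_def cinner_simps cinner_proj_swap[OF L])
  have U_invol: "U (U p) = p" for p
  proof -
    have "proj L (p - 2 *\<^sub>C proj L p) = proj L p - 2 *\<^sub>C proj L p"
      using proj_add[OF L, of "p - 2 *\<^sub>C proj L p" "2 *\<^sub>C proj L p"]
      by (simp add: proj_scaleC[OF L] proj_fixed[OF L proj_in[OF L]] eq_diff_eq)
    then have "U (U p) = p - 2 *\<^sub>C proj L p - 2 *\<^sub>C proj L p + (2 * 2) *\<^sub>C proj L p"
      by (simp add: U_def scaleC_diff_right scaleC_scaleC)
    also have "(2 * 2 :: complex) *\<^sub>C proj L p = 2 *\<^sub>C proj L p + 2 *\<^sub>C proj L p"
      by (simp flip: scaleC_add_left)
    finally show ?thesis by simp
  qed
  have U_iso: "cinner (U p) (U q) = cinner p q" for p q by (simp add: U_sa U_invol)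
  have "unitary_on S U"
    unfolding unitary_on_def
  proof (intro conjI ballI)
    show "U \<in> bounded_ops S"
    proof (rule bounded_opsI)
      show "norm (U p) \<le> 1 * norm p" for p by (simp add: norm_eq_sqrt_cinner U_iso)
    qed (auto simp: U_in U_add U_scaleC)
    show "U ` S = S" using U_in U_invol by (metis (no_types, lifting) image_iff subsetI subset_antisym image_subsetI)
  qed (rule U_iso)
  then have coll: "agler_unitary_colligation M U"
    by (simp add: agler_unitary_colligation_def closed_M S_def)
  have sa: "selfadjoint_on (orth_sum M \<times> UNIV) U" by (simp add: selfadjoint_on_def U_sa)
  have "\<forall>z\<in>poly_halfplane. \<forall>u. \<exists>g\<in>orth_sum M.
      U (pencil coord_proj (\<chi> k. z $ k - 1) g, f z u + u) = (pencil coord_proj (\<chi> k. z $ k + 1) g, f z u - u)"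
  proof (intro ballI allI bexI)
    fix z :: "complex ^ 'n" and u assume z: "z \<in> poly_halfplane"
    let ?p = "(pencil coord_proj (\<chi> k. z $ k - 1) (H z u), f z u + u)"
    let ?r = "(pencil coord_proj z (H z u), blinfun_apply (f z) u)"
    have pr: "?p = ?r + (- H z u, u)" by (simp add: vec_eq_iff scaleC_diff_left)
    have orth: "cinner b ?r = 0" if "b \<in> L" for b
    proof (rule orthogonal_ccspan[OF that[unfolded L_def]])
      fix b assume "b \<in> D"
      then obtain \<zeta> v where b: "b = (- H \<zeta> v, v)" "\<zeta> \<in> poly_halfplane" by (auto simp: D_def)
      have "cinner ?r b = 0"
        using \<eta>_gram[OF z b(2), of u v]
        by (simp add: b(1) cinner_prod_def cinner_vec_def H_def cinner_simps sum_negf)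
      then show "cinner b ?r = 0" using cinner_commute[of b ?r] by simp
    qed
    have "proj L ?p = (- H z u, u)"
    proof (rule proj_unique[OF L])
      show "(- H z u, u) \<in> L" unfolding L_def by (rule ccspan_superset) (use z in \<open>auto simp: D_def\<close>)
      show "cinner y (- H z u, u) = cinner y ?p" if "y \<in> L" for y
        unfolding pr cinner_add_right by (simp add: orth[OF that])
    qed
    then show "U ?p = (pencil coord_proj (\<chi> k. z $ k + 1) (H z u), f z u - u)"
      by (simp add: U_def scaleC_two vec_eq_iff scaleC_diff_left scaleC_add_left)
    show "H z u \<in> orth_sum M" by (rule H_in[OF z])
  qed
  then have tf: "\<forall>w\<in>polydisc. \<forall>u. double_cayley f w u = transfer_function M U w u"
    unfolding cayley_transfer_function_iff[OF coll df] .
  define \<iota>X where "\<iota>X x = (\<chi> k. \<kappa> (x $ k))" for x :: "'w ^ 'n"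
  have \<kappa>C: "cinner (\<kappa> x) (\<kappa> y) = cinner y x" "\<kappa> (\<kappa> x) = x" if "x \<in> M k" "y \<in> M k" for x y k
    using that M_subset_C AUI_onD[OF AUI_\<kappa>] by blast+
  have AUI_X: "AUI_on (orth_sum M) \<iota>X"
    unfolding AUI_on_def
  proof (intro conjI ballI)
    show "\<iota>X ` orth_sum M \<subseteq> orth_sum M" using \<kappa>_M by (auto simp: orth_sum_def \<iota>X_def)
    show "\<iota>X (\<iota>X x) = x" if "x \<in> orth_sum M" for x
      using that by (auto simp: orth_sum_def \<iota>X_def vec_eq_iff intro: \<kappa>C(2))
    show "cinner (\<iota>X x) (\<iota>X y) = cinner y x" if "x \<in> orth_sum M" "y \<in> orth_sum M" for x y
      unfolding cinner_vec_def \<iota>X_def using that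
      by (intro sum.cong[OF refl]) (auto simp: orth_sum_def intro: \<kappa>C(1))
  qed
  have comm: "\<iota>X (coord_proj k x) = coord_proj k (\<iota>X x)" for k x
    by (simp add: \<iota>X_def coord_proj_def vec_eq_iff AUI_zero[OF closed_C AUI_\<kappa>])
  define J where "J = map_prod \<iota>X \<iota>"
  have J: "AUI_on S J" unfolding J_def S_def by (rule AUI_map_prod[OF AUI_X AUI_\<iota>])
  have JL: "J p \<in> L" if "p \<in> L" for p
    unfolding L_def
  proof (rule AUI_ccspan[OF S J DS])
    fix b assume "b \<in> D"
    then obtain z u where b: "b = (- H z u, u)" "z \<in> poly_halfplane" by (auto simp: D_def)
    have "J b = (- H (vcnj z) (\<iota> u), \<iota> u)"
      using b by (simp add: J_def \<iota>X_def H_def vec_eq_iff AUI_minus[OF closed_C AUI_\<kappa>] \<eta>_in_C \<kappa>_\<eta>)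
    then show "J b \<in> ccspan D" using b by (auto simp: D_def intro!: ccspan_superset)
  qed (use that in \<open>simp add: L_def\<close>)
  have "iota_real_op_on S J U"
    unfolding iota_real_op_on_def
  proof
    fix p assume p: "p \<in> S"
    have "proj L p \<in> S" by (rule subsetD[OF LS proj_in[OF L]])
    then show "J (U p) = U (J p)"
      using p by (simp add: U_def proj_AUI[OF J L LS JL] AUI_diff[OF S J] AUI_scaleC[OF S J]
          closed_csubspaceD(3)[OF S])
  qed
  then show ?thesis using df coll sa tf AUI_X comm unfolding S_def J_def by blast
qed

end

section \<open>Holomorphic real kernels from a real pencil\<close>

lemma cadj_scaleC:
  assumes "clinear (blinfun_apply T)"
  shows "cadj (c *\<^sub>C T) = cnj c *\<^sub>C cadj T"
proof (rule blinfun_eqI, rule cinner_eqI)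
  fix y v
  have "clinear (blinfun_apply (c *\<^sub>C T))"
    by (rule clinearI) (simp_all add: clinear_simps[OF assms] scaleC_add_right scaleC_scaleC mult.commute)
  then show "cinner (cadj (c *\<^sub>C T) y) v = cinner ((cnj c *\<^sub>C cadj T) y) v"
    by (simp add: cinner_cadj_left assms cinner_simps)
qed

lemma pencil_kernel_unique:
  assumes H: "closed_csubspace H" and rep: "bessmertnyi_representation f H A"
    and z: "z \<in> rotated_halfplanes"
    and p: "p \<in> {u} \<times> H" "snd (pencil A z p) = 0" and q: "q \<in> {u} \<times> H" "snd (pencil A z q) = 0"
  shows "p = q"
proof -
  have S: "closed_csubspace (UNIV \<times> H)" by (intro closed_csubspace_Times closed_csubspace_UNIV H)
  have T: "pencil A z \<in> bounded_ops (UNIV \<times> H)"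
    by (rule pencil_in_bounded_ops[OF S bessmertnyi_representationD(1)[OF rep]])
  have d: "snd p - snd q \<in> H" using p q closed_csubspaceD(6)[OF H] by auto
  have "block22 (pencil A z) (snd p - snd q) = snd (pencil A z (p - q))"
  proof -
    have "p - q = (0, snd p - snd q)" using p q by (auto simp: prod_eq_iff)
    then show ?thesis by (simp only: block22_def)
  qed
  also have "pencil A z (p - q) = pencil A z p - pencil A z q"
    by (rule bounded_ops_diff[OF S T]) (use p q in auto)
  also have "snd \<dots> = 0" using p q by simp
  finally have "block22 (pencil A z) (snd p - snd q) = block22 (pencil A z) 0"
    using bounded_opsD(3)[OF block22_bounded_ops[OF H T] closed_csubspaceD(1)[OF H], of 0] by simp
  moreover have "block22 (pencil A z) ` H \<subseteq> H"
    using bounded_opsD(1)[OF block22_bounded_ops[OF H T]] by auto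
  ultimately have "snd p - snd q = 0"
    using boundedly_invertible_onD(3)[OF bessmertnyi_representationD(4)[OF rep z]] d
      closed_csubspaceD(1)[OF H] by metis
  then show ?thesis using p q by (auto simp: prod_eq_iff)
qed

text \<open>The coefficient \<open>A\<^sub>k\<close> is the difference of the pencil at two real points of \<open>\<Pi>\<^sup>N\<close>.\<close>

lemma real_pencil_imp_real_coefficients:
  fixes A :: "'n::finite \<Rightarrow> 'u::chilbert_space \<times> 'h::chilbert_space \<Rightarrow> 'u \<times> 'h"
  assumes S: "closed_csubspace S" and A: "\<And>k. A k \<in> bounded_ops S" and J: "AUI_on S J"
    and real: "iota_real_fun_on rotated_halfplanes S J (pencil A)" and p: "p \<in> S"
  shows "A k (J p) = J (A k p)"
proof -
  define a :: "complex ^ 'n" where "a = (\<chi> j. 1)"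
  define b :: "complex ^ 'n" where "b = (\<chi> j. if j = k then 2 else 1)"
  have ab: "a \<in> rotated_halfplanes" "b \<in> rotated_halfplanes" "vcnj a = a" "vcnj b = b"
    using poly_halfplane_subset_rotated by (auto simp: a_def b_def poly_halfplane_def vcnj_def vec_eq_iff)
  have diff: "pencil A b x = pencil A a x + A k x" for x
  proof -
    have "pencil A b x = (\<Sum>j\<in>UNIV. a $ j *\<^sub>C A j x + (if j = k then A j x else 0))"
      unfolding pencil_def by (rule sum.cong) (auto simp: a_def b_def scaleC_add_left[of 1 1, simplified])
    then show ?thesis by (simp add: pencil_def sum.distrib)
  qed
  have Jp: "J p \<in> S" by (rule AUI_onD(1)[OF J p])
  have R: "J (pencil A c (J p)) = pencil A c p" if "c \<in> {a, b}" for c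
    using real ab p that by (auto simp: iota_real_fun_on_def sharp_def)
  have "pencil A b p = J (pencil A a (J p) + A k (J p))" using R[of b] by (simp add: diff)
  also have "\<dots> = pencil A a p + J (A k (J p))"
  proof -
    have "pencil A a (J p) \<in> S" by (rule bounded_opsD(1)[OF pencil_in_bounded_ops[OF S A] Jp])
    from AUI_add[OF S J this bounded_opsD(1)[OF A Jp]] R[of a] show ?thesis by simp
  qed
  finally have "A k p = J (A k (J p))" by (simp add: diff)
  then show ?thesis using AUI_onD(2)[OF J bounded_opsD(1)[OF A Jp]] by simp
qed

text \<open>The kernels are \<open>\<Phi>\<^sub>k(z, \<zeta>) = \<psi>(\<zeta>)\<^sup>* A\<^sub>k \<psi>(z)\<close>, where \<open>\<psi>(z) u\<close> solves \<open>A(z) (\<psi>(z) u) = (f(z) u, 0)\<close>.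
  Pairing this equation with \<open>\<psi>(\<zeta>) v\<close>, whose first component is \<open>v\<close>, gives the decomposition of \<open>f\<close>.\<close>

theorem real_pencil_imp_real_kernels:
  fixes f :: "complex ^ 'n \<Rightarrow> 'u::chilbert_space \<Rightarrow>\<^sub>L 'u" and H :: "'h::chilbert_space set"
  assumes \<iota>: "AUI_on UNIV \<iota>" and H: "closed_csubspace H" and rep: "bessmertnyi_representation f H A"
    and \<iota>H: "AUI_on H \<iota>H"
    and real: "iota_real_fun_on rotated_halfplanes (UNIV \<times> H) (map_prod \<iota> \<iota>H) (pencil A)"
  shows "\<exists>\<Phi> :: 'n \<Rightarrow> complex ^ 'n \<Rightarrow> complex ^ 'n \<Rightarrow> 'u \<Rightarrow>\<^sub>L 'u.
    (\<forall>k. holomorphic_psd_kernel poly_halfplane (\<Phi> k) \<and> iota_real_kernel_on poly_halfplane \<iota> (\<Phi> k)) \<and>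
    (\<forall>z\<in>poly_halfplane. \<forall>\<zeta>\<in>poly_halfplane. f z = (\<Sum>k\<in>UNIV. z $ k *\<^sub>C \<Phi> k z \<zeta>))"
proof -
  obtain \<psi> :: "complex ^ 'n \<Rightarrow> 'u \<Rightarrow>\<^sub>L ('u \<times> 'h)" and B :: "'n \<Rightarrow> ('u \<times> 'h) \<Rightarrow>\<^sub>L ('u \<times> 'h)" where
    B0: "\<forall>k. clinear (blinfun_apply (B k)) \<and> (\<forall>p\<in>UNIV \<times> H. B k p = A k p)" and
    \<psi>0: "\<forall>z\<in>rotated_halfplanes. clinear (blinfun_apply (\<psi> z)) \<and>
      (\<forall>u. \<psi> z u \<in> {u} \<times> H \<and> pencil A z (\<psi> z u) = (f z u, 0)) \<and>
      (\<exists>D. clinear D \<and> (\<forall>h. clinear (blinfun_apply (D h))) \<and> (\<psi> has_derivative D) (at z))"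
    using bessmertnyi_solution_operator[OF H rep] by metis
  define S where "S = (UNIV :: 'u set) \<times> H"
  have S: "closed_csubspace S" unfolding S_def by (intro closed_csubspace_Times closed_csubspace_UNIV H)
  note sub = subsetD[OF poly_halfplane_subset_rotated]
  have Bl: "clinear (blinfun_apply (B k))" and BA: "p \<in> S \<Longrightarrow> B k p = A k p" for k p
    using B0 by (auto simp: S_def)
  have \<psi>l: "clinear (blinfun_apply (\<psi> z))" and \<psi>u: "\<psi> z u \<in> {u} \<times> H" and
    \<psi>f: "pencil A z (\<psi> z u) = (f z u, 0)" if "z \<in> poly_halfplane" for z u
    using \<psi>0 sub[OF that] by auto
  have \<psi>S: "\<psi> z u \<in> S" if "z \<in> poly_halfplane" for z u using \<psi>u[OF that, of u] by (auto simp: S_def)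
  note A = bessmertnyi_representationD[OF rep, folded S_def]
  define \<Phi> where "\<Phi> k z \<zeta> = cadj (\<psi> \<zeta>) o\<^sub>L (B k o\<^sub>L \<psi> z)" for k z \<zeta>
  have \<Phi>: "cinner (\<Phi> k z \<zeta> u) v = cinner (A k (\<psi> z u)) (\<psi> \<zeta> v)"
    if "z \<in> poly_halfplane" "\<zeta> \<in> poly_halfplane" for k z \<zeta> u v
    by (simp add: \<Phi>_def cinner_cadj_left[OF \<psi>l[OF that(2)]] BA[OF \<psi>S[OF that(1)]])
  have \<Phi>l: "clinear (blinfun_apply (\<Phi> k z \<zeta>))"
    if "z \<in> poly_halfplane" "\<zeta> \<in> poly_halfplane" for k z \<zeta>
    by (rule clinearI) (simp_all add: \<Phi>_def clinear_simps[OF \<psi>l[OF that(1)]] clinear_simps[OF Bl]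
        clinear_simps[OF clinear_cadj[OF \<psi>l[OF that(2)]]])
  have sym: "cinner (\<Phi> k z \<zeta> u) v = cinner u (\<Phi> k \<zeta> z v)"
    if z: "z \<in> poly_halfplane" and \<zeta>: "\<zeta> \<in> poly_halfplane" for k z \<zeta> u v
  proof -
    have "cinner u (\<Phi> k \<zeta> z v) = cnj (cinner (A k (\<psi> \<zeta> v)) (\<psi> z u))"
      by (simp add: \<Phi>[OF \<zeta> z, symmetric] cinner_commute[of u])
    also have "\<dots> = cinner (\<psi> z u) (A k (\<psi> \<zeta> v))" by (rule cinner_commute[symmetric])
    also have "\<dots> = cinner (A k (\<psi> z u)) (\<psi> \<zeta> v)"
      using A(2)[of k] \<psi>S[OF z] \<psi>S[OF \<zeta>] by (simp add: selfadjoint_on_def)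
    finally show ?thesis by (simp add: \<Phi>[OF z \<zeta>])
  qed
  note comp_right = bounded_linear.has_derivative[OF
      bounded_bilinear.bounded_linear_right[OF bounded_bilinear_blinfun_compose]]
  note comp_left = bounded_linear.has_derivative[OF
      bounded_bilinear.bounded_linear_left[OF bounded_bilinear_blinfun_compose]]
  have holo: "holomorphic_op_on (\<lambda>z. \<Phi> k z \<zeta>) poly_halfplane" if \<zeta>: "\<zeta> \<in> poly_halfplane" for k \<zeta>
    unfolding holomorphic_op_on_def
  proof (intro ballI conjI)
    fix z :: "complex ^ 'n" assume z: "z \<in> poly_halfplane"
    show "clinear (blinfun_apply (\<Phi> k z \<zeta>))" by (rule \<Phi>l[OF z \<zeta>])
    obtain D where D: "clinear D" "(\<psi> has_derivative D) (at z)" using \<psi>0 sub[OF z] by blast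
    have "((\<lambda>z. \<Phi> k z \<zeta>) has_derivative (\<lambda>h. cadj (\<psi> \<zeta>) o\<^sub>L (B k o\<^sub>L D h))) (at z)"
      unfolding \<Phi>_def by (intro comp_right D)
    moreover have "clinear (\<lambda>h. cadj (\<psi> \<zeta>) o\<^sub>L (B k o\<^sub>L D h))"
      by (rule clinearI; rule blinfun_eqI)
         (simp_all add: clinear_simps[OF D(1)] blinfun.add_left clinear_simps[OF Bl]
           clinear_simps[OF clinear_cadj[OF \<psi>l[OF \<zeta>]]])
    ultimately show "\<exists>D. clinear D \<and> ((\<lambda>z. \<Phi> k z \<zeta>) has_derivative D) (at z)" by blast
  qed
  have antiholo: "antiholomorphic_op_on (\<lambda>\<zeta>. \<Phi> k z \<zeta>) poly_halfplane" if z: "z \<in> poly_halfplane" for k z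
    unfolding antiholomorphic_op_on_def
  proof (intro ballI conjI)
    fix \<zeta> :: "complex ^ 'n" assume \<zeta>: "\<zeta> \<in> poly_halfplane"
    show "clinear (blinfun_apply (\<Phi> k z \<zeta>))" by (rule \<Phi>l[OF z \<zeta>])
    obtain D where D: "clinear D" "\<And>h. clinear (blinfun_apply (D h))" "(\<psi> has_derivative D) (at \<zeta>)"
      using \<psi>0 sub[OF \<zeta>] by blast
    have "((\<lambda>\<zeta>. \<Phi> k z \<zeta>) has_derivative (\<lambda>h. cadj (D h) o\<^sub>L (B k o\<^sub>L \<psi> z))) (at \<zeta>)"
      unfolding \<Phi>_def by (intro comp_left bounded_linear.has_derivative[OF bounded_linear_cadj] D)
    moreover have "antilinear (\<lambda>h. cadj (D h) o\<^sub>L (B k o\<^sub>L \<psi> z))"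
      unfolding antilinear_def
    proof (intro conjI allI; rule blinfun_eqI)
      have "cadj (S + T) = cadj S + cadj T" for S T :: "'u \<Rightarrow>\<^sub>L ('u \<times> 'h)"
        using bounded_linear.linear[OF bounded_linear_cadj] by (rule linear_add)
      then show "(cadj (D (x + y)) o\<^sub>L (B k o\<^sub>L \<psi> z)) u
          = ((cadj (D x) o\<^sub>L (B k o\<^sub>L \<psi> z)) + (cadj (D y) o\<^sub>L (B k o\<^sub>L \<psi> z))) u" for x y u
        by (simp add: clinear_simps[OF D(1)] blinfun.add_left)
      show "(cadj (D (c *\<^sub>C x)) o\<^sub>L (B k o\<^sub>L \<psi> z)) u = (cnj c *\<^sub>C (cadj (D x) o\<^sub>L (B k o\<^sub>L \<psi> z))) u" for c x u
        by (simp add: clinear_simps[OF D(1)] cadj_scaleC[OF D(2)])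
    qed
    ultimately show "\<exists>D. antilinear D \<and> ((\<lambda>\<zeta>. \<Phi> k z \<zeta>) has_derivative D) (at \<zeta>)" by blast
  qed
  have psd: "(\<Sum>\<mu><m. \<Sum>\<nu><m. cinner (\<Phi> k (z \<mu>) (z \<nu>) (u \<mu>)) (u \<nu>)) \<in> \<real>\<^sub>\<ge>\<^sub>0"
    if z: "\<forall>\<mu><m. z \<mu> \<in> poly_halfplane" for k m z and u :: "nat \<Rightarrow> 'u"
  proof -
    define x where "x = (\<Sum>\<mu><m. \<psi> (z \<mu>) (u \<mu>))"
    have x: "x \<in> S" unfolding x_def using z \<psi>S by (intro closed_csubspace_sum[OF S]) auto
    have "(\<Sum>\<mu><m. \<Sum>\<nu><m. cinner (\<Phi> k (z \<mu>) (z \<nu>) (u \<mu>)) (u \<nu>))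
        = (\<Sum>\<mu><m. \<Sum>\<nu><m. cinner (B k (\<psi> (z \<mu>) (u \<mu>))) (\<psi> (z \<nu>) (u \<nu>)))"
      using z by (intro sum.cong[OF refl]) (auto simp: \<Phi> BA \<psi>S)
    also have "\<dots> = cinner (B k x) x"
      by (simp add: x_def clinear_sum[OF Bl] cinner_sum_left) (simp add: cinner_sum_right)
    also have "\<dots> = cinner (A k x) x" by (simp add: BA[OF x])
    also have "\<dots> \<in> \<real>\<^sub>\<ge>\<^sub>0" using A(3)[of k] x by (simp add: psd_on_def)
    finally show ?thesis .
  qed
  define J where "J = map_prod \<iota> \<iota>H"
  have J: "AUI_on S J" unfolding J_def S_def by (rule AUI_map_prod[OF \<iota> \<iota>H])
  have AJ: "A k (J p) = J (A k p)" if "p \<in> S" for k p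
    by (rule real_pencil_imp_real_coefficients[OF S A(1) J real[folded S_def J_def] that])
  have \<psi>J: "\<psi> (vcnj z) (\<iota> u) = J (\<psi> z u)" if z: "z \<in> poly_halfplane" for z u
  proof (rule pencil_kernel_unique[OF H rep])
    have vz: "vcnj z \<in> poly_halfplane" using z by simp
    show "vcnj z \<in> rotated_halfplanes" by (rule sub[OF vz])
    show "\<psi> (vcnj z) (\<iota> u) \<in> {\<iota> u} \<times> H" by (rule \<psi>u[OF vz])
    show "snd (pencil A (vcnj z) (\<psi> (vcnj z) (\<iota> u))) = 0" by (simp add: \<psi>f[OF vz])
    show "J (\<psi> z u) \<in> {\<iota> u} \<times> H"
      using \<psi>u[OF z, of u] AUI_onD(1)[OF \<iota>H] by (auto simp: J_def)
    have "pencil A (vcnj z) (J (\<psi> z u)) = J (J (pencil A (vcnj z) (J (\<psi> z u))))"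
      by (rule AUI_onD(2)[OF J, symmetric])
         (rule bounded_opsD(1)[OF pencil_in_bounded_ops[OF S A(1)] AUI_onD(1)[OF J \<psi>S[OF z]]])
    also have "J (pencil A (vcnj z) (J (\<psi> z u))) = pencil A z (\<psi> z u)"
      using real \<psi>S[OF z] sub[OF z] unfolding iota_real_fun_on_def sharp_def J_def S_def by blast
    finally show "snd (pencil A (vcnj z) (J (\<psi> z u))) = 0"
      by (simp add: \<psi>f[OF z] J_def AUI_zero[OF H \<iota>H])
  qed
  have kernel_real: "\<iota> (\<Phi> k (vcnj z) (vcnj \<zeta>) (\<iota> u)) = \<Phi> k z \<zeta> u"
    if z: "z \<in> poly_halfplane" and \<zeta>: "\<zeta> \<in> poly_halfplane" for k z \<zeta> u
  proof (rule cinner_eqI)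
    fix v
    have AS: "A k (\<psi> z u) \<in> S" by (rule bounded_opsD(1)[OF A(1) \<psi>S[OF z]])
    have "cinner (\<iota> (\<Phi> k (vcnj z) (vcnj \<zeta>) (\<iota> u))) v = cnj (cinner (\<Phi> k (vcnj z) (vcnj \<zeta>) (\<iota> u)) (\<iota> v))"
      using AUI_swap[OF \<iota>, of "\<Phi> k (vcnj z) (vcnj \<zeta>) (\<iota> u)" v]
        cinner_commute[of "\<iota> (\<Phi> k (vcnj z) (vcnj \<zeta>) (\<iota> u))" v] by simp
    also have "\<dots> = cnj (cinner (J (A k (\<psi> z u))) (J (\<psi> \<zeta> v)))"
      using z \<zeta> by (simp add: \<Phi> \<psi>J AJ \<psi>S)
    also have "\<dots> = cinner (A k (\<psi> z u)) (\<psi> \<zeta> v)"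
      by (simp add: AUI_onD(3)[OF J AS \<psi>S[OF \<zeta>]] cinner_commute[of "A k _"])
    finally show "cinner (\<iota> (\<Phi> k (vcnj z) (vcnj \<zeta>) (\<iota> u))) v = cinner (\<Phi> k z \<zeta> u) v"
      by (simp add: \<Phi>[OF z \<zeta>])
  qed
  have decomposition: "f z = (\<Sum>k\<in>UNIV. z $ k *\<^sub>C \<Phi> k z \<zeta>)"
    if z: "z \<in> poly_halfplane" and \<zeta>: "\<zeta> \<in> poly_halfplane" for z \<zeta>
  proof (rule blinfun_eqI, rule cinner_eqI)
    fix u v
    have "cinner ((\<Sum>k\<in>UNIV. z $ k *\<^sub>C \<Phi> k z \<zeta>) u) v = cinner (pencil A z (\<psi> z u)) (\<psi> \<zeta> v)"
      by (simp add: blinfun.sum_left cinner_sum_left cinner_scaleC_left \<Phi>[OF z \<zeta>] pencil_def)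
    also have "\<dots> = cinner (f z u) v"
      using \<psi>u[OF \<zeta>, of v] by (auto simp: \<psi>f[OF z] cinner_prod_def)
    finally show "cinner (f z u) v = cinner ((\<Sum>k\<in>UNIV. z $ k *\<^sub>C \<Phi> k z \<zeta>) u) v" by simp
  qed
  have "holomorphic_psd_kernel poly_halfplane (\<Phi> k)" for k
    unfolding holomorphic_psd_kernel_def using holo antiholo sym psd by blast
  moreover have "iota_real_kernel_on poly_halfplane \<iota> (\<Phi> k)" for k
    unfolding iota_real_kernel_on_def using kernel_real by blast
  ultimately show ?thesis using decomposition by blast
qed

lemma real_kernels_imp_gram_solution:
  fixes f :: "complex ^ 'n \<Rightarrow> 'u::chilbert_space \<Rightarrow>\<^sub>L 'u"
  assumes \<iota>: "AUI_on UNIV \<iota>"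
    and \<Phi>: "\<And>k. holomorphic_psd_kernel poly_halfplane (\<Phi> k)"
      "\<And>k. iota_real_kernel_on poly_halfplane \<iota> (\<Phi> k)"
    and f: "\<And>z \<zeta>. z \<in> poly_halfplane \<Longrightarrow> \<zeta> \<in> poly_halfplane \<Longrightarrow> f z = (\<Sum>k\<in>UNIV. z $ k *\<^sub>C \<Phi> k z \<zeta>)"
  shows "\<exists>G. gram_solution f \<iota> G"
proof -
  define G where "G k p q = cinner (\<Phi> k (fst p) (fst q) (snd p)) (snd q)"
    for k and p q :: "(complex ^ 'n) \<times> 'u"
  have "gram_solution f \<iota> G"
    unfolding gram_solution_def
  proof (intro conjI allI ballI)
    fix k
    show "psd_kernel_on (poly_halfplane \<times> UNIV) (G k)"
      unfolding psd_kernel_on_def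
    proof (intro conjI ballI allI impI)
      fix p q :: "(complex ^ 'n) \<times> 'u"
      assume "p \<in> poly_halfplane \<times> UNIV" "q \<in> poly_halfplane \<times> UNIV"
      then have "fst p \<in> poly_halfplane" "fst q \<in> poly_halfplane" by auto
      then have "cinner (\<Phi> k (fst q) (fst p) (snd q)) (snd p) = cinner (snd q) (\<Phi> k (fst p) (fst q) (snd p))"
        using \<Phi>(1)[of k] unfolding holomorphic_psd_kernel_def by blast
      also have "\<dots> = cnj (cinner (\<Phi> k (fst p) (fst q) (snd p)) (snd q))" by (rule cinner_commute)
      finally show "G k q p = cnj (G k p q)" unfolding G_def .
    next
      fix F :: "((complex ^ 'n) \<times> 'u) set" and c :: "(complex ^ 'n) \<times> 'u \<Rightarrow> complex"
      assume F: "finite F" "F \<subseteq> poly_halfplane \<times> UNIV"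
      obtain e where e: "bij_betw e {..<card F} F"
        using ex_bij_betw_nat_finite[OF F(1)] by (auto simp: atLeast0LessThan)
      have eF: "e \<mu> \<in> poly_halfplane \<times> UNIV" if "\<mu> < card F" for \<mu>
        using bij_betwE[OF e] that F(2) by auto
      have lin: "clinear (blinfun_apply (\<Phi> k z \<zeta>))"
        if "z \<in> poly_halfplane" "\<zeta> \<in> poly_halfplane" for z \<zeta>
        using \<Phi>(1)[of k] that by (auto simp: holomorphic_psd_kernel_def holomorphic_op_on_def)
      have "(\<Sum>p\<in>F. \<Sum>q\<in>F. c p * cnj (c q) * G k p q)
          = (\<Sum>\<mu><card F. \<Sum>\<nu><card F. c (e \<mu>) * cnj (c (e \<nu>)) * G k (e \<mu>) (e \<nu>))"
        by (simp add: sum.reindex_bij_betw[OF e, symmetric])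
      also have "\<dots> = (\<Sum>\<mu><card F. \<Sum>\<nu><card F. cinner (\<Phi> k (fst (e \<mu>)) (fst (e \<nu>)) (c (e \<mu>) *\<^sub>C snd (e \<mu>)))
          (c (e \<nu>) *\<^sub>C snd (e \<nu>)))"
      proof (intro sum.cong[OF refl])
        fix \<mu> \<nu> assume "\<mu> \<in> {..<card F}" "\<nu> \<in> {..<card F}"
        then have "clinear (blinfun_apply (\<Phi> k (fst (e \<mu>)) (fst (e \<nu>))))"
          using eF[of \<mu>] eF[of \<nu>] by (intro lin) auto
        from clinear_simps(2)[OF this]
        show "c (e \<mu>) * cnj (c (e \<nu>)) * G k (e \<mu>) (e \<nu>) = cinner (\<Phi> k (fst (e \<mu>)) (fst (e \<nu>))
            (c (e \<mu>) *\<^sub>C snd (e \<mu>))) (c (e \<nu>) *\<^sub>C snd (e \<nu>))"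
          by (simp add: G_def cinner_scaleC_left cinner_scaleC_right)
      qed
      also have "\<dots> \<in> \<real>\<^sub>\<ge>\<^sub>0"
      proof -
        have "\<forall>\<mu><card F. fst (e \<mu>) \<in> poly_halfplane" using eF by (simp add: mem_Times_iff)
        moreover have "(\<Sum>\<mu><m. \<Sum>\<nu><m. cinner (\<Phi> k (z \<mu>) (z \<nu>) (u \<mu>)) (u \<nu>)) \<in> \<real>\<^sub>\<ge>\<^sub>0"
          if "\<forall>\<mu><m. z \<mu> \<in> poly_halfplane" for m :: nat and z u
          using \<Phi>(1)[of k] that unfolding holomorphic_psd_kernel_def by blast
        ultimately show ?thesis by simp
      qed
      finally show "0 \<le> Re (\<Sum>p\<in>F. \<Sum>q\<in>F. c p * cnj (c q) * G k p q)"
        by (simp only: complex_nonneg_Reals_iff)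
    qed
  next
    fix z \<zeta> :: "complex ^ 'n" and u v assume z: "z \<in> poly_halfplane" and \<zeta>: "\<zeta> \<in> poly_halfplane"
    show "(\<Sum>k\<in>UNIV. z $ k * G k (z, u) (\<zeta>, v)) = cinner (f z u) v"
      by (simp add: G_def f[OF z \<zeta>] blinfun.sum_left cinner_sum_left cinner_scaleC_left)
    fix k
    have "\<iota> (\<Phi> k (vcnj z) (vcnj \<zeta>) (\<iota> u)) = \<Phi> k z \<zeta> u"
      using \<Phi>(2)[of k] z \<zeta> by (simp add: iota_real_kernel_on_def)
    then have "\<Phi> k (vcnj z) (vcnj \<zeta>) (\<iota> u) = \<iota> (\<Phi> k z \<zeta> u)"
      using AUI_onD(2)[OF \<iota>, of "\<Phi> k (vcnj z) (vcnj \<zeta>) (\<iota> u)"] by simp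
    then show "G k (vcnj z, \<iota> u) (vcnj \<zeta>, \<iota> v) = cnj (G k (z, u) (\<zeta>, v))"
      using AUI_onD(3)[OF \<iota>, of "\<Phi> k z \<zeta> u" v] cinner_commute[of v "\<Phi> k z \<zeta> u"] by (simp add: G_def)
  qed
  then show ?thesis by blast
qed

text \<open>Conjugating a solution of \<open>A(cnj z) (\<iota> u, y) = (v, 0)\<close> gives a solution of \<open>A(z) (u, \<iota>\<^sub>H y) = (\<iota> v, 0)\<close>.\<close>

lemma real_pencil_imp_real_function:
  fixes f :: "complex ^ 'n \<Rightarrow> 'u::chilbert_space \<Rightarrow>\<^sub>L 'u"
  assumes H: "closed_csubspace H" and rep: "bessmertnyi_representation f H A"
    and \<iota>: "AUI_on UNIV \<iota>" and \<iota>H: "AUI_on H \<iota>H"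
    and real: "iota_real_fun_on rotated_halfplanes (UNIV \<times> H) (map_prod \<iota> \<iota>H) (pencil A)"
  shows "iota_real_fun_on rotated_halfplanes UNIV \<iota> (\<lambda>z. blinfun_apply (f z))"
  unfolding iota_real_fun_on_def sharp_def
proof (intro ballI)
  fix z :: "complex ^ 'n" and u assume z: "z \<in> rotated_halfplanes"
  obtain y where y: "y \<in> H" "pencil A (vcnj z) (\<iota> u, y) = (f (vcnj z) (\<iota> u), 0)"
    using bessmertnyi_schur[OF H rep vcnj_rotated[OF z], of "\<iota> u" "f (vcnj z) (\<iota> u)"] by blast
  have \<iota>y: "\<iota>H y \<in> H" "\<iota>H (\<iota>H y) = y" using AUI_onD[OF \<iota>H y(1)] by auto
  have "pencil A z (u, \<iota>H y) = map_prod \<iota> \<iota>H (pencil A (vcnj z) (map_prod \<iota> \<iota>H (u, \<iota>H y)))"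
    using real z \<iota>y(1) by (auto simp: iota_real_fun_on_def sharp_def)
  also have "\<dots> = (\<iota> (f (vcnj z) (\<iota> u)), 0)" by (simp add: \<iota>y(2) y(2) AUI_zero[OF H \<iota>H])
  finally have "f z u = \<iota> (f (vcnj z) (\<iota> u))"
    using bessmertnyi_schur[OF H rep z] \<iota>y(1) by blast
  then show "\<iota> (f (vcnj z) (\<iota> u)) = f z u" by simp
qed

text \<open>The standard basis of the \<open>\<ell>\<^sup>2\<close> summand of the ambient space is an orthonormal family over exactly
  the index set \<open>(k, z, u)\<close> of the Gram family.\<close>

lemma gram_solution_imp_gram_vectors:
  fixes f :: "complex ^ 'n \<Rightarrow> 'u::chilbert_space \<Rightarrow>\<^sub>L 'u"
  assumes holo: "holomorphic_op_on f rotated_halfplanes" and \<iota>: "AUI_on UNIV \<iota>" and G: "gram_solution f \<iota> G"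
  shows "\<exists>\<eta> :: 'n \<Rightarrow> complex ^ 'n \<Rightarrow> 'u \<Rightarrow> ('g::chilbert_space, 'n, 'u) ambient. gram_vectors f \<iota> \<eta>"
proof -
  define e :: "'n \<times> (complex ^ 'n) \<times> 'u \<Rightarrow> ('g, 'n, 'u) ambient" where "e i = (0, ell2_basis i)" for i
  have "cinner (e i) (e j) = (if i = j then 1 else 0)" for i j
    by (simp add: e_def cinner_prod_def cinner_ell2_basis)
  from gram_solution_vectors[OF this G]
  obtain \<eta> :: "'n \<Rightarrow> complex ^ 'n \<Rightarrow> 'u \<Rightarrow> ('g, 'n, 'u) ambient" where
    \<eta>: "\<And>z \<zeta> k l u v. z \<in> poly_halfplane \<Longrightarrow> \<zeta> \<in> poly_halfplane \<Longrightarrow>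
      cinner (\<eta> k z u) (\<eta> l \<zeta> v) = (if k = l then G k (z, u) (\<zeta>, v) else 0)"
    by blast
  have "gram_vectors f \<iota> \<eta>"
  proof
    show "clinear (blinfun_apply (f z))" if "z \<in> poly_halfplane" for z
      using holo that poly_halfplane_subset_rotated by (auto simp: holomorphic_op_on_def)
  qed (use G in \<open>auto simp: \<eta> \<iota> gram_solution_def\<close>)
  then show ?thesis by blast
qed

theorem theorem6p4:
  fixes f :: "complex ^ 'n \<Rightarrow> 'u::chilbert_space \<Rightarrow>\<^sub>L 'u"
    and \<iota> :: "'u \<Rightarrow> 'u"
  assumes "holomorphic_op_on f rotated_halfplanes"
    and "AUI_on UNIV \<iota>"
  shows
    "(f \<in> real_bessmertnyi_class TYPE(('g::chilbert_space, 'n, 'u) ambient) \<iota>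
      \<longleftrightarrow>
      (\<exists>(H :: ('g, 'n, 'u) ambient set) A \<iota>H.
         closed_csubspace H \<and> bessmertnyi_representation f H A \<and> AUI_on H \<iota>H \<and>
         iota_real_fun_on rotated_halfplanes (UNIV \<times> H) (map_prod \<iota> \<iota>H) (pencil A)))
     \<and>
     (f \<in> real_bessmertnyi_class TYPE(('g, 'n, 'u) ambient) \<iota>
      \<longleftrightarrow>
      (\<exists>\<Phi> :: 'n \<Rightarrow> complex ^ 'n \<Rightarrow> complex ^ 'n \<Rightarrow> 'u \<Rightarrow>\<^sub>L 'u.
         (\<forall>k. holomorphic_psd_kernel poly_halfplane (\<Phi> k) \<and>
              iota_real_kernel_on poly_halfplane \<iota> (\<Phi> k)) \<and>
         (\<forall>z\<in>poly_halfplane. \<forall>\<zeta>\<in>poly_halfplane. f z = (\<Sum>k\<in>UNIV. z $ k *\<^sub>C \<Phi> k z \<zeta>))))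
     \<and>
     (f \<in> real_bessmertnyi_class TYPE(('g, 'n, 'u) ambient) \<iota>
      \<longleftrightarrow>
      double_cayley_defined f \<and>
      (\<exists>(X :: 'n \<Rightarrow> ('g, 'n, 'u) ambient set) U \<iota>X.
         agler_unitary_colligation X U \<and> selfadjoint_on (orth_sum X \<times> UNIV) U \<and>
         (\<forall>w\<in>polydisc. \<forall>u. double_cayley f w u = transfer_function X U w u) \<and>
         AUI_on (orth_sum X) \<iota>X \<and>
         (\<forall>k. \<forall>x\<in>orth_sum X. \<iota>X (coord_proj k x) = coord_proj k (\<iota>X x)) \<and>
         iota_real_op_on (orth_sum X \<times> UNIV) (map_prod \<iota>X \<iota>) U))"
    (is "(?i \<longleftrightarrow> ?ii) \<and> (_ \<longleftrightarrow> ?iii) \<and> (_ \<longleftrightarrow> ?iv)")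
proof -
  note holo = assms(1) and \<iota> = assms(2)
  define gram where "gram \<longleftrightarrow> (\<exists>G. gram_solution f \<iota> G)"
  have "?i \<Longrightarrow> gram"
    unfolding gram_def by (rule bessmertnyi_imp_gram_solution[OF \<iota>])
  moreover have "gram \<Longrightarrow> ?ii"
    unfolding gram_def using gram_solution_imp_gram_vectors[OF holo \<iota>] gram_vectors.pencil_model[OF _ holo]
    by blast
  moreover have "?ii \<Longrightarrow> ?i"
    using holo real_pencil_imp_real_function[OF _ _ \<iota>]
    unfolding real_bessmertnyi_class_def bessmertnyi_class_def by blast
  moreover have "?ii \<Longrightarrow> ?iii"
    using real_pencil_imp_real_kernels[OF \<iota>] by blast
  moreover have "?iii \<Longrightarrow> gram"
    unfolding gram_def using real_kernels_imp_gram_solution[OF \<iota>] by blast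
  moreover have "gram \<Longrightarrow> ?iv"
    unfolding gram_def using gram_solution_imp_gram_vectors[OF holo \<iota>] gram_vectors.colligation_model
    by blast
  moreover have "?iv \<Longrightarrow> gram"
    unfolding gram_def using colligation_imp_gram_solution[OF _ _ _ _ \<iota>] by blast
  ultimately show ?thesis by argo
qed

end
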